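(* Let $(X,\gamma,H)$ be an abstract Wiener space and $s\in(0,1)$. Let $v\in H^1(X\times\mathbb R^+,\gamma\otimes y^{1-2s}dy)$ and let $h=Qx^*\in H$ for some $x^*\in X^*$, with $|h|_H=1$. Let $v_h^*$ be the Ehrhard symmetrisation of $v$ in direction $h$ and let $$J_1(v):=\int_{X\times\mathbb R^+}|\partial_yv|^2\,y^{1-2s}\,d\gamma(x)\,dy.$$ Then $J_1(v_h^* )\le J_1(v)$.
   Context: An abstract Wiener space is a triple $(X,\gamma,H)$ where $X$ is a separable (real) Banach space, $\gamma$ is a nondegenerate centred Gaussian measure on $X$, and $H$ is its Cameron-Martin space, defined as follows. Let $\mathcal H$ be the closure in $L^2_\gamma(X)$ of $\{x\mapsto\langle x,x^*\rangle: x^*\in X^*\}$ and let $R:\mathcal H\to X$, $R\hat h=\int_X\hat h(x)\,x\,d\gamma(x)$ (Bochner integral), which is injective; then $H=R\mathcal H$ with the inner product $[\cdot,\cdot]_H$ and norm $|\cdot|_H$ induced from $\mathcal H$ via $R$. For $h\in H$, $\hat h:=R^{-1}h$. The covariance operator is $Q:X^*\to X$, $Qx^*=R\langle\cdot,x^*\rangle$, so for $h=Qx^*$ one has $\hat h(x)=\langle x,x^*\rangle$. $\nabla_\gamma$ denotes the (closure in $L^2_\gamma$ of the) gradient along $H$: $\nabla_\gamma u=\sum_j\partial_{h_j}u\,h_j$ on smooth bounded cylindrical functions, where $(h_j)$ is an orthonormal basis of $H$ with $h_j\in QX^*$. Write $\mathbb R^+=(0,+\infty)$. $H^1(X\times\mathbb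 R^+,\gamma\otimes y^{1-2s}dy)$ is the space of $v\in H^1_{\rm loc}(X\times\mathbb R^+)$ (local Sobolev space with gradient $(\nabla_\gamma,\partial_y)$ and measure $\gamma\otimes dy$) such that $\int_{X\times\mathbb R^+}(|v|^2+|\nabla_\gamma v|_H^2+|\partial_yv|^2)y^{1-2s}d\gamma(x)dy<\infty$. Ehrhard symmetrisation: let $\gamma_1$ be the standard Gaussian measure on $\mathbb R$ and $\phi(t)=\frac1{\sqrt{2\pi}}\int_{-\infty}^te^{-r^2/2}dr$. For measurable $I\subset\mathbb R$ set $I^*=(-\infty,\phi^{-1}(\gamma_1(I)))$. For $h\in H$ with $|h|_H=1$ write $x=x'+th$ with $x'=x-\hat h(x)h$, $t=\hat h(x)\in\mathbb R$. For measurable $u:X\to\mathbb R$, $$u_h^*(x'+th)=\sup\bigl\{c\in\mathbb R:\ t\in\{u(x',\cdot)>c\}^*\bigr\},\qquad \{u(x',\cdot)>c\}=\{\tau\in\mathbb R: u(x'+\tau h)>c\}.$$ For a function $v$ on $X\times\mathbb R^+$, $v_h^*$ is obtained by symmetrising $v(\cdot,y)$ in this way for each fixed $y\in\mathbb R^+$. *)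

theory Defs
  imports "HOL-Probability.Probability"
begin

section \<open>Abstract Wiener spaces\<close>

text \<open>
  The separable Banach space is a type of class banach and second_countable_topology; its dual is
  the type of bounded linear maps to the reals. The Cameron--Martin space is determined by the
  measure, so an abstract Wiener space is given by the measure alone. Nondegenerate means that no
  nonzero functional has a Dirac law; the zero functional always has law Dirac at 0.
\<close>

definition abstract_wiener_measure :: "'a::{banach,second_countable_topology} measure \<Rightarrow> bool" where
  "abstract_wiener_measure \<gamma> \<longleftrightarrow>
     prob_space \<gamma> \<and> sets \<gamma> = sets borel \<and>
     (\<forall>xs :: 'a \<Rightarrow>\<^sub>L real. xs \<noteq> 0 \<longrightarrow>
        (\<exists>\<sigma>>0. distr \<gamma> borel (blinfun_apply xs) = density lborel (normal_density 0 \<sigma>)))"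

text \<open>
  Elements of $L^2_\gamma$ are handled through measurable representatives. The next set is the
  $L^2_\gamma$-closure of the continuous linear functionals.
\<close>

definition cm_dual :: "'a::{banach,second_countable_topology} measure \<Rightarrow> ('a \<Rightarrow> real) set" where
  "cm_dual \<gamma> = {f \<in> borel_measurable \<gamma>. integrable \<gamma> (\<lambda>x. (f x)\<^sup>2) \<and>
     (\<forall>\<epsilon>>0. \<exists>xs :: 'a \<Rightarrow>\<^sub>L real. (LINT x|\<gamma>. (f x - xs x)\<^sup>2) < \<epsilon>)}"

definition cm_R :: "'a::{banach,second_countable_topology} measure \<Rightarrow> ('a \<Rightarrow> real) \<Rightarrow> 'a" where
  "cm_R \<gamma> f = (LINT x|\<gamma>. f x *\<^sub>R x)"

definition cameron_martin :: "'a::{banach,second_countable_topology} measure \<Rightarrow> 'a set" where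
  "cameron_martin \<gamma> = cm_R \<gamma> ` cm_dual \<gamma>"

text \<open>
  A representative of $\hat h = R^{-1} h$, unique up to null sets because $R$ is injective on
  $L^2_\gamma$-classes. It is only used under integrals.
\<close>

definition cm_hat :: "'a::{banach,second_countable_topology} measure \<Rightarrow> 'a \<Rightarrow> 'a \<Rightarrow> real" where
  "cm_hat \<gamma> h = (SOME f. f \<in> cm_dual \<gamma> \<and> cm_R \<gamma> f = h)"

definition cm_inner :: "'a::{banach,second_countable_topology} measure \<Rightarrow> 'a \<Rightarrow> 'a \<Rightarrow> real" where
  "cm_inner \<gamma> h k = (LINT x|\<gamma>. cm_hat \<gamma> h x * cm_hat \<gamma> k x)"

definition cm_norm :: "'a::{banach,second_countable_topology} measure \<Rightarrow> 'a \<Rightarrow> real" where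
  "cm_norm \<gamma> h = sqrt (cm_inner \<gamma> h h)"

definition cov_op :: "'a::{banach,second_countable_topology} measure \<Rightarrow> ('a \<Rightarrow>\<^sub>L real) \<Rightarrow> 'a" where
  "cov_op \<gamma> xs = cm_R \<gamma> (blinfun_apply xs)"

definition cm_basis :: "'a::{banach,second_countable_topology} measure \<Rightarrow> 'a set \<Rightarrow> bool" where
  "cm_basis \<gamma> B \<longleftrightarrow>
     B \<subseteq> range (cov_op \<gamma>) \<and>
     (\<forall>h\<in>B. \<forall>k\<in>B. cm_inner \<gamma> h k = (if h = k then 1 else 0)) \<and>
     (\<forall>h\<in>cameron_martin \<gamma>. \<forall>\<epsilon>>0. \<exists>k\<in>span B. cm_norm \<gamma> (h - k) < \<epsilon>)"


section \<open>The gradient along the Cameron--Martin space\<close>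

primrec iter_partial :: "nat list \<Rightarrow> ((nat \<Rightarrow> real) \<Rightarrow> real) \<Rightarrow> (nat \<Rightarrow> real) \<Rightarrow> real" where
  "iter_partial [] f = f"
| "iter_partial (i # is) f = (\<lambda>z. deriv (\<lambda>t. iter_partial is f (z(i := t))) (z i))"

text \<open>
  A function on $\mathbb{R}^m$, with $m$ varying, is a function on real sequences that depends on
  the first $m$ coordinates only. The following is then $C_b^\infty(\mathbb{R}^m)$: all iterated
  partial derivatives exist, are continuous and bounded.
\<close>

definition smooth_bounded :: "nat \<Rightarrow> ((nat \<Rightarrow> real) \<Rightarrow> real) \<Rightarrow> bool" where
  "smooth_bounded m f \<longleftrightarrow>
     (\<forall>z z'. (\<forall>i<m. z i = z' i) \<longrightarrow> f z = f z') \<and>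
     (\<forall>is\<in>lists {..<m}.
        continuous_on UNIV (iter_partial is f) \<and> bounded (range (iter_partial is f)) \<and>
        (\<forall>i<m. \<forall>z. (\<lambda>t. iter_partial is f (z(i := t))) differentiable (at (z i))))"

definition smooth_cylindrical :: "('a::{banach,second_countable_topology} \<Rightarrow> real) \<Rightarrow> bool" where
  "smooth_cylindrical u \<longleftrightarrow>
     (\<exists>m f (l :: nat \<Rightarrow> 'a \<Rightarrow>\<^sub>L real). smooth_bounded m f \<and> u = (\<lambda>x. f (\<lambda>i. l i x)))"

text \<open>
  For smooth cylindrical $u$ the series converges unconditionally in $H$; as $H$ embeds continuously
  into $X$, the sum may be taken in the topology of $X$.
\<close>

definition cyl_gradient :: "'a::{banach,second_countable_topology} set \<Rightarrow> ('a \<Rightarrow> real) \<Rightarrow> 'a \<Rightarrow> 'a" where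
  "cyl_gradient B u x = (\<Sum>\<^sub>\<infinity>h\<in>B. deriv (\<lambda>t. u (x + t *\<^sub>R h)) 0 *\<^sub>R h)"

text \<open>
  The graph of $\nabla_\gamma$, the closure in $L^2_\gamma$ of the gradient on smooth cylindrical
  functions: $u$ lies in its domain with gradient $g$. It does not depend on the basis.
\<close>

definition has_cm_gradient ::
    "'a::{banach,second_countable_topology} measure \<Rightarrow> ('a \<Rightarrow> real) \<Rightarrow> ('a \<Rightarrow> 'a) \<Rightarrow> bool" where
  "has_cm_gradient \<gamma> u g \<longleftrightarrow>
     u \<in> borel_measurable \<gamma> \<and> (\<integral>\<^sup>+x. ennreal ((u x)\<^sup>2) \<partial>\<gamma>) < \<infinity> \<and>
     g \<in> borel_measurable \<gamma> \<and> (AE x in \<gamma>. g x \<in> cameron_martin \<gamma>) \<and>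
     (\<integral>\<^sup>+x. ennreal ((cm_norm \<gamma> (g x))\<^sup>2) \<partial>\<gamma>) < \<infinity> \<and>
     (\<exists>B U. cm_basis \<gamma> B \<and> (\<forall>n::nat. smooth_cylindrical (U n)) \<and>
        (\<lambda>n. \<integral>\<^sup>+x. ennreal ((U n x - u x)\<^sup>2) \<partial>\<gamma>) \<longlonglongrightarrow> 0 \<and>
        (\<lambda>n. \<integral>\<^sup>+x. ennreal ((cm_norm \<gamma> (cyl_gradient B (U n) x - g x))\<^sup>2) \<partial>\<gamma>) \<longlonglongrightarrow> 0)"


section \<open>Weighted Sobolev space on the half space\<close>

definition half_space :: "'a::{banach,second_countable_topology} measure \<Rightarrow> ('a \<times> real) measure" where
  "half_space \<gamma> = \<gamma> \<Otimes>\<^sub>M restrict_space lborel {0<..}"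

text \<open>
  Local means local in $y$: as $X$ need not be locally compact, the sets
  $X \times [a,b]$ with $0 < a < b$ play the role of the compact sets.
\<close>

definition L2_loc ::
    "'a::{banach,second_countable_topology} measure \<Rightarrow> ('a \<times> real \<Rightarrow> real) \<Rightarrow> bool" where
  "L2_loc \<gamma> v \<longleftrightarrow> v \<in> borel_measurable (half_space \<gamma>) \<and>
     (\<forall>a b. 0 < a \<and> a < b \<longrightarrow>
        (\<integral>\<^sup>+z. ennreal ((v z)\<^sup>2 * indicator (UNIV \<times> {a..b}) z) \<partial>half_space \<gamma>) < \<infinity>)"

definition test_function :: "(real \<Rightarrow> real) \<Rightarrow> bool" where
  "test_function \<eta> \<longleftrightarrow>
     (\<forall>k y. (deriv ^^ k) \<eta> differentiable (at y)) \<and>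
     (\<exists>a b. 0 < a \<and> a < b \<and> (\<forall>y. y \<notin> {a..b} \<longrightarrow> \<eta> y = 0))"

text \<open>$w$ is the weak derivative $\partial_y v$ in $L^2_{loc}(X \times \mathbb{R}^+, \gamma \otimes dy)$.\<close>

definition weak_dy ::
    "'a::{banach,second_countable_topology} measure \<Rightarrow> ('a \<times> real \<Rightarrow> real) \<Rightarrow> ('a \<times> real \<Rightarrow> real) \<Rightarrow> bool" where
  "weak_dy \<gamma> v w \<longleftrightarrow> L2_loc \<gamma> v \<and> L2_loc \<gamma> w \<and>
     (\<forall>f \<eta>. smooth_cylindrical f \<and> test_function \<eta> \<longrightarrow>
        (LINT z|half_space \<gamma>. v z * (f (fst z) * deriv \<eta> (snd z))) =
        - (LINT z|half_space \<gamma>. w z * (f (fst z) * \<eta> (snd z))))"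

text \<open>$v \in H^1_{loc}(X \times \mathbb{R}^+)$ with $\nabla_\gamma v = G$ and $\partial_y v = w$.\<close>

definition H1_loc_gradient ::
    "'a::{banach,second_countable_topology} measure \<Rightarrow> ('a \<times> real \<Rightarrow> real)
      \<Rightarrow> ('a \<times> real \<Rightarrow> 'a) \<Rightarrow> ('a \<times> real \<Rightarrow> real) \<Rightarrow> bool" where
  "H1_loc_gradient \<gamma> v G w \<longleftrightarrow>
     G \<in> borel_measurable (half_space \<gamma>) \<and> L2_loc \<gamma> (\<lambda>z. cm_norm \<gamma> (G z)) \<and>
     (AE y in restrict_space lborel {0<..}. has_cm_gradient \<gamma> (\<lambda>x. v (x, y)) (\<lambda>x. G (x, y))) \<and>
     weak_dy \<gamma> v w"

definition H1_weighted ::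
    "'a::{banach,second_countable_topology} measure \<Rightarrow> real \<Rightarrow> ('a \<times> real \<Rightarrow> real) set" where
  "H1_weighted \<gamma> s = {v. \<exists>G w. H1_loc_gradient \<gamma> v G w \<and>
     (\<integral>\<^sup>+z. ennreal (((v z)\<^sup>2 + (cm_norm \<gamma> (G z))\<^sup>2 + (w z)\<^sup>2) * snd z powr (1 - 2 * s))
        \<partial>half_space \<gamma>) < \<infinity>}"

text \<open>A representative of $\partial_y v$; it is unique almost everywhere if it exists.\<close>

definition dy :: "'a::{banach,second_countable_topology} measure \<Rightarrow> ('a \<times> real \<Rightarrow> real) \<Rightarrow> 'a \<times> real \<Rightarrow> real" where
  "dy \<gamma> v = (SOME w. weak_dy \<gamma> v w)"

text \<open>
  The value is infinite if $v$ has no weak derivative $\partial_y v$, so finiteness of the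
  functional includes weak differentiability in $y$.
\<close>

definition J1 :: "'a::{banach,second_countable_topology} measure \<Rightarrow> real \<Rightarrow> ('a \<times> real \<Rightarrow> real) \<Rightarrow> ennreal" where
  "J1 \<gamma> s v =
     (if \<exists>w. weak_dy \<gamma> v w
      then \<integral>\<^sup>+z. ennreal (\<bar>dy \<gamma> v z\<bar>\<^sup>2 * snd z powr (1 - 2 * s)) \<partial>half_space \<gamma>
      else \<infinity>)"


section \<open>Ehrhard symmetrisation\<close>

abbreviation gauss1 :: "real measure" where
  "gauss1 \<equiv> density lborel std_normal_density"

text \<open>
  $\phi$ on the extended line, a bijection of $[-\infty,\infty]$ onto $[0,1]$; thus the inverse
  takes the value $-\infty$ at 0 and $\infty$ at 1.
\<close>

definition gauss_phi :: "ereal \<Rightarrow> real" where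
  "gauss_phi t = 1 / sqrt (2 * pi) * (LBINT r=-\<infinity>..t. exp (- r\<^sup>2 / 2))"

definition ehrhard_set :: "real set \<Rightarrow> real set" where
  "ehrhard_set I = {t. ereal t < inv gauss_phi (measure gauss1 I)}"

text \<open>
  The first argument is the function $\hat h$. It is passed explicitly because the
  symmetrisation needs pointwise values; for $h = Qx^*$ it is $x^*$ itself.
\<close>

definition ehrhard_sym ::
    "('a::real_vector \<Rightarrow> real) \<Rightarrow> 'a \<Rightarrow> ('a \<Rightarrow> real) \<Rightarrow> 'a \<Rightarrow> real" where
  "ehrhard_sym hhat h u x =
     (let t = hhat x; x' = x - t *\<^sub>R h
      in Sup {c. t \<in> ehrhard_set {\<tau>. u (x' + \<tau> *\<^sub>R h) > c}})"

definition ehrhard_sym_half ::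
    "('a::real_vector \<Rightarrow> real) \<Rightarrow> 'a \<Rightarrow> ('a \<times> real \<Rightarrow> real) \<Rightarrow> 'a \<times> real \<Rightarrow> real" where
  "ehrhard_sym_half hhat h v = (\<lambda>(x, y). ehrhard_sym hhat h (\<lambda>x. v (x, y)) x)"

end

theory Submission
  imports Defs
begin

text \<open>
  Symmetrisation in the direction \<open>h\<close> acts on each horizontal slice \<open>v(\<cdot>, y)\<close> and does not increase
  the \<open>L\<^sup>2(\<gamma>)\<close> distance of two functions. Hence the curve \<open>y \<mapsto> v\<^sup>*(\<cdot>, y)\<close> in \<open>L\<^sup>2(\<gamma>)\<close> moves at
  most as fast as \<open>y \<mapsto> v(\<cdot>, y)\<close>, and the energy \<open>J\<^sub>1\<close> is the weighted integral of the squared speed.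

  The contraction (\<open>sym_contraction\<close>) is a statement on lines. If \<open>x\<close> has law \<open>\<gamma>\<close> and \<open>\<tau>\<close> is an
  independent standard Gaussian, then \<open>x - \<langle>x, x\<^sup>*\<rangle> h + \<tau> h\<close> has law \<open>\<gamma>\<close> again (\<open>gaussian_resampling\<close>), so
  that \<open>\<gamma>\<close> disintegrates into standard Gaussians on the lines parallel to \<open>h\<close>. On a line the squared
  distance of two functions is an integral over \<open>c \<le> d\<close> of the measures of \<open>{a > d} - {b > c}\<close> and
  of the sets with exchanged roles. Rearranged superlevel sets are half lines of the same measure,
  so they are nested and these differences are as small as possible (\<open>gauss_rearr_contraction\<close>).

  For the passage between speed and weak derivative, increments of \<open>v\<close> are averages of \<open>\<partial>\<^sub>yv\<close>
  (\<open>weak_dy_increment\<close>), which bounds the increments of \<open>v\<close> and hence those of \<open>v\<^sup>*\<close>. Conversely a bound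
  on weighted increments makes \<open>\<phi> \<mapsto> - \<integral> v\<^sup>* \<partial>\<^sub>y\<phi>\<close> a bounded functional on a weighted \<open>L\<^sup>2\<close> space;
  the Riesz representation theorem (\<open>L2_riesz\<close>) then provides a weak derivative of \<open>v\<^sup>*\<close> whose weighted
  norm obeys the same bound (\<open>weak_dy_from_increments\<close>).

  Two facts about separable Banach spaces enter. By the theorem of Hahn and Banach the Borel sets
  are generated by the continuous functionals, so finite measures are determined by their Fourier
  transforms (\<open>finite_measure_eq_trig\<close>). This yields both the uniqueness of weak derivatives, which
  makes \<open>J\<^sub>1\<close> independent of the chosen representative, and the invariance properties of \<open>\<gamma>\<close>. Fernique's
  argument (\<open>norm_square_integrable\<close>) shows that the Bochner integrals defining \<open>R\<close> converge, without
  which \<open>Qx\<^sup>*\<close> would not represent the covariance.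
\<close>

section \<open>Riesz representation in a space of square integrable functions\<close>

lemma square_integrable_mult:
  fixes f g :: "'b \<Rightarrow> real"
  assumes [measurable]: "f \<in> borel_measurable M" "g \<in> borel_measurable M"
    and "integrable M (\<lambda>x. (f x)\<^sup>2)" "integrable M (\<lambda>x. (g x)\<^sup>2)"
  shows "integrable M (\<lambda>x. f x * g x)"
proof (rule Bochner_Integration.integrable_bound)
  show "integrable M (\<lambda>x. (f x)\<^sup>2 + (g x)\<^sup>2)" by (intro Bochner_Integration.integrable_add assms)
  have "\<bar>f x * g x\<bar> \<le> (f x)\<^sup>2 + (g x)\<^sup>2" for x
  proof -
    have "2 * (\<bar>f x\<bar> * \<bar>g x\<bar>) \<le> (f x)\<^sup>2 + (g x)\<^sup>2"
      using sum_squares_bound[of "\<bar>f x\<bar>" "\<bar>g x\<bar>"] by (simp add: mult.assoc)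
    moreover have "0 \<le> \<bar>f x\<bar> * \<bar>g x\<bar>" by simp
    ultimately show ?thesis unfolding abs_mult by linarith
  qed
  then show "AE x in M. norm (f x * g x) \<le> norm ((f x)\<^sup>2 + (g x)\<^sup>2)" by simp
qed measurable

lemma integral_square_combination:
  fixes f g :: "'b \<Rightarrow> real"
  assumes "f \<in> borel_measurable M" "g \<in> borel_measurable M"
    and "integrable M (\<lambda>x. (f x)\<^sup>2)" "integrable M (\<lambda>x. (g x)\<^sup>2)"
  shows "integrable M (\<lambda>x. (a * f x + b * g x)\<^sup>2)"
    and "(LINT x|M. (a * f x + b * g x)\<^sup>2) =
      a\<^sup>2 * (LINT x|M. (f x)\<^sup>2) + 2 * a * b * (LINT x|M. f x * g x) + b\<^sup>2 * (LINT x|M. (g x)\<^sup>2)"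
proof -
  have eq: "(a * f x + b * g x)\<^sup>2 = a\<^sup>2 * (f x)\<^sup>2 + (2 * a * b) * (f x * g x) + b\<^sup>2 * (g x)\<^sup>2" for x
    by (simp add: power2_eq_square algebra_simps)
  note i = integrable_mult_right[OF assms(3), of "a\<^sup>2"]
    integrable_mult_right[OF square_integrable_mult[OF assms], of "2 * a * b"]
    integrable_mult_right[OF assms(4), of "b\<^sup>2"]
  show "integrable M (\<lambda>x. (a * f x + b * g x)\<^sup>2)"
    unfolding eq by (intro Bochner_Integration.integrable_add i)
  show "(LINT x|M. (a * f x + b * g x)\<^sup>2) =
      a\<^sup>2 * (LINT x|M. (f x)\<^sup>2) + 2 * a * b * (LINT x|M. f x * g x) + b\<^sup>2 * (LINT x|M. (g x)\<^sup>2)"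
    unfolding eq
    by (subst Bochner_Integration.integral_add[OF Bochner_Integration.integrable_add[OF i(1,2)] i(3)],
        subst Bochner_Integration.integral_add[OF i(1,2)]) simp
qed

text \<open>Cauchy-Schwarz against a constant, from the integral of \<open>(f - k/\<mu>)\<^sup>2\<close> with the integral \<open>k\<close> of \<open>f\<close> and the
  total mass \<open>\<mu>\<close>.\<close>

lemma nn_integral_square_ge_mean:
  fixes f :: "'b \<Rightarrow> real"
  assumes U: "finite_measure U" "0 < measure U (space U)" and [measurable]: "f \<in> borel_measurable U"
  shows "ennreal ((LINT x|U. f x)\<^sup>2) \<le> ennreal (measure U (space U)) * (\<integral>\<^sup>+x. ennreal ((f x)\<^sup>2) \<partial>U)"
proof (cases "(\<integral>\<^sup>+x. ennreal ((f x)\<^sup>2) \<partial>U) = \<infinity>")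
  case True
  then show ?thesis using U by (simp add: ennreal_mult_top)
next
  case False
  interpret finite_measure U by fact
  let ?\<mu> = "measure U (space U)"
  have sq: "integrable U (\<lambda>x. (f x)\<^sup>2)"
    using False by (intro integrableI_bounded) (auto simp: less_top)
  define k where "k = (LINT x|U. f x)"
  have "0 \<le> (LINT x|U. (1 * f x + (- k / ?\<mu>) * 1)\<^sup>2)" by (rule integral_nonneg_AE) simp
  also have "\<dots> = (LINT x|U. (f x)\<^sup>2) + 2 * (- k / ?\<mu>) * k + (- k / ?\<mu>)\<^sup>2 * ?\<mu>"
    using sq by (subst integral_square_combination(2)) (auto simp: k_def)
  also have "\<dots> = (LINT x|U. (f x)\<^sup>2) - k\<^sup>2 / ?\<mu>"
    using U(2) by (simp add: power2_eq_square field_simps)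
  finally have "k\<^sup>2 \<le> ?\<mu> * (LINT x|U. (f x)\<^sup>2)" using U(2) by (simp add: field_simps)
  then have "ennreal (k\<^sup>2) \<le> ennreal ?\<mu> * ennreal (LINT x|U. (f x)\<^sup>2)"
    by (simp add: ennreal_mult[symmetric] ennreal_leI)
  also have "ennreal (LINT x|U. (f x)\<^sup>2) = (\<integral>\<^sup>+x. ennreal ((f x)\<^sup>2) \<partial>U)"
    using sq by (intro nn_integral_eq_integral[symmetric]) auto
  finally show ?thesis by (simp add: k_def)
qed

text \<open>A sequence that converges fast enough in mean square also converges almost everywhere: the
  weighted squares \<open>4\<^sup>n (\<phi>\<^sub>n\<^sub>+\<^sub>1 - \<phi>\<^sub>n)\<^sup>2\<close> have a finite sum.\<close>

lemma fast_L2_Cauchy_AE_convergent: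
  fixes \<phi> :: "nat \<Rightarrow> 'b \<Rightarrow> real"
  assumes [measurable]: "\<And>n. \<phi> n \<in> borel_measurable M"
    and fast: "\<And>n. (\<integral>\<^sup>+x. ennreal ((\<phi> (Suc n) x - \<phi> n x)\<^sup>2) \<partial>M) \<le> ennreal ((1 / 8) ^ n)"
  shows "AE x in M. convergent (\<lambda>n. \<phi> n x)"
proof -
  define d where "d n x = ennreal (4 ^ n) * ennreal ((\<phi> (Suc n) x - \<phi> n x)\<^sup>2)" for n x
  have [measurable]: "d n \<in> borel_measurable M" for n unfolding d_def by measurable
  have "(\<integral>\<^sup>+x. (\<Sum>n. d n x) \<partial>M) = (\<Sum>n. \<integral>\<^sup>+x. d n x \<partial>M)" by (rule nn_integral_suminf) measurable
  also have "\<dots> \<le> (\<Sum>n. ennreal ((1 / 2) ^ n))"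
  proof (rule suminf_le)
    fix n
    have "(\<integral>\<^sup>+x. d n x \<partial>M) = ennreal (4 ^ n) * (\<integral>\<^sup>+x. ennreal ((\<phi> (Suc n) x - \<phi> n x)\<^sup>2) \<partial>M)"
      unfolding d_def by (rule nn_integral_cmult) measurable
    also have "\<dots> \<le> ennreal (4 ^ n) * ennreal ((1 / 8) ^ n)" by (intro mult_left_mono fast) simp
    also have "\<dots> = ennreal (4 ^ n * (1 / 8) ^ n)" by (rule ennreal_mult[symmetric]) auto
    also have "(4 ^ n * (1 / 8) ^ n :: real) = (1 / 2) ^ n" unfolding power_mult_distrib[symmetric] by simp
    finally show "(\<integral>\<^sup>+x. d n x \<partial>M) \<le> ennreal ((1 / 2) ^ n)" .
  qed simp_all
  also have "\<dots> = ennreal (\<Sum>n. (1 / 2) ^ n)"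
    by (intro suminf_ennreal2 summable_geometric) auto
  finally have "(\<integral>\<^sup>+x. (\<Sum>n. d n x) \<partial>M) < \<infinity>" by (rule le_less_trans) simp
  then have "(\<integral>\<^sup>+x. (\<Sum>n. d n x) \<partial>M) \<noteq> \<infinity>" by simp
  then have "AE x in M. (\<Sum>n. d n x) \<noteq> \<infinity>" by (intro nn_integral_PInf_AE) measurable
  then show ?thesis
  proof eventually_elim
    case (elim x)
    obtain K where K: "(\<Sum>n. d n x) = ennreal K" "0 \<le> K" using elim by (cases "\<Sum>n. d n x") auto
    have "\<bar>\<phi> (Suc n) x - \<phi> n x\<bar> \<le> sqrt K * (1 / 2) ^ n" for n
    proof -
      have "d n x \<le> ennreal K" using sum_le_suminf[of "\<lambda>n. d n x" "{n}"] by (simp add: K)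
      then have "ennreal (4 ^ n * (\<phi> (Suc n) x - \<phi> n x)\<^sup>2) \<le> ennreal K"
        unfolding d_def by (simp add: ennreal_mult)
      then have "4 ^ n * (\<phi> (Suc n) x - \<phi> n x)\<^sup>2 \<le> K" using K(2) by simp
      then have "sqrt (4 ^ n * (\<phi> (Suc n) x - \<phi> n x)\<^sup>2) \<le> sqrt K" by (rule real_sqrt_le_mono)
      moreover have "sqrt (4 ^ n) = (2 ^ n :: real)" by (simp add: real_sqrt_power)
      ultimately have "2 ^ n * \<bar>\<phi> (Suc n) x - \<phi> n x\<bar> \<le> sqrt K" by (simp add: real_sqrt_mult)
      then have "\<bar>\<phi> (Suc n) x - \<phi> n x\<bar> \<le> sqrt K / 2 ^ n"
        by (subst pos_le_divide_eq) (simp_all add: mult.commute)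
      then show ?thesis by (simp add: power_divide)
    qed
    then have "summable (\<lambda>n. \<phi> (Suc n) x - \<phi> n x)"
      using summable_comparison_test'[of "\<lambda>n. sqrt K * (1 / 2) ^ n" 0 "\<lambda>n. \<phi> (Suc n) x - \<phi> n x"]
        summable_mult[OF summable_geometric[of "1 / 2 :: real"], of "sqrt K"] by simp
    then have "(\<lambda>m. \<Sum>n<m. \<phi> (Suc n) x - \<phi> n x) \<longlonglongrightarrow> (\<Sum>n. \<phi> (Suc n) x - \<phi> n x)"
      by (rule summable_LIMSEQ)
    then have "(\<lambda>m. (\<phi> m x - \<phi> 0 x) + \<phi> 0 x) \<longlonglongrightarrow> (\<Sum>n. \<phi> (Suc n) x - \<phi> n x) + \<phi> 0 x"
      unfolding sum_lessThan_telescope[of "\<lambda>n. \<phi> n x"] by (intro tendsto_add tendsto_const)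
    then show ?case by (simp add: convergentI)
  qed
qed

text \<open>A linear functional on a space of square integrable functions that lies below
  \<open>C/2 + \<parallel>f\<parallel>\<^sup>2/2\<close> is the inner product with a function of squared norm at most \<open>C\<close>: that function
  is the limit of a sequence maximising \<open>L f - \<parallel>f\<parallel>\<^sup>2/2\<close>, which is Cauchy by the parallelogram
  identity.\<close>

theorem L2_riesz:
  fixes M :: "'b measure" and S :: "('b \<Rightarrow> real) set" and L :: "('b \<Rightarrow> real) \<Rightarrow> real"
  assumes meas: "\<And>f. f \<in> S \<Longrightarrow> f \<in> borel_measurable M"
    and sq: "\<And>f. f \<in> S \<Longrightarrow> integrable M (\<lambda>x. (f x)\<^sup>2)"
    and zero: "(\<lambda>_. 0) \<in> S"
    and lin: "\<And>f g a b. f \<in> S \<Longrightarrow> g \<in> S \<Longrightarrow> (\<lambda>x. a * f x + b * g x) \<in> S"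
    and L: "\<And>f g a b. f \<in> S \<Longrightarrow> g \<in> S \<Longrightarrow> L (\<lambda>x. a * f x + b * g x) = a * L f + b * L g"
    and bound: "\<And>f. f \<in> S \<Longrightarrow> L f \<le> C / 2 + (LINT x|M. (f x)\<^sup>2) / 2"
  obtains g where "g \<in> borel_measurable M" "integrable M (\<lambda>x. (g x)\<^sup>2)" "(LINT x|M. (g x)\<^sup>2) \<le> C"
    "\<And>f. f \<in> S \<Longrightarrow> L f = (LINT x|M. g x * f x)"
proof -
  define N where "N f = (LINT x|M. (f x)\<^sup>2)" for f :: "'b \<Rightarrow> real"
  define F where "F f = L f - N f / 2" for f
  define m where "m = (SUP f\<in>S. F f)"
  have N_nn: "0 \<le> N f" for f unfolding N_def by (rule integral_nonneg_AE) simp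
  have "F f \<le> C / 2" if "f \<in> S" for f using bound[OF that] unfolding F_def N_def by linarith
  then have bdd: "bdd_above (F ` S)" by (rule bdd_aboveI2)
  have F_le: "F f \<le> m" if "f \<in> S" for f unfolding m_def by (rule cSUP_upper[OF that bdd])
  have NL: "N (\<lambda>x. a * f x + b * g x) = a\<^sup>2 * N f + 2 * a * b * (LINT x|M. f x * g x) + b\<^sup>2 * N g"
    if "f \<in> S" "g \<in> S" for f g a b
    unfolding N_def using that by (intro integral_square_combination meas sq)
  have par: "N (\<lambda>x. f x - g x) \<le> 4 * ((m - F f) + (m - F g))" if "f \<in> S" "g \<in> S" for f g
  proof -
    let ?I = "LINT x|M. f x * g x"
    have "F (\<lambda>x. 1 / 2 * f x + 1 / 2 * g x) \<le> m" by (rule F_le[OF lin[OF that]])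
    then have "L f / 2 + L g / 2 - (N f / 4 + ?I / 2 + N g / 4) / 2 \<le> m"
      unfolding F_def[of "\<lambda>x. 1 / 2 * f x + 1 / 2 * g x"] L[OF that] NL[OF that] by (simp add: power2_eq_square)
    moreover have "N (\<lambda>x. f x - g x) = N f - 2 * ?I + N g" using NL[OF that, of 1 "-1"] by simp
    ultimately show ?thesis unfolding F_def[of f] F_def[of g] by argo
  qed
  \<comment> \<open>With these errors consecutive members of a maximising sequence have squared distance at most \<open>8\<^sup>-\<^sup>n\<close>.\<close>
  define e :: "nat \<Rightarrow> real" where "e n = (1 / 8) ^ Suc n" for n
  have e: "0 < e n" "e (Suc n) \<le> e n" "8 * e n = (1 / 8) ^ n" for n by (auto simp: e_def)
  have e_lim: "e \<longlonglongrightarrow> 0" unfolding e_def by (intro LIMSEQ_Suc LIMSEQ_realpow_zero) auto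
  have e_mono: "e j \<le> e n" if "n \<le> j" for n j using that e(2) by (rule lift_Suc_antimono_le[rotated])
  have "\<exists>f. f \<in> S \<and> m - e n < F f" for n
  proof -
    have "m - e n < m" using e(1) by simp
    then obtain f where "f \<in> S" "m - e n < F f"
      using less_cSUP_iff[OF _ bdd, of "m - e n"] zero unfolding m_def by fast
    then show ?thesis by auto
  qed
  then obtain \<phi> where \<phi>: "\<And>n. \<phi> n \<in> S" "\<And>n. m - e n < F (\<phi> n)" by metis
  have [measurable]: "\<phi> n \<in> borel_measurable M" for n using meas \<phi>(1) by blast
  have cauchy: "N (\<lambda>x. \<phi> j x - \<phi> n x) \<le> 8 * e n" if "n \<le> j" for n j
  proof -
    have "(m - F (\<phi> j)) + (m - F (\<phi> n)) \<le> 2 * e n"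
      using \<phi>(2)[of n] \<phi>(2)[of j] e_mono[OF that] by linarith
    then show ?thesis by (intro order_trans[OF par[OF \<phi>(1) \<phi>(1)]]) argo
  qed
  have nnN: "(\<integral>\<^sup>+x. ennreal ((\<phi> j x - \<phi> n x)\<^sup>2) \<partial>M) = ennreal (N (\<lambda>x. \<phi> j x - \<phi> n x))" for n j
  proof -
    have "integrable M (\<lambda>x. (1 * \<phi> j x + (-1) * \<phi> n x)\<^sup>2)"
      using \<phi>(1) by (intro integral_square_combination meas sq)
    then show ?thesis unfolding N_def by (intro nn_integral_eq_integral) auto
  qed
  have "AE x in M. convergent (\<lambda>n. \<phi> n x)"
  proof (rule fast_L2_Cauchy_AE_convergent)
    show "(\<integral>\<^sup>+x. ennreal ((\<phi> (Suc n) x - \<phi> n x)\<^sup>2) \<partial>M) \<le> ennreal ((1 / 8) ^ n)" for n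
      unfolding nnN e(3)[symmetric] by (intro ennreal_leI cauchy) simp
  qed measurable
  define g where "g x = lim (\<lambda>n. \<phi> n x)" for x
  have g [measurable]: "g \<in> borel_measurable M" unfolding g_def by measurable
  have lim: "AE x in M. (\<lambda>n. \<phi> n x) \<longlonglongrightarrow> g x"
    using \<open>AE x in M. convergent _\<close> unfolding g_def by eventually_elim (simp add: convergent_LIMSEQ_iff)
  have fatou: "(\<integral>\<^sup>+x. ennreal ((g x - \<phi> n x)\<^sup>2) \<partial>M) \<le> ennreal (8 * e n)" for n
  proof -
    have "(\<integral>\<^sup>+x. ennreal ((g x - \<phi> n x)\<^sup>2) \<partial>M) = (\<integral>\<^sup>+x. liminf (\<lambda>j. ennreal ((\<phi> j x - \<phi> n x)\<^sup>2)) \<partial>M)"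
    proof (rule nn_integral_cong_AE)
      show "AE x in M. ennreal ((g x - \<phi> n x)\<^sup>2) = liminf (\<lambda>j. ennreal ((\<phi> j x - \<phi> n x)\<^sup>2))"
        using lim
      proof eventually_elim
        case (elim x)
        have "(\<lambda>j. ennreal ((\<phi> j x - \<phi> n x)\<^sup>2)) \<longlonglongrightarrow> ennreal ((g x - \<phi> n x)\<^sup>2)"
          by (intro tendsto_intros elim)
        then show ?case by (rule lim_imp_Liminf[OF trivial_limit_sequentially, symmetric])
      qed
    qed
    also have "\<dots> \<le> liminf (\<lambda>j. \<integral>\<^sup>+x. ennreal ((\<phi> j x - \<phi> n x)\<^sup>2) \<partial>M)"
      by (rule nn_integral_liminf) measurable
    also have "\<dots> \<le> ennreal (8 * e n)"
    proof (rule order_trans[OF Liminf_le_Limsup[OF trivial_limit_sequentially] Limsup_bounded])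
      show "\<forall>\<^sub>F j in sequentially. (\<integral>\<^sup>+x. ennreal ((\<phi> j x - \<phi> n x)\<^sup>2) \<partial>M) \<le> ennreal (8 * e n)"
        unfolding nnN eventually_sequentially using cauchy by (auto intro!: exI[of _ n] ennreal_leI)
    qed
    finally show ?thesis .
  qed
  have diff_sq: "integrable M (\<lambda>x. (g x - \<phi> n x)\<^sup>2)" for n
    using fatou[of n] by (intro integrableI_bounded) (auto intro: le_less_trans)
  define D where "D n = N (\<lambda>x. g x - \<phi> n x)" for n
  have D: "0 \<le> D n" "D n \<le> 8 * e n" for n
  proof -
    show "0 \<le> D n" unfolding D_def by (rule N_nn)
    have "ennreal (D n) \<le> ennreal (8 * e n)"
      using fatou[of n] nn_integral_eq_integral[OF diff_sq[of n]] unfolding D_def N_def by simp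
    then show "D n \<le> 8 * e n" using e(1)[of n] by simp
  qed
  have D_lim: "D \<longlonglongrightarrow> 0"
    by (rule tendsto_sandwich[of "\<lambda>_. 0" _ _ "\<lambda>n. 8 * e n"]) (use D e_lim in \<open>auto intro!: tendsto_eq_intros\<close>)
  have g2: "integrable M (\<lambda>x. (g x)\<^sup>2)"
    using integral_square_combination(1)[of "\<lambda>x. g x - \<phi> 0 x" M "\<phi> 0" 1 1] diff_sq[of 0] sq[OF \<phi>(1)[of 0]] by simp
  have rep: "L f = (LINT x|M. g x * f x)" if f: "f \<in> S" for f
  proof -
    have [measurable]: "f \<in> borel_measurable M" using meas f .
    define A where "A = L f - (LINT x|M. g x * f x)"
    have step: "t * A \<le> e n + D n / 2 + t\<^sup>2 * N f" for t n
    proof -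
      have "F (\<lambda>x. 1 * \<phi> n x + t * f x) \<le> m" by (intro F_le lin \<phi>(1) f)
      then have 1: "t * (L f - (LINT x|M. \<phi> n x * f x)) \<le> e n + t\<^sup>2 / 2 * N f"
        using \<phi>(2)[of n] unfolding F_def L[OF \<phi>(1) f] NL[OF \<phi>(1) f] by (simp add: field_simps)
      have "0 \<le> N (\<lambda>x. 1 * (g x - \<phi> n x) + t * f x)" by (rule N_nn)
      also have "\<dots> = D n + 2 * t * (LINT x|M. (g x - \<phi> n x) * f x) + t\<^sup>2 * N f"
        using integral_square_combination(2)[of "\<lambda>x. g x - \<phi> n x" M f 1 t] diff_sq[of n] sq[OF f]
        unfolding D_def N_def by simp
      also have "(LINT x|M. (g x - \<phi> n x) * f x) = (LINT x|M. g x * f x) - (LINT x|M. \<phi> n x * f x)"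
        using square_integrable_mult[of g M f] square_integrable_mult[of "\<phi> n" M f] g2 sq[OF f] sq[OF \<phi>(1)]
        by (simp add: left_diff_distrib)
      finally show ?thesis using 1 unfolding A_def by (simp add: algebra_simps)
    qed
    have tA: "t * A \<le> t\<^sup>2 * N f" for t
    proof (rule LIMSEQ_le_const)
      show "(\<lambda>n. e n + D n / 2 + t\<^sup>2 * N f) \<longlonglongrightarrow> t\<^sup>2 * N f"
        using e_lim D_lim by (auto intro!: tendsto_eq_intros)
      show "\<exists>n0. \<forall>n\<ge>n0. t * A \<le> e n + D n / 2 + t\<^sup>2 * N f" using step by blast
    qed
    have "A = 0"
    proof (rule ccontr)
      assume "A \<noteq> 0"
      \<comment> \<open>The inequality fails at \<open>t = k A\<close>, where the linear term wins.\<close>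
      define k where "k = 1 / (N f + 1)"
      have k: "0 < k" "k * N f < 1" unfolding k_def using N_nn[of f] by (auto simp: field_simps add_nonneg_pos)
      have "k * A * A \<le> (k * A)\<^sup>2 * N f" by (rule tA)
      also have "\<dots> = (k * A * A) * (k * N f)" by (simp add: power2_eq_square algebra_simps)
      also have "\<dots> < (k * A * A) * 1"
      proof (rule mult_strict_left_mono[OF k(2)])
        have "0 < A * A" using \<open>A \<noteq> 0\<close> zero_less_power2[of A] unfolding power2_eq_square by blast
        then show "0 < k * A * A" using k(1) by (simp add: mult.assoc)
      qed
      finally show False by simp
    qed
    then show ?thesis by (simp add: A_def)
  qed
  have "N g \<le> C"
  proof (rule LIMSEQ_le_const)
    show "(\<lambda>n. C + D n) \<longlonglongrightarrow> C" using D_lim by (auto intro!: tendsto_eq_intros)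
    have "N g \<le> C + D n" for n
    proof -
      have "D n = N g - 2 * (LINT x|M. g x * \<phi> n x) + N (\<phi> n)"
        using integral_square_combination(2)[of g M "\<phi> n" 1 "-1"] g2 sq[OF \<phi>(1)[of n]]
        unfolding D_def N_def by simp
      moreover have "L (\<phi> n) \<le> C / 2 + N (\<phi> n) / 2" unfolding N_def by (rule bound[OF \<phi>(1)])
      ultimately show ?thesis using rep[OF \<phi>(1), of n] by simp
    qed
    then show "\<exists>n0. \<forall>n\<ge>n0. N g \<le> C + D n" by blast
  qed
  then show thesis by (intro that[OF g g2 _ rep]) (simp_all add: N_def)
qed

section \<open>The theorem of Hahn and Banach\<close>

definition sublinear_below_norm :: "('a::real_normed_vector \<Rightarrow> real) \<Rightarrow> bool" where
  "sublinear_below_norm p \<longleftrightarrow>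
     (\<forall>x y. p (x + y) \<le> p x + p y) \<and> (\<forall>c x. 0 \<le> c \<longrightarrow> p (c *\<^sub>R x) = c * p x) \<and> (\<forall>x. p x \<le> norm x)"

definition tilt :: "('a::real_normed_vector \<Rightarrow> real) \<Rightarrow> 'a \<Rightarrow> 'a \<Rightarrow> real" where
  "tilt p y x = (INF t\<in>{0..}. p (x + t *\<^sub>R y) - t * p y)"

lemma sublinear_lower:
  assumes "sublinear_below_norm p"
  shows "- norm x \<le> p x" "p 0 = 0" "- p (-x) \<le> p x"
proof -
  have "p (0 *\<^sub>R 0) = 0 * p 0" using assms unfolding sublinear_below_norm_def by (metis order_refl)
  then show z: "p 0 = 0" by simp
  have "p (x + - x) \<le> p x + p (-x)" using assms unfolding sublinear_below_norm_def by blast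
  with z show 1: "- p (-x) \<le> p x" by simp
  have "p (-x) \<le> norm (-x)" using assms unfolding sublinear_below_norm_def by blast
  then show "- norm x \<le> p x" using 1 by simp
qed

lemma tilt_bdd:
  assumes "sublinear_below_norm p"
  shows "bdd_below ((\<lambda>t. p (x + t *\<^sub>R y) - t * p y) ` {0..})"
proof (rule bdd_belowI2)
  fix t :: real assume "t \<in> {0..}"
  then have "t * p y = p (t *\<^sub>R y)" using assms unfolding sublinear_below_norm_def by simp
  also have "\<dots> = p ((x + t *\<^sub>R y) + - x)" by simp
  also have "\<dots> \<le> p (x + t *\<^sub>R y) + p (-x)" using assms unfolding sublinear_below_norm_def by blast
  finally show "- p (-x) \<le> p (x + t *\<^sub>R y) - t * p y" by simp
qed

lemma tilt_le:
  assumes "sublinear_below_norm p" "0 \<le> t"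
  shows "tilt p y x \<le> p (x + t *\<^sub>R y) - t * p y"
  unfolding tilt_def using tilt_bdd[OF assms(1)] assms(2) by (intro cINF_lower) auto

text \<open>A sublinear functional \<open>q\<close> below the tilt satisfies \<open>q y \<ge> - q (- y) \<ge> p y\<close>: tilting is a way to
  decrease \<open>p\<close> without decreasing it at \<open>y\<close>.\<close>

lemma tilt_sublinear:
  assumes p: "sublinear_below_norm p"
  shows "sublinear_below_norm (tilt p y)" "tilt p y x \<le> p x" "tilt p y (- y) \<le> - p y"
proof -
  have le: "tilt p y x \<le> p x" for x using tilt_le[OF p, of 0 y x] by simp
  then show "tilt p y x \<le> p x" .
  show "tilt p y (- y) \<le> - p y" using tilt_le[OF p, of 1 y "-y"] sublinear_lower[OF p] by simp
  have add: "tilt p y (x + x') \<le> tilt p y x + tilt p y x'" for x x'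
  proof -
    have "tilt p y (x + x') - (p (x' + s *\<^sub>R y) - s * p y) \<le> tilt p y x" if "0 \<le> s" for s
      unfolding tilt_def[of p y x]
    proof (rule cINF_greatest)
      fix t :: real assume "t \<in> {0..}"
      then have "tilt p y (x + x') \<le> p ((x + x') + (t + s) *\<^sub>R y) - (t + s) * p y"
        using that by (intro tilt_le[OF p]) auto
      also have "(x + x') + (t + s) *\<^sub>R y = (x + t *\<^sub>R y) + (x' + s *\<^sub>R y)"
        by (simp add: algebra_simps)
      also have "p \<dots> \<le> p (x + t *\<^sub>R y) + p (x' + s *\<^sub>R y)"
        using p unfolding sublinear_below_norm_def by blast
      finally show "tilt p y (x + x') - (p (x' + s *\<^sub>R y) - s * p y) \<le> p (x + t *\<^sub>R y) - t * p y"
        by (simp add: algebra_simps)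
    qed simp
    then have "tilt p y (x + x') - tilt p y x \<le> tilt p y x'"
      unfolding tilt_def[of p y x'] by (intro cINF_greatest) (auto simp: algebra_simps)
    then show ?thesis by simp
  qed
  have hom1: "tilt p y (c *\<^sub>R x) \<le> c * tilt p y x" if c: "0 < c" for c x
  proof -
    have "tilt p y (c *\<^sub>R x) / c \<le> tilt p y x"
      unfolding tilt_def[of p y x]
    proof (rule cINF_greatest)
      fix t :: real assume t: "t \<in> {0..}"
      have "tilt p y (c *\<^sub>R x) \<le> p (c *\<^sub>R x + (c * t) *\<^sub>R y) - (c * t) * p y"
        using t c by (intro tilt_le[OF p]) auto
      also have "c *\<^sub>R x + (c * t) *\<^sub>R y = c *\<^sub>R (x + t *\<^sub>R y)" by (simp add: algebra_simps)
      also have "p \<dots> = c * p (x + t *\<^sub>R y)" using p c unfolding sublinear_below_norm_def by simp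
      finally show "tilt p y (c *\<^sub>R x) / c \<le> p (x + t *\<^sub>R y) - t * p y"
        using c by (simp add: field_simps)
    qed simp
    then show ?thesis using c by (simp add: field_simps)
  qed
  have hom: "tilt p y (c *\<^sub>R x) = c * tilt p y x" if c: "0 < c" for c x
  proof (rule antisym[OF hom1[OF c]])
    have "tilt p y (inverse c *\<^sub>R (c *\<^sub>R x)) \<le> inverse c * tilt p y (c *\<^sub>R x)"
      using c by (intro hom1) simp
    then show "c * tilt p y x \<le> tilt p y (c *\<^sub>R x)" using c by (simp add: field_simps)
  qed
  have "tilt p y 0 = 0"
  proof -
    have "(\<lambda>t. p (0 + t *\<^sub>R y) - t * p y) ` {0..} = {0}"
      using p unfolding sublinear_below_norm_def by (auto simp: image_iff intro!: exI[of _ 0])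
    then show ?thesis unfolding tilt_def by simp
  qed
  with hom have "0 \<le> c \<Longrightarrow> tilt p y (c *\<^sub>R x) = c * tilt p y x" for c x
    by (cases "c = 0") auto
  moreover have "tilt p y x \<le> norm x" for x
    using le[of x] p unfolding sublinear_below_norm_def by (meson order_trans)
  ultimately show "sublinear_below_norm (tilt p y)"
    using add unfolding sublinear_below_norm_def by blast
qed

lemma sublinear_Inf_chain:
  fixes C :: "('a::real_normed_vector \<Rightarrow> real) set"
  assumes "C \<noteq> {}" and sublin: "\<And>p. p \<in> C \<Longrightarrow> sublinear_below_norm p"
    and chain: "\<And>p q. p \<in> C \<Longrightarrow> q \<in> C \<Longrightarrow> p \<le> q \<or> q \<le> p"
  shows "sublinear_below_norm (\<lambda>x. INF p\<in>C. p x)" "p \<in> C \<Longrightarrow> (INF p\<in>C. p x) \<le> p x"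
proof -
  have bdd: "bdd_below ((\<lambda>p. p x) ` C)" for x
    using sublinear_lower(1)[OF sublin] by (intro bdd_belowI2[of _ "- norm x"]) auto
  have low: "(INF p\<in>C. p x) \<le> p x" if "p \<in> C" for p x
    using bdd that by (rule cINF_lower)
  then show "p \<in> C \<Longrightarrow> (INF p\<in>C. p x) \<le> p x" .
  have add: "(INF p\<in>C. p (x + y)) \<le> (INF p\<in>C. p x) + (INF p\<in>C. p y)" for x y
  proof -
    have "(INF p\<in>C. p (x + y)) - q y \<le> (INF p\<in>C. p x)" if q: "q \<in> C" for q
    proof (rule cINF_greatest[OF assms(1)])
      fix p assume p: "p \<in> C"
      obtain r where r: "r \<in> C" "r \<le> p" "r \<le> q" using chain[OF p q] p q by auto
      have "(INF p\<in>C. p (x + y)) \<le> r (x + y)" using low r by auto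
      also have "\<dots> \<le> r x + r y" using sublin[OF r(1)] unfolding sublinear_below_norm_def by blast
      also have "\<dots> \<le> p x + q y" using r by (intro add_mono) (auto simp: le_fun_def)
      finally show "(INF p\<in>C. p (x + y)) - q y \<le> p x" by simp
    qed
    then have "(INF p\<in>C. p (x + y)) - (INF p\<in>C. p x) \<le> (INF p\<in>C. p y)"
      by (intro cINF_greatest[OF assms(1)]) (simp add: algebra_simps)
    then show ?thesis by simp
  qed
  have hom1: "(INF p\<in>C. p (c *\<^sub>R x)) \<le> c * (INF p\<in>C. p x)" if c: "0 < c" for c x
  proof -
    have "(INF p\<in>C. p (c *\<^sub>R x)) / c \<le> (INF p\<in>C. p x)"
    proof (rule cINF_greatest[OF assms(1)])
      fix p assume p: "p \<in> C"
      have "(INF p\<in>C. p (c *\<^sub>R x)) \<le> p (c *\<^sub>R x)" using low p by auto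
      also have "\<dots> = c * p x" using sublin[OF p] c unfolding sublinear_below_norm_def by simp
      finally show "(INF p\<in>C. p (c *\<^sub>R x)) / c \<le> p x" using c by (simp add: field_simps)
    qed
    then show ?thesis using c by (simp add: field_simps)
  qed
  have hom: "(INF p\<in>C. p (c *\<^sub>R x)) = c * (INF p\<in>C. p x)" if c: "0 < c" for c x
  proof (rule antisym[OF hom1[OF c]])
    have "(INF p\<in>C. p (inverse c *\<^sub>R (c *\<^sub>R x))) \<le> inverse c * (INF p\<in>C. p (c *\<^sub>R x))"
      using c by (intro hom1) simp
    then show "c * (INF p\<in>C. p x) \<le> (INF p\<in>C. p (c *\<^sub>R x))" using c by (simp add: field_simps)
  qed
  have "(\<lambda>p. p 0) ` C = {0}" using sublinear_lower(2)[OF sublin] assms(1) by force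
  then have "(INF p\<in>C. p 0) = 0" by simp
  with hom have "0 \<le> c \<Longrightarrow> (INF p\<in>C. p (c *\<^sub>R x)) = c * (INF p\<in>C. p x)" for c x
    by (cases "c = 0") auto
  moreover have "(INF p\<in>C. p x) \<le> norm x" for x
  proof -
    obtain p where "p \<in> C" using assms(1) by blast
    then show ?thesis using low[of p x] sublin[of p] unfolding sublinear_below_norm_def
      by (meson order_trans)
  qed
  ultimately show "sublinear_below_norm (\<lambda>x. INF p\<in>C. p x)"
    using add unfolding sublinear_below_norm_def by blast
qed

text \<open>A minimal sublinear functional equals all its tilts, which makes it superadditive, hence
  linear. Minimal elements below the tilt of the norm in direction \<open>x\<^sub>0\<close> attain the norm
  at \<open>x\<^sub>0\<close>.\<close>

theorem norming_functional:
  fixes x0 :: "'a::real_normed_vector"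
  obtains z :: "'a \<Rightarrow>\<^sub>L real" where "\<And>x. \<bar>z x\<bar> \<le> norm x" "z x0 = norm x0"
proof -
  have norm_sublinear: "sublinear_below_norm (norm :: 'a \<Rightarrow> real)"
    unfolding sublinear_below_norm_def by (auto intro: norm_triangle_ineq)
  define p0 where "p0 = tilt norm (x0 :: 'a)"
  define A where "A = {p :: 'a \<Rightarrow> real. sublinear_below_norm p \<and> p \<le> p0}"
  have p0: "p0 \<in> A" unfolding A_def p0_def using tilt_sublinear[OF norm_sublinear] by simp
  have "\<exists>m\<in>A. \<forall>a\<in>A. a \<le> m \<longrightarrow> a = m"
  proof (rule predicate_Zorn[where P = "\<lambda>x y. y \<le> x"])
    show "partial_order_on A (relation_of (\<lambda>x y. y \<le> x) A)"
      unfolding partial_order_on_def preorder_on_def relation_of_def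
      by (auto simp: refl_on_def trans_def antisym_def)
    fix C assume C: "C \<in> Chains (relation_of (\<lambda>x y. y \<le> x) A)"
    then have sub: "C \<subseteq> A" unfolding Chains_def relation_of_def by auto
    show "\<exists>u\<in>A. \<forall>a\<in>C. u \<le> a"
    proof (cases "C = {}")
      case True then show ?thesis using p0 by auto
    next
      case False
      have s: "\<And>p. p \<in> C \<Longrightarrow> sublinear_below_norm p" using sub A_def by auto
      have c: "\<And>p q. p \<in> C \<Longrightarrow> q \<in> C \<Longrightarrow> p \<le> q \<or> q \<le> p"
        using C unfolding Chains_def relation_of_def by blast
      let ?u = "\<lambda>x. INF p\<in>C. p x"
      have low: "?u \<le> p" if "p \<in> C" for p
        using sublinear_Inf_chain(2)[OF False s c that] by (simp add: le_fun_def)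
      obtain q where "q \<in> C" using False by auto
      then have "?u \<le> p0" using low[of q] sub A_def by (metis (mono_tags, lifting) mem_Collect_eq order_trans subsetD)
      then have "?u \<in> A" using sublinear_Inf_chain(1)[OF False s c] A_def by simp
      with low show ?thesis by blast
    qed
  qed
  then obtain p where p: "sublinear_below_norm p" "p \<le> p0"
    and min: "\<And>q. sublinear_below_norm q \<Longrightarrow> q \<le> p \<Longrightarrow> q = p"
    unfolding A_def by (auto intro: order_trans)
  have tilt_eq: "tilt p y = p" for y
    using tilt_sublinear[OF p(1)] by (intro min) (auto simp: le_fun_def)
  have add: "p (x + y) = p x + p y" for x y
  proof (rule antisym)
    show "p (x + y) \<le> p x + p y" using p(1) unfolding sublinear_below_norm_def by blast
    show "p x + p y \<le> p (x + y)" using tilt_le[OF p(1), of 1 y x] unfolding tilt_eq by simp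
  qed
  have neg: "p (- x) = - p x" for x using add[of x "-x"] sublinear_lower(2)[OF p(1)] by simp
  have scale: "p (c *\<^sub>R x) = c * p x" for c x
  proof (cases "0 \<le> c")
    case True then show ?thesis using p(1) unfolding sublinear_below_norm_def by blast
  next
    case False
    then have "p ((- c) *\<^sub>R x) = (- c) * p x" using p(1) unfolding sublinear_below_norm_def by (metis linorder_not_le neg_0_le_iff_le order_less_imp_le)
    then show ?thesis using neg[of "c *\<^sub>R x"] by simp
  qed
  have le: "\<bar>p x\<bar> \<le> norm x" for x
    using sublinear_lower(1)[OF p(1), of x] p(1) unfolding sublinear_below_norm_def by (auto simp: abs_le_iff)
  have bl: "bounded_linear p"
    using add scale le by (intro bounded_linear_intro[of _ 1]) auto
  have "p (- x0) \<le> - norm x0"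
    using p(2) tilt_sublinear(3)[OF norm_sublinear, of x0] unfolding p0_def le_fun_def by (meson order_trans)
  then have "p x0 = norm x0" using neg le[of x0] by (simp add: abs_le_iff)
  then show thesis using le that[of "Blinfun p"] by (simp add: bounded_linear_Blinfun_apply[OF bl])
qed

text \<open>In a separable space the norm is a countable supremum of functionals, so balls lie in the
  \<open>\<sigma>\<close>-algebra that the functionals generate.\<close>

lemma borel_generated_by_functionals:
  fixes N :: "'a::{real_normed_vector,second_countable_topology} measure"
  assumes "space N = UNIV" and meas: "\<And>z :: 'a \<Rightarrow>\<^sub>L real. blinfun_apply z \<in> borel_measurable N"
  shows "sets borel \<subseteq> sets N"
proof -
  obtain D :: "'a set" where D: "countable D" "\<And>X. open X \<Longrightarrow> X \<noteq> {} \<Longrightarrow> \<exists>d\<in>D. d \<in> X"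
    using countable_dense_exists by auto
  have "\<exists>z :: 'a \<Rightarrow>\<^sub>L real. (\<forall>x. \<bar>z x\<bar> \<le> norm x) \<and> z a = norm a" for a
    using norming_functional by metis
  then obtain Z :: "'a \<Rightarrow> 'a \<Rightarrow>\<^sub>L real" where Z: "\<And>a x. \<bar>Z a x\<bar> \<le> norm x" "\<And>a. Z a a = norm a"
    by metis
  have norm_le: "norm x \<le> r \<longleftrightarrow> (\<forall>a\<in>D. \<bar>Z a x\<bar> \<le> r)" for x r
  proof
    show "norm x \<le> r \<Longrightarrow> \<forall>a\<in>D. \<bar>Z a x\<bar> \<le> r" using Z(1) order_trans by blast
    assume r: "\<forall>a\<in>D. \<bar>Z a x\<bar> \<le> r"
    show "norm x \<le> r"
    proof (rule field_le_epsilon)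
      fix e :: real assume "0 < e"
      then obtain a where a: "a \<in> D" "a \<in> ball x (e/2)" using D(2)[of "ball x (e/2)"] by auto
      have "norm x \<le> norm a + norm (x - a)" by (metis add.commute diff_add_cancel norm_triangle_ineq)
      also have "norm a = Z a x - Z a (x - a)" using Z(2)[of a] by (simp add: blinfun.diff_right)
      also have "\<dots> \<le> r + norm (x - a)" using r[rule_format, OF a(1)] Z(1)[of a "x - a"] by linarith
      finally show "norm x \<le> r + e" using a(2) by (simp add: dist_norm)
    qed
  qed
  have cball: "cball b r \<in> sets N" for b r
  proof -
    have "cball b r = {x \<in> space N. \<forall>a\<in>D. \<bar>Z a x - Z a b\<bar> \<le> r}"
      using norm_le[of _ r] by (auto simp: assms(1) dist_norm norm_minus_commute[of b] blinfun.diff_right)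
    also have "\<dots> \<in> sets N" using meas D(1) by measurable
    finally show ?thesis .
  qed
  have "U \<in> sets N" if U: "open U" for U :: "'a set"
  proof -
    let ?I = "{(b, q). b \<in> D \<and> q \<in> \<rat> \<and> cball b q \<subseteq> U}"
    have "U = (\<Union>(b, q)\<in>?I. cball b q)"
    proof (intro set_eqI iffI)
      fix x assume x: "x \<in> U"
      then obtain e where e: "e > 0" "ball x e \<subseteq> U" using U open_contains_ball by blast
      then obtain b where b: "b \<in> D" "b \<in> ball x (e/4)" using D(2)[of "ball x (e/4)"] by auto
      obtain q where q: "q \<in> \<rat>" "e/4 < q" "q < e/2" using Rats_dense_in_real[of "e/4" "e/2"] e by auto
      have "cball b q \<subseteq> ball x e"
      proof
        fix y assume "y \<in> cball b q"
        then show "y \<in> ball x e" using b q dist_triangle[of x y b] e by simp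
      qed
      then show "x \<in> (\<Union>(b, q)\<in>?I. cball b q)" using b q e order_trans[OF \<open>cball b q \<subseteq> ball x e\<close> e(2)]
        by (intro UN_I[of "(b, q)"]) (auto simp: dist_commute)
    qed auto
    moreover have "countable ?I"
      by (rule countable_subset[of _ "D \<times> \<rat>"]) (auto intro: D(1) countable_rat)
    moreover have "(\<Union>(b, q)\<in>?I. cball b q) \<in> sets N"
      using \<open>countable ?I\<close> cball by (intro sets.countable_UN'') auto
    ultimately show ?thesis by simp
  qed
  then have "(\<lambda>x. x) \<in> borel_measurable N" using assms(1) by (intro borel_measurableI) simp
  then show ?thesis using measurable_sets[of "\<lambda>x. x" N borel] assms(1) by auto
qed

section \<open>Fourier uniqueness for finite Borel measures\<close>

inductive_set trig_polys :: "('a::real_normed_vector \<Rightarrow> real) set" where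
  cos: "(\<lambda>x. cos (blinfun_apply z x)) \<in> trig_polys"
| sin: "(\<lambda>x. sin (blinfun_apply z x)) \<in> trig_polys"
| add: "f \<in> trig_polys \<Longrightarrow> g \<in> trig_polys \<Longrightarrow> (\<lambda>x. f x + g x) \<in> trig_polys"
| scale: "f \<in> trig_polys \<Longrightarrow> (\<lambda>x. c * f x) \<in> trig_polys"

lemma trig_polys_const: "(\<lambda>x. c) \<in> trig_polys"
  using trig_polys.scale[OF trig_polys.cos[of 0], of c] by simp

lemma trig_polys_diff: "f \<in> trig_polys \<Longrightarrow> g \<in> trig_polys \<Longrightarrow> (\<lambda>x. f x - g x) \<in> trig_polys"
  using trig_polys.add[OF _ trig_polys.scale[of g "-1"], of f] by simp

lemma trig_polys_mult:
  assumes "f \<in> trig_polys" "g \<in> trig_polys"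
  shows "(\<lambda>x. f x * g x) \<in> trig_polys"
  using assms
proof (induction f)
  case (cos z)
  show ?case using cos
  proof (induction g)
    case (cos w)
    show ?case using trig_polys.scale[OF trig_polys.add[OF trig_polys.cos[of "z - w"] trig_polys.cos[of "z + w"]], of "1/2"]
      by (simp add: cos_times_cos blinfun.diff_left blinfun.add_left)
  next
    case (sin w)
    show ?case using trig_polys.scale[OF trig_polys_diff[OF trig_polys.sin[of "z + w"] trig_polys.sin[of "z - w"]], of "1/2"]
      by (simp add: cos_times_sin blinfun.diff_left blinfun.add_left)
  next
    case (add f g) then show ?case by (simp add: distrib_left trig_polys.add)
  next
    case (scale f c) then show ?case
      by (simp add: mult.left_commute[of _ c] trig_polys.scale)
  qed
next
  case (sin z)
  show ?case using sin
  proof (induction g)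
    case (cos w)
    show ?case using trig_polys.scale[OF trig_polys.add[OF trig_polys.sin[of "z + w"] trig_polys.sin[of "z - w"]], of "1/2"]
      by (simp add: sin_times_cos blinfun.diff_left blinfun.add_left)
  next
    case (sin w)
    show ?case using trig_polys.scale[OF trig_polys_diff[OF trig_polys.cos[of "z - w"] trig_polys.cos[of "z + w"]], of "1/2"]
      by (simp add: sin_times_sin blinfun.diff_left blinfun.add_left)
  next
    case (add f g) then show ?case by (simp add: distrib_left trig_polys.add)
  next
    case (scale f c) then show ?case
      by (simp add: mult.left_commute[of _ c] trig_polys.scale)
  qed
next
  case (add f1 f2) then show ?case by (simp add: distrib_right trig_polys.add)
next
  case (scale f c) then show ?case by (simp add: mult.assoc trig_polys.scale)
qed

lemma trig_polys_bounded:
  assumes "f \<in> trig_polys" obtains K where "\<And>x. \<bar>f x\<bar> \<le> K"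
proof -
  have "\<exists>K. \<forall>x. \<bar>f x\<bar> \<le> K" using assms
  proof induction
    case (cos z) then show ?case by (intro exI[of _ 1]) simp
  next
    case (sin z) then show ?case by (intro exI[of _ 1]) simp
  next
    case (add f g)
    then obtain K L where "\<forall>x. \<bar>f x\<bar> \<le> K" "\<forall>x. \<bar>g x\<bar> \<le> L" by blast
    then have "\<bar>f x + g x\<bar> \<le> K + L" for x
      using abs_triangle_ineq[of "f x" "g x"] by (meson add_mono order_trans)
    then show ?case by blast
  next
    case (scale f c)
    then obtain K where "\<forall>x. \<bar>f x\<bar> \<le> K" by blast
    then show ?case by (intro exI[of _ "\<bar>c\<bar> * K"]) (simp add: abs_mult mult_left_mono)
  qed
  then show thesis using that by blast
qed

lemma blinfun_borel_measurable [measurable]: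
  fixes z :: "'a::{real_normed_vector,second_countable_topology} \<Rightarrow>\<^sub>L real"
  shows "blinfun_apply z \<in> borel_measurable borel"
  by (intro borel_measurable_continuous_onI linear_continuous_on blinfun.bounded_linear_right)

lemma trig_polys_measurable:
  fixes f :: "'a::{real_normed_vector,second_countable_topology} \<Rightarrow> real"
  assumes "f \<in> trig_polys" shows "f \<in> borel_measurable borel"
  using assms
proof induction
  case (cos z)
  show ?case by measurable
next
  case (sin z)
  show ?case by measurable
next
  case (add f g)
  from add.IH show ?case by (rule borel_measurable_add)
next
  case (scale f c)
  from scale.IH show ?case by (intro borel_measurable_times borel_measurable_const)
qed

lemma trig_polys_polynomial:
  assumes "real_polynomial_function q" "f \<in> trig_polys"
  shows "(\<lambda>x. q (f x)) \<in> trig_polys"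
  using assms(1)
proof induction
  case (linear g)
  have "g (f x) = g 1 * f x" for x
    using linear_cmul[OF bounded_linear.linear[OF linear], of "f x" 1] by (simp add: mult.commute)
  then show ?case using trig_polys.scale[OF assms(2), of "g 1"] by presburger
qed (auto intro: trig_polys_const trig_polys.add trig_polys_mult)

text \<open>Uniform limits of trigonometric polynomials. By the theorem of Weierstrass applied to the
  absolute value they form a vector lattice, so the sets \<open>{f > 0}\<close> are closed under intersection.\<close>

definition trig_closure :: "('a::real_normed_vector \<Rightarrow> real) set" where
  "trig_closure = {f. \<forall>e>0. \<exists>p\<in>trig_polys. \<forall>x. \<bar>f x - p x\<bar> \<le> e}"

lemma trig_closureI: "f \<in> trig_polys \<Longrightarrow> f \<in> trig_closure"
  unfolding trig_closure_def by (auto intro!: bexI[of _ f])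

lemma trig_closure_add:
  assumes "f \<in> trig_closure" "g \<in> trig_closure" shows "(\<lambda>x. f x + g x) \<in> trig_closure"
  unfolding trig_closure_def
proof (intro CollectI allI impI)
  fix e :: real assume "0 < e"
  then have "e/2 > 0" by simp
  then obtain p q where pq: "p \<in> trig_polys" "\<forall>x. \<bar>f x - p x\<bar> \<le> e/2" "q \<in> trig_polys" "\<forall>x. \<bar>g x - q x\<bar> \<le> e/2"
    using assms unfolding trig_closure_def by blast
  have "\<bar>(f x + g x) - (p x + q x)\<bar> \<le> e" for x
    using pq(2)[rule_format, of x] pq(4)[rule_format, of x] by linarith
  then show "\<exists>p\<in>trig_polys. \<forall>x. \<bar>(f x + g x) - p x\<bar> \<le> e"
    using trig_polys.add[OF pq(1,3)] by (intro bexI[of _ "\<lambda>x. p x + q x"]) auto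
qed

lemma trig_closure_scale:
  assumes "f \<in> trig_closure" shows "(\<lambda>x. c * f x) \<in> trig_closure"
  unfolding trig_closure_def
proof (intro CollectI allI impI)
  fix e :: real assume "0 < e"
  then have "e / (\<bar>c\<bar> + 1) > 0" by simp
  then obtain p where p: "p \<in> trig_polys" "\<And>x. \<bar>f x - p x\<bar> \<le> e / (\<bar>c\<bar> + 1)"
    using assms unfolding trig_closure_def by blast
  have "\<bar>c * f x - c * p x\<bar> \<le> e" for x
  proof -
    have "\<bar>c * f x - c * p x\<bar> = \<bar>c\<bar> * \<bar>f x - p x\<bar>" by (simp add: abs_mult right_diff_distrib[symmetric])
    also have "\<dots> \<le> (\<bar>c\<bar> + 1) * (e / (\<bar>c\<bar> + 1))" using p(2)[of x] by (intro mult_mono) auto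
    also have "\<dots> = e" by simp
    finally show ?thesis .
  qed
  then show "\<exists>p\<in>trig_polys. \<forall>x. \<bar>c * f x - p x\<bar> \<le> e"
    using trig_polys.scale[OF p(1)] by (intro bexI[of _ "\<lambda>x. c * p x"]) auto
qed

lemma trig_closure_abs:
  assumes "f \<in> trig_closure" shows "(\<lambda>x. \<bar>f x\<bar>) \<in> trig_closure"
  unfolding trig_closure_def
proof (intro CollectI allI impI)
  fix e :: real assume e: "0 < e"
  then have "e / 2 > 0" by simp
  then obtain p where p: "p \<in> trig_polys" "\<And>x. \<bar>f x - p x\<bar> \<le> e/2"
    using assms unfolding trig_closure_def by blast
  obtain K where K: "\<And>x. \<bar>p x\<bar> \<le> K" using trig_polys_bounded[OF p(1)] by blast
  have "continuous_on {-K..K} (\<lambda>t::real. \<bar>t\<bar>)" by (intro continuous_intros)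
  then obtain q where q: "real_polynomial_function q" "\<And>t. t \<in> {-K..K} \<Longrightarrow> \<bar>\<bar>t\<bar> - q t\<bar> < e/2"
    using Stone_Weierstrass_real_polynomial_function[of "{-K..K}" "\<lambda>t. \<bar>t\<bar>" "e/2"] \<open>0 < e/2\<close>
    by blast
  have "\<bar>\<bar>f x\<bar> - q (p x)\<bar> \<le> e" for x
  proof -
    have "p x \<in> {-K..K}" using K[of x] by (simp add: abs_le_iff)
    then show ?thesis using p(2)[of x] q(2)[of "p x"] by linarith
  qed
  then show "\<exists>p\<in>trig_polys. \<forall>x. \<bar>\<bar>f x\<bar> - p x\<bar> \<le> e"
    using trig_polys_polynomial[OF q(1) p(1)] by (intro bexI[of _ "\<lambda>x. q (p x)"]) auto
qed

lemma trig_closure_min: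
  assumes "f \<in> trig_closure" "g \<in> trig_closure" shows "(\<lambda>x. min (f x) (g x)) \<in> trig_closure"
proof -
  have "(\<lambda>x. f x + -1 * g x) \<in> trig_closure" by (intro trig_closure_add trig_closure_scale assms)
  then have "(\<lambda>x. (1/2) * ((f x + g x) + -1 * \<bar>f x + -1 * g x\<bar>)) \<in> trig_closure"
    by (intro trig_closure_add trig_closure_scale trig_closure_abs assms)
  also have "(\<lambda>x. (1/2) * ((f x + g x) + -1 * \<bar>f x + -1 * g x\<bar>)) = (\<lambda>x. min (f x) (g x))"
    by (rule ext) (simp add: min_def abs_if)
  finally show ?thesis .
qed

lemma trig_closure_measurable:
  fixes f :: "'a::{real_normed_vector,second_countable_topology} \<Rightarrow> real"
  assumes "f \<in> trig_closure" shows "f \<in> borel_measurable borel"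
proof -
  have "\<forall>n. \<exists>p. p \<in> trig_polys \<and> (\<forall>x. \<bar>f x - p x\<bar> \<le> inverse (real (Suc n)))"
  proof
    fix n
    have "0 < inverse (real (Suc n))" by simp
    then show "\<exists>p. p \<in> trig_polys \<and> (\<forall>x. \<bar>f x - p x\<bar> \<le> inverse (real (Suc n)))"
      using assms unfolding trig_closure_def by blast
  qed
  from choice[OF this] obtain p
    where p: "\<And>n. p n \<in> trig_polys" "\<And>n x. \<bar>f x - p n x\<bar> \<le> inverse (real (Suc n))" by blast
  show ?thesis
  proof (rule borel_measurable_LIMSEQ_real)
    show "p n \<in> borel_measurable borel" for n using p(1) by (rule trig_polys_measurable)
    fix x
    have "(\<lambda>n. f x - p n x) \<longlonglongrightarrow> 0"
      by (rule Lim_null_comparison[OF _ LIMSEQ_inverse_real_of_nat]) (simp only: p(2) real_norm_def eventually_True)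
    then have "(\<lambda>n. f x - (f x - p n x)) \<longlonglongrightarrow> f x - 0" by (intro tendsto_intros)
    then show "(\<lambda>n. p n x) \<longlonglongrightarrow> f x" by simp
  qed
qed

lemma trig_closure_bounded:
  assumes "f \<in> trig_closure" obtains K where "\<And>x. \<bar>f x\<bar> \<le> K"
proof -
  obtain p where p: "p \<in> trig_polys" "\<And>x. \<bar>f x - p x\<bar> \<le> 1"
    using assms zero_less_one unfolding trig_closure_def by blast
  obtain K where K: "\<And>x. \<bar>p x\<bar> \<le> K" using trig_polys_bounded[OF p(1)] by blast
  have "\<bar>f x\<bar> \<le> K + 1" for x using p(2)[of x] K[of x] by linarith
  then show thesis using that by blast
qed

lemma (in finite_measure) integral_diff_bound:
  fixes f g :: "'a \<Rightarrow> real"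
  assumes "integrable M f" "integrable M g" and le: "\<And>x. \<bar>f x - g x\<bar> \<le> e"
  shows "\<bar>(LINT x|M. f x) - (LINT x|M. g x)\<bar> \<le> e * measure M (space M)"
proof -
  have "\<bar>LINT x|M. (f x - g x)\<bar> \<le> (LINT x|M. \<bar>f x - g x\<bar>)" by (rule integral_abs_bound)
  also have "\<dots> \<le> (LINT x|M. e)"
    using assms by (intro integral_mono integrable_abs Bochner_Integration.integrable_diff) auto
  finally show ?thesis using assms by (simp add: mult.commute)
qed

text \<open>The sets \<open>{f > 0}\<close> form an intersection-stable generator: their indicators are limits of
  truncations \<open>min 1 (n f\<^sup>+)\<close> within the lattice, and a functional \<open>z\<close> is recovered as the limit of
  \<open>sin (t z) / t\<close>.\<close>

theorem finite_measure_eq_trig: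
  fixes M N :: "'a::{real_normed_vector,second_countable_topology} measure"
  assumes M: "finite_measure M" "sets M = sets borel" and N: "finite_measure N" "sets N = sets borel"
    and cos: "\<And>z :: 'a \<Rightarrow>\<^sub>L real. (LINT x|M. cos (z x)) = (LINT x|N. cos (z x))"
    and sin: "\<And>z :: 'a \<Rightarrow>\<^sub>L real. (LINT x|M. sin (z x)) = (LINT x|N. sin (z x))"
  shows "M = N"
proof -
  interpret M: finite_measure M by fact
  interpret N: finite_measure N by fact
  have [measurable_cong]: "sets M = sets borel" "sets N = sets borel" by fact+
  have intp: "integrable M f" "integrable N f" if f: "f \<in> trig_closure" for f :: "'a \<Rightarrow> real"
  proof -
    obtain K where "\<And>x. \<bar>f x\<bar> \<le> K" using trig_closure_bounded[OF f] by blast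
    then show "integrable M f" "integrable N f" using trig_closure_measurable[OF f]
      by (auto intro!: M.integrable_const_bound[of _ K] N.integrable_const_bound[of _ K])
  qed
  note intt = intp[OF trig_closureI]
  have eq_poly: "(LINT x|M. f x) = (LINT x|N. f x)" if "f \<in> trig_polys" for f :: "'a \<Rightarrow> real"
    using that
  proof induction
    case (add f g) then show ?case by (simp add: intt)
  qed (simp_all add: cos sin)
  have eq: "(LINT x|M. f x) = (LINT x|N. f x)" if f: "f \<in> trig_closure" for f :: "'a \<Rightarrow> real"
  proof -
    define c where "c = measure M (space M) + measure N (space N) + 1"
    have c: "c > 0" unfolding c_def by (intro add_nonneg_pos add_nonneg_nonneg) auto
    have "\<bar>(LINT x|M. f x) - (LINT x|N. f x)\<bar> \<le> 0 + e" if e: "0 < e" for e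
    proof -
      have ec: "e / c > 0" using e c by simp
      then obtain p where p: "p \<in> trig_polys" "\<And>x. \<bar>f x - p x\<bar> \<le> e / c"
        using f unfolding trig_closure_def by blast
      note 1 = M.integral_diff_bound[OF intp(1)[OF f] intt(1)[OF p(1)] p(2)]
      note 2 = N.integral_diff_bound[OF intp(2)[OF f] intt(2)[OF p(1)] p(2)]
      have "\<bar>(LINT x|M. f x) - (LINT x|N. f x)\<bar> \<le> e / c * measure M (space M) + e / c * measure N (space N)"
        using 1 2 eq_poly[OF p(1)] by linarith
      also have "\<dots> \<le> e / c * c" unfolding distrib_left[symmetric]
        using ec by (intro mult_left_mono) (auto simp: c_def)
      finally show ?thesis using c by simp
    qed
    then have "\<bar>(LINT x|M. f x) - (LINT x|N. f x)\<bar> \<le> 0" by (rule field_le_epsilon)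
    then show ?thesis by simp
  qed
  define E where "E = (\<lambda>f. {x :: 'a. 0 < f x}) ` trig_closure"
  have UN: "UNIV \<in> E" unfolding E_def
    by (rule image_eqI[of _ _ "\<lambda>x. 1"]) (auto intro: trig_closureI trig_polys_const)
  have int_pos: "emeasure M {x. 0 < f x} = emeasure N {x. 0 < f x}" if f: "f \<in> trig_closure" for f :: "'a \<Rightarrow> real"
  proof -
    define u where "u n x = min 1 (real n * ((1/2) * (f x + \<bar>f x\<bar>)))" for n x
    have u: "u n \<in> trig_closure" for n
      unfolding u_def
      by (intro trig_closure_min trig_closure_scale trig_closure_add trig_closure_abs f trig_closureI trig_polys_const)
    have lim: "(\<lambda>n. u n x) \<longlonglongrightarrow> indicator {x. 0 < f x} x" for x
    proof (cases "0 < f x")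
      case True
      have "eventually (\<lambda>n. u n x = 1) sequentially"
      proof -
        obtain m :: nat where m: "1 / f x < m" using reals_Archimedean2 by blast
        have "u n x = 1" if "n \<ge> m" for n
        proof -
          have "1 < real m * f x" using m True by (simp add: field_simps)
          also have "\<dots> \<le> real n * f x" using that True by simp
          finally show ?thesis using True unfolding u_def by simp
        qed
        then show ?thesis unfolding eventually_sequentially by blast
      qed
      then show ?thesis using True by (simp add: tendsto_eventually)
    next
      case False
      then show ?thesis unfolding u_def by simp
    qed
    have bd: "norm (u n x) \<le> 1" for n x unfolding u_def by (auto simp: abs_le_iff)
    have [measurable]: "f \<in> borel_measurable borel" "\<And>n. u n \<in> borel_measurable borel"
      using f u trig_closure_measurable by blast+
    have "(\<lambda>n. LINT x|M. u n x) \<longlonglongrightarrow> (LINT x|M. indicator {x. 0 < f x} x)"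
      using lim bd by (intro integral_dominated_convergence[where w = "\<lambda>_. 1"]) auto
    moreover have "(\<lambda>n. LINT x|N. u n x) \<longlonglongrightarrow> (LINT x|N. indicator {x. 0 < f x} x)"
      using lim bd by (intro integral_dominated_convergence[where w = "\<lambda>_. 1"]) auto
    ultimately have "measure M {x. 0 < f x} = measure N {x. 0 < f x}"
      using eq[OF u] LIMSEQ_unique[of "\<lambda>n. LINT x|N. u n x"] sets_eq_imp_space_eq[OF M(2)] sets_eq_imp_space_eq[OF N(2)]
      by simp
    then show ?thesis by (simp add: M.emeasure_eq_measure N.emeasure_eq_measure)
  qed
  have sub: "E \<subseteq> sets borel" unfolding E_def
    using trig_closure_measurable[THEN borel_measurable_iff_greater[THEN iffD1], rule_format, of _ 0] by auto
  have gen: "sets borel = sigma_sets UNIV E"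
  proof (rule antisym)
    show "sigma_sets UNIV E \<subseteq> sets borel" using sets.sigma_sets_subset[OF sub] by simp
    let ?S = "sigma UNIV E"
    have cl: "f \<in> borel_measurable ?S" if f: "f \<in> trig_closure" for f
    proof (rule borel_measurable_iff_greater[THEN iffD2], intro allI)
      fix a
      have "(\<lambda>x. f x + - a) \<in> trig_closure"
        by (intro trig_closure_add f trig_closureI trig_polys_const)
      then have "{x. 0 < f x + - a} \<in> E"
        unfolding E_def by (rule image_eqI[where f = "\<lambda>f. {x. 0 < f x}", rotated]) simp
      then show "{x \<in> space ?S. a < f x} \<in> sets ?S" by (simp add: sigma_sets.Basic)
    qed
    have "blinfun_apply z \<in> borel_measurable ?S" for z :: "'a \<Rightarrow>\<^sub>L real"
    proof (rule borel_measurable_LIMSEQ_real)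
      fix x
      have "((\<lambda>t. sin (t * z x) / t) \<longlongrightarrow> z x) (at 0)"
      proof -
        have "((\<lambda>t. sin (t * z x)) has_real_derivative z x) (at 0)"
          by (auto intro!: derivative_eq_intros)
        then show ?thesis by (simp add: has_field_derivative_iff)
      qed
      moreover have "filterlim (\<lambda>n. 1 / real (Suc n)) (at 0) sequentially"
        unfolding filterlim_at using LIMSEQ_inverse_real_of_nat by (simp add: inverse_eq_divide)
      ultimately show "(\<lambda>n. sin ((1 / real (Suc n)) * z x) / (1 / real (Suc n))) \<longlonglongrightarrow> z x"
        by (rule filterlim_compose)
    next
      fix n
      have "(\<lambda>x. sin (((1 / real (Suc n)) *\<^sub>R z) x)) \<in> borel_measurable ?S"
        by (intro cl trig_closureI trig_polys.sin)
      then have "(\<lambda>x. sin ((1 / real (Suc n)) * z x)) \<in> borel_measurable ?S"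
        by (simp add: blinfun.scaleR_left)
      then show "(\<lambda>x. sin ((1 / real (Suc n)) * z x) / (1 / real (Suc n))) \<in> borel_measurable ?S"
        by measurable
    qed
    then have "sets borel \<subseteq> sets ?S" by (intro borel_generated_by_functionals) (simp_all add: space_measure_of_conv)
    then show "sets borel \<subseteq> sigma_sets UNIV E" by simp
  qed
  show ?thesis
  proof (rule measure_eqI_generator_eq[of E UNIV, where A = "\<lambda>_. UNIV"])
    show "Int_stable E"
    proof (rule Int_stableI)
      fix a b assume "a \<in> E" "b \<in> E"
      then obtain f g where fg: "f \<in> trig_closure" "g \<in> trig_closure" "a = {x. 0 < f x}" "b = {x. 0 < g x}"
        unfolding E_def by auto
      then have "a \<inter> b = {x. 0 < min (f x) (g x)}" by auto
      then show "a \<inter> b \<in> E" unfolding E_def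
        by (rule image_eqI[where f = "\<lambda>f. {x. 0 < f x}"]) (rule trig_closure_min[OF fg(1,2)])
    qed
    show "emeasure M X = emeasure N X" if "X \<in> E" for X using that int_pos unfolding E_def by auto
    show "sets M = sigma_sets UNIV E" "sets N = sigma_sets UNIV E" using gen M(2) N(2) by simp_all
  qed (use UN in simp_all)
qed

section \<open>Test functions\<close>

definition flat_exp :: "nat \<Rightarrow> real \<Rightarrow> real" where
  "flat_exp k t = (if t \<le> 0 then 0 else (1 / t) ^ k * exp (- (1 / t)))"

text \<open>The class spanned by \<open>t\<^sup>-\<^sup>k exp (- 1/t)\<close> is closed under differentiation, whence
  the smoothness of \<open>exp (- 1/t)\<close> at the origin.\<close>

lemma flat_exp_deriv:
  "(flat_exp k has_real_derivative flat_exp (k + 2) t + - real k * flat_exp (k + 1) t) (at t)"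
proof -
  consider "t < 0" | "t = 0" | "t > 0" by linarith
  then show ?thesis
  proof cases
    case 1
    have "(flat_exp k has_real_derivative 0) (at t)"
      by (rule has_field_derivative_transform_within_open[of "\<lambda>t. 0" _ _ "{..<0}"])
        (use 1 in \<open>auto simp: flat_exp_def\<close>)
    then show ?thesis using 1 by (simp add: flat_exp_def)
  next
    case 2
    have "((\<lambda>h. (flat_exp k (0 + h) - flat_exp k 0) / h) \<longlongrightarrow> 0) (at 0)"
    proof (rule filterlim_split_at_real)
      have "\<forall>\<^sub>F h in at_left 0. 0 = (flat_exp k (0 + h) - flat_exp k 0) / h"
        by (simp add: eventually_at_filter flat_exp_def)
      then show "((\<lambda>h. (flat_exp k (0 + h) - flat_exp k 0) / h) \<longlongrightarrow> 0) (at_left 0)"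
        by (rule Lim_transform_eventually[rotated]) simp
      have "((\<lambda>h. inverse h ^ (k + 1) / exp (inverse h)) \<longlongrightarrow> (0::real)) (at_right 0)"
        by (rule filterlim_compose[OF tendsto_power_div_exp_0 filterlim_inverse_at_top_right])
      moreover have "\<forall>\<^sub>F h in at_right 0. inverse h ^ (k + 1) / exp (inverse h) = (flat_exp k (0 + h) - flat_exp k 0) / h"
        by (simp add: eventually_at_filter flat_exp_def exp_minus field_simps)
      ultimately show "((\<lambda>h. (flat_exp k (0 + h) - flat_exp k 0) / h) \<longlongrightarrow> 0) (at_right 0)"
        by (rule Lim_transform_eventually)
    qed
    then have "(flat_exp k has_real_derivative 0) (at 0)" by (simp add: has_field_derivative_iff)
    then show ?thesis using 2 by (simp add: flat_exp_def)
  next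
    case 3
    have "((\<lambda>t. (1 / t) ^ k * exp (- (1 / t))) has_real_derivative
        real k * (1/t) ^ (k - 1) * (- (1 / t\<^sup>2)) * exp (- (1 / t)) + (1/t)^k * (exp (- (1 / t)) * (1 / t\<^sup>2))) (at t)"
      using 3 by (auto intro!: derivative_eq_intros simp: power2_eq_square)
    also have "real k * (1/t) ^ (k - 1) * (- (1 / t\<^sup>2)) * exp (- (1 / t)) + (1/t)^k * (exp (- (1 / t)) * (1 / t\<^sup>2))
      = flat_exp (k + 2) t + - real k * flat_exp (k + 1) t"
      using 3 by (cases k) (simp_all add: flat_exp_def power2_eq_square field_simps)
    finally show ?thesis
      by (rule has_field_derivative_transform_within_open[of _ _ _ "{0<..}"])
        (use 3 in \<open>auto simp: flat_exp_def\<close>)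
  qed
qed

inductive_set smooth_functions :: "(real \<Rightarrow> real) set" where
  flat: "(\<lambda>t. flat_exp k (c * t + d)) \<in> smooth_functions"
| cos: "(\<lambda>t. cos (c * t + d)) \<in> smooth_functions"
| add: "f \<in> smooth_functions \<Longrightarrow> g \<in> smooth_functions \<Longrightarrow> (\<lambda>t. f t + g t) \<in> smooth_functions"
| scale: "f \<in> smooth_functions \<Longrightarrow> (\<lambda>t. a * f t) \<in> smooth_functions"
| mult: "f \<in> smooth_functions \<Longrightarrow> g \<in> smooth_functions \<Longrightarrow> (\<lambda>t. f t * g t) \<in> smooth_functions"

lemma smooth_functions_deriv:
  assumes "f \<in> smooth_functions"
  shows "\<exists>g\<in>smooth_functions. \<forall>t. (f has_real_derivative g t) (at t)"
  using assms
proof induction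
  case (flat k c d)
  let ?g = "\<lambda>t. c * (flat_exp (k + 2) (c * t + d) + - real k * flat_exp (k + 1) (c * t + d))"
  have "((\<lambda>t. flat_exp k (c * t + d)) has_real_derivative ?g t) (at t)" for t
  proof -
    have "((\<lambda>t. c * t + d) has_real_derivative c) (at t)" by (auto intro!: derivative_eq_intros)
    from DERIV_chain2[OF flat_exp_deriv this] show ?thesis by (simp add: mult.commute)
  qed
  moreover have "?g \<in> smooth_functions" by (intro smooth_functions.intros)
  ultimately show ?case by (intro bexI[of _ ?g] allI)
next
  case (cos c d)
  let ?g = "\<lambda>t. c * cos (c * t + (d + pi / 2))"
  have "((\<lambda>t. cos (c * t + d)) has_real_derivative ?g t) (at t)" for t
  proof -
    have "cos (c * t + d + pi / 2) = - sin (c * t + d)" by (simp add: cos_add)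
    then show ?thesis by (auto intro!: derivative_eq_intros simp: add.assoc)
  qed
  moreover have "?g \<in> smooth_functions" by (intro smooth_functions.intros)
  ultimately show ?case by (intro bexI[of _ ?g] allI)
next
  case (add f g)
  then obtain f' g' where "f' \<in> smooth_functions" "g' \<in> smooth_functions"
    "\<forall>t. (f has_real_derivative f' t) (at t)" "\<forall>t. (g has_real_derivative g' t) (at t)" by blast
  then show ?case
    by (intro bexI[of _ "\<lambda>t. f' t + g' t"]) (auto intro!: smooth_functions.add derivative_eq_intros)
next
  case (scale f a)
  then obtain f' where "f' \<in> smooth_functions" "\<forall>t. (f has_real_derivative f' t) (at t)" by blast
  then show ?case
    by (intro bexI[of _ "\<lambda>t. a * f' t"]) (auto intro!: smooth_functions.scale derivative_eq_intros)
next
  case (mult f g)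
  then obtain f' g' where fg: "f' \<in> smooth_functions" "g' \<in> smooth_functions"
    "\<forall>t. (f has_real_derivative f' t) (at t)" "\<forall>t. (g has_real_derivative g' t) (at t)" by blast
  then have "\<forall>t. ((\<lambda>t. f t * g t) has_real_derivative f' t * g t + g' t * f t) (at t)"
    by (auto intro: DERIV_mult)
  moreover have "(\<lambda>t. f' t * g t + g' t * f t) \<in> smooth_functions"
    by (intro smooth_functions.add smooth_functions.mult fg mult.hyps)
  ultimately show ?case by (intro bexI[of _ "\<lambda>t. f' t * g t + g' t * f t"])
qed

lemma smooth_functions_deriv_iter:
  assumes "f \<in> smooth_functions"
  shows "(deriv ^^ k) f \<in> smooth_functions"
proof (induction k)
  case 0 then show ?case using assms by simp
next
  case (Suc k)
  obtain g where g: "g \<in> smooth_functions" "\<forall>t. ((deriv ^^ k) f has_real_derivative g t) (at t)"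
    using smooth_functions_deriv[OF Suc] by blast
  then have "deriv ((deriv ^^ k) f) = g" by (intro ext DERIV_imp_deriv) blast
  with g show ?case by simp
qed

lemma test_functionI:
  assumes "\<eta> \<in> smooth_functions" "0 < a" "a < b" "\<And>y. y \<notin> {a..b} \<Longrightarrow> \<eta> y = 0"
  shows "test_function \<eta>"
  unfolding test_function_def
proof (intro conjI allI)
  fix k y
  show "(deriv ^^ k) \<eta> differentiable at y"
    using smooth_functions_deriv[OF smooth_functions_deriv_iter[OF assms(1), of k]]
    by (meson real_differentiable_def)
  show "\<exists>a b. 0 < a \<and> a < b \<and> (\<forall>y. y \<notin> {a..b} \<longrightarrow> \<eta> y = 0)" using assms(2-4) by blast
qed

text \<open>As \<open>n\<close> grows these bumps increase to the indicator of the open interval.\<close>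

definition bump :: "nat \<Rightarrow> real \<Rightarrow> real \<Rightarrow> real \<Rightarrow> real" where
  "bump n a b t = flat_exp 0 (real (Suc n) * (t - a)) * flat_exp 0 (real (Suc n) * (b - t))"

lemma bump_smooth: "bump n a b \<in> smooth_functions"
proof -
  have "(\<lambda>t. flat_exp 0 (real (Suc n) * t + - (real (Suc n) * a)) * flat_exp 0 (- real (Suc n) * t + real (Suc n) * b)) \<in> smooth_functions"
    by (intro smooth_functions.intros)
  then show ?thesis unfolding bump_def by (simp add: algebra_simps)
qed

lemma bump_bound: "0 \<le> bump n a b t" "bump n a b t \<le> 1" "t \<notin> {a<..<b} \<Longrightarrow> bump n a b t = 0"
proof -
  have *: "0 \<le> flat_exp 0 t" "flat_exp 0 t \<le> 1" for t by (auto simp: flat_exp_def)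
  show "0 \<le> bump n a b t" "bump n a b t \<le> 1" unfolding bump_def using * by (auto intro: mult_le_one)
  assume "t \<notin> {a<..<b}"
  then have "t \<le> a \<or> b \<le> t" by auto
  then show "bump n a b t = 0" unfolding bump_def by (auto simp: flat_exp_def mult_le_0_iff)
qed

lemma bump_tendsto: "(\<lambda>n. bump n a b t) \<longlonglongrightarrow> indicator {a<..<b} t"
proof (cases "t \<in> {a<..<b}")
  case True
  have lim: "(\<lambda>n. flat_exp 0 (real (Suc n) * r)) \<longlonglongrightarrow> 1" if r: "r > 0" for r
  proof -
    have "(\<lambda>n. exp (- (inverse (real (Suc n)) * (1 / r)))) \<longlonglongrightarrow> exp (- (0 * (1 / r)))"
      by (intro tendsto_intros LIMSEQ_inverse_real_of_nat)
    moreover have "exp (- (inverse (real (Suc n)) * (1 / r))) = flat_exp 0 (real (Suc n) * r)" for n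
      using r by (simp add: flat_exp_def mult_le_0_iff field_simps del: of_nat_Suc)
    ultimately show ?thesis by simp
  qed
  have "(\<lambda>n. bump n a b t) \<longlonglongrightarrow> 1 * 1"
    unfolding bump_def using True by (intro tendsto_mult lim) auto
  then show ?thesis using True by simp
next
  case False
  then show ?thesis using bump_bound(3)[OF False] by simp
qed

lemma test_function_bump_cos:
  assumes "0 < a" "a < b"
  shows "test_function (\<lambda>t. bump n a b t * cos (c * t + d))"
proof (rule test_functionI[OF _ assms])
  show "(\<lambda>t. bump n a b t * cos (c * t + d)) \<in> smooth_functions"
    by (intro smooth_functions.mult smooth_functions.cos bump_smooth)
  show "bump n a b y * cos (c * y + d) = 0" if "y \<notin> {a..b}" for y
    using bump_bound(3)[of y a b n] that by auto
qed

lemma test_function_continuous: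
  assumes "test_function \<eta>"
  shows "continuous_on UNIV ((deriv ^^ k) \<eta>)" "(\<eta> has_real_derivative deriv \<eta> y) (at y)"
proof -
  have d: "(deriv ^^ k) \<eta> differentiable at y" for k y
    using assms unfolding test_function_def by blast
  then show "continuous_on UNIV ((deriv ^^ k) \<eta>)"
    by (intro continuous_at_imp_continuous_on ballI differentiable_imp_continuous_within) auto
  show "(\<eta> has_real_derivative deriv \<eta> y) (at y)"
    using d[of 0 y] by (simp add: DERIV_deriv_iff_real_differentiable)
qed

lemma test_function_bounds:
  assumes "test_function \<eta>"
  obtains a b K where "0 < a" "a < b" "\<And>y. \<bar>\<eta> y\<bar> \<le> K" "\<And>y. \<bar>deriv \<eta> y\<bar> \<le> K"
    "\<And>y. y \<notin> {a..b} \<Longrightarrow> \<eta> y = 0" "\<And>y. y \<notin> {a..b} \<Longrightarrow> deriv \<eta> y = 0"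
proof -
  obtain a b where ab: "0 < a" "a < b" "\<And>y. y \<notin> {a..b} \<Longrightarrow> \<eta> y = 0"
    using assms unfolding test_function_def by blast
  have d0: "deriv \<eta> y = 0" if "y \<notin> {a..b}" for y
  proof (rule DERIV_imp_deriv, rule has_field_derivative_transform_within_open)
    show "((\<lambda>_. 0) has_real_derivative 0) (at y)" by simp
    show "open (- {a..b})" "y \<in> - {a..b}" using that by auto
  qed (simp add: ab(3))
  have cont: "continuous_on {a..b} \<eta>" "continuous_on {a..b} (deriv \<eta>)"
    using test_function_continuous(1)[OF assms, of 0] test_function_continuous(1)[OF assms, of 1]
    by (auto intro: continuous_on_subset)
  have "bounded (\<eta> ` {a..b} \<union> deriv \<eta> ` {a..b})"
    by (intro bounded_Un[THEN iffD2] conjI compact_imp_bounded compact_continuous_image cont compact_Icc)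
  then obtain B where B: "\<And>t. t \<in> \<eta> ` {a..b} \<union> deriv \<eta> ` {a..b} \<Longrightarrow> \<bar>t\<bar> \<le> B"
    unfolding bounded_iff by auto
  have "\<bar>\<eta> y\<bar> \<le> \<bar>B\<bar>" "\<bar>deriv \<eta> y\<bar> \<le> \<bar>B\<bar>" for y
    using B[of "\<eta> y"] B[of "deriv \<eta> y"] ab(3)[of y] d0[of y] by (cases "y \<in> {a..b}"; force)+
  then show thesis using that ab d0 by blast
qed

lemma smooth_cylindrical_cos: "smooth_cylindrical (\<lambda>x. cos (blinfun_apply z x + c))"
proof -
  define F where "F c = (\<lambda>w :: nat \<Rightarrow> real. cos (w 0 + c))" for c
  have step: "deriv (\<lambda>t. F c (w(0 := t))) (w 0) = F (c + pi / 2) w" for c w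
  proof -
    have "((\<lambda>t. cos (t + c)) has_real_derivative - sin (w 0 + c)) (at (w 0))"
      by (auto intro!: derivative_eq_intros)
    then show ?thesis unfolding F_def
      by (subst DERIV_imp_deriv) (auto simp: cos_add add.assoc[symmetric])
  qed
  have iter: "\<exists>d. iter_partial is (F c) = F d" if "is \<in> lists {..<1}" for "is"
    using that
  proof (induction "is" rule: list.induct)
    case Nil then show ?case by auto
  next
    case (Cons i "is")
    then obtain d where "iter_partial is (F c) = F d" by auto
    moreover have "i = 0" using Cons.prems by auto
    ultimately show ?case using step by auto
  qed
  have cont: "continuous_on UNIV (F d)" for d
    unfolding F_def by (intro continuous_intros continuous_on_product_coordinates)
  have bdd: "bounded (range (F d))" for d
    unfolding F_def bounded_iff by (auto intro!: exI[of _ 1])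
  have diff: "(\<lambda>t. F d (w(i := t))) differentiable at (w i)" if "i < 1" for d w i
    unfolding F_def using that unfolding real_differentiable_def by (auto intro!: derivative_eq_intros exI)
  have "smooth_bounded 1 (F c)"
    unfolding smooth_bounded_def
  proof (intro conjI ballI allI impI)
    fix w w' :: "nat \<Rightarrow> real" assume "\<forall>i<1. w i = w' i"
    then show "F c w = F c w'" by (simp add: F_def)
  next
    fix "is" :: "nat list" assume "is \<in> lists {..<1}"
    then obtain d where d: "iter_partial is (F c) = F d" using iter by blast
    show "continuous_on UNIV (iter_partial is (F c))" "bounded (range (iter_partial is (F c)))"
      using cont bdd d by simp_all
    fix i w assume "i < (1::nat)"
    then show "(\<lambda>t. iter_partial is (F c) (w(i := t))) differentiable at (w i)"
      using diff d by simp
  qed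
  then show ?thesis unfolding smooth_cylindrical_def
    by (intro exI[of _ 1] exI[of _ "F c"] exI[of _ "\<lambda>_. z"]) (auto simp: F_def)
qed

lemma smooth_cylindrical_bounded_measurable:
  fixes f :: "'a::{banach,second_countable_topology} \<Rightarrow> real"
  assumes "smooth_cylindrical f"
  shows "f \<in> borel_measurable borel" "\<exists>K. \<forall>x. \<bar>f x\<bar> \<le> K"
proof -
  obtain m F and l :: "nat \<Rightarrow> 'a \<Rightarrow>\<^sub>L real" where F: "smooth_bounded m F" and f: "f = (\<lambda>x. F (\<lambda>i. l i x))"
    using assms unfolding smooth_cylindrical_def by blast
  have "[] \<in> lists {..<m}" by simp
  then have c: "continuous_on UNIV F" and b: "bounded (range F)"
    using F unfolding smooth_bounded_def by (metis iter_partial.simps(1))+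
  have "continuous_on UNIV (\<lambda>x i. blinfun_apply (l i) x)"
    by (intro continuous_on_coordinatewise_then_product linear_continuous_on blinfun.bounded_linear_right)
  then have "continuous_on UNIV f" unfolding f
    by (rule continuous_on_compose2[OF c]) auto
  then show "f \<in> borel_measurable borel" by (rule borel_measurable_continuous_onI)
  show "\<exists>K. \<forall>x. \<bar>f x\<bar> \<le> K" using b unfolding f bounded_iff by auto
qed

section \<open>Uniqueness of the weak derivative\<close>

lemma pair_measure_restrict_space:
  assumes "sigma_finite_measure M" "sigma_finite_measure N" and S: "S \<in> sets N"
  shows "M \<Otimes>\<^sub>M restrict_space N S = restrict_space (M \<Otimes>\<^sub>M N) (space M \<times> S)"
proof -
  interpret M: sigma_finite_measure M by fact
  interpret N: sigma_finite_measure N by fact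
  have SN: "S \<subseteq> space N" using S sets.sets_into_space by blast
  have MS: "space M \<times> S \<in> sets (M \<Otimes>\<^sub>M N)" using S by auto
  have R: "sigma_finite_measure (restrict_space N S)"
    by (rule sigma_finite_measure_restrict_space) fact+
  have sp: "space (M \<Otimes>\<^sub>M restrict_space N S) = space M \<times> S"
    using SN by (auto simp: space_pair_measure space_restrict_space)
  have sets: "sets (M \<Otimes>\<^sub>M restrict_space N S) = sets (restrict_space (M \<Otimes>\<^sub>M N) (space M \<times> S))"
  proof
    show "sets (M \<Otimes>\<^sub>M restrict_space N S) \<subseteq> sets (restrict_space (M \<Otimes>\<^sub>M N) (space M \<times> S))"
    proof (rule sets_pair_in_sets)
      fix A B assume A: "A \<in> sets M" and B: "B \<in> sets (restrict_space N S)"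
      then have "B \<in> sets N" "B \<subseteq> S" using S by (auto simp: sets_restrict_space_iff)
      then show "A \<times> B \<in> sets (restrict_space (M \<Otimes>\<^sub>M N) (space M \<times> S))"
        using A sets.sets_into_space[OF A] MS by (auto simp: sets_restrict_space_iff)
    qed
    show "sets (restrict_space (M \<Otimes>\<^sub>M N) (space M \<times> S)) \<subseteq> sets (M \<Otimes>\<^sub>M restrict_space N S)"
    proof
      fix A assume "A \<in> sets (restrict_space (M \<Otimes>\<^sub>M N) (space M \<times> S))"
      then have A: "A \<in> sets (M \<Otimes>\<^sub>M N)" "A \<subseteq> space M \<times> S" using MS by (auto simp: sets_restrict_space_iff)
      have "snd \<in> (M \<Otimes>\<^sub>M restrict_space N S) \<rightarrow>\<^sub>M N"
        using measurable_snd[of M "restrict_space N S"] by (simp add: measurable_restrict_space2_iff)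
      then have "(\<lambda>z. (fst z, snd z)) \<in> (M \<Otimes>\<^sub>M restrict_space N S) \<rightarrow>\<^sub>M (M \<Otimes>\<^sub>M N)"
        by (intro measurable_Pair measurable_fst)
      from measurable_sets[OF this A(1)] show "A \<in> sets (M \<Otimes>\<^sub>M restrict_space N S)"
        using A(2) by (simp add: sp Int_absorb2 vimage_def)
    qed
  qed
  show ?thesis
  proof (rule pair_measure_eqI[OF assms(1) R sets])
    fix A B assume A: "A \<in> sets M" and B: "B \<in> sets (restrict_space N S)"
    then have B: "B \<in> sets N" "B \<subseteq> S" using S by (auto simp: sets_restrict_space_iff)
    have "A \<times> B \<subseteq> space M \<times> S" using A B sets.sets_into_space by blast
    then show "emeasure M A * emeasure (restrict_space N S) B = emeasure (restrict_space (M \<Otimes>\<^sub>M N) (space M \<times> S)) (A \<times> B)"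
      using A B S MS by (simp add: emeasure_restrict_space N.emeasure_pair_measure_Times)
  qed
qed

lemma half_space_eq:
  fixes \<gamma> :: "'a::{banach,second_countable_topology} measure"
  assumes "prob_space \<gamma>" "sets \<gamma> = sets borel"
  shows "half_space \<gamma> = restrict_space (\<gamma> \<Otimes>\<^sub>M lborel) (UNIV \<times> {0<..})"
  unfolding half_space_def using pair_measure_restrict_space[of \<gamma> lborel "{0<..} :: real set"] assms sets_eq_imp_space_eq[OF assms(2)]
  by (simp add: prob_space_imp_sigma_finite sigma_finite_lborel)

lemma sets_half_space:
  fixes \<gamma> :: "'a::{banach,second_countable_topology} measure"
  assumes "prob_space \<gamma>" "sets \<gamma> = sets borel"
  shows "sets (half_space \<gamma>) = sets (restrict_space borel (UNIV \<times> {0<..}))"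
    and "space (half_space \<gamma>) = UNIV \<times> {0<..}"
proof -
  have "sets (\<gamma> \<Otimes>\<^sub>M lborel) = sets (borel :: ('a \<times> real) measure)"
    using assms(2) by (subst borel_prod[symmetric]) (intro sets_pair_measure_cong, simp_all)
  then show "sets (half_space \<gamma>) = sets (restrict_space borel (UNIV \<times> {0<..}))"
    unfolding half_space_eq[OF assms] by (rule sets_restrict_space_cong)
  show "space (half_space \<gamma>) = UNIV \<times> {0<..}"
    unfolding half_space_def using sets_eq_imp_space_eq[OF assms(2)] by (simp add: space_pair_measure space_restrict_space)
qed

text \<open>A function annihilated by all products of a cylindrical function and a test function has equal
  Fourier transforms of its positive and negative part on every strip, since \<open>cos (z x + c y)\<close>
  splits into such products; hence it vanishes.\<close>

lemma weak_zero_imp_AE_zero: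
  fixes \<gamma> :: "'a::{banach,second_countable_topology} measure"
  assumes \<gamma>: "prob_space \<gamma>" "sets \<gamma> = sets borel"
    and g [measurable]: "g \<in> borel_measurable (half_space \<gamma>)"
    and int: "\<And>a b. 0 < a \<Longrightarrow> a < b \<Longrightarrow> integrable (half_space \<gamma>) (\<lambda>z. g z * indicator (UNIV \<times> {a..b}) z)"
    and zero: "\<And>f \<eta>. smooth_cylindrical f \<Longrightarrow> test_function \<eta> \<Longrightarrow>
      (LINT z|half_space \<gamma>. g z * (f (fst z) * \<eta> (snd z))) = 0"
  shows "AE z in half_space \<gamma>. g z = 0"
proof -
  let ?H = "half_space \<gamma>"
  have [measurable_cong]: "sets ?H = sets (restrict_space borel (UNIV \<times> {0<..}))"
    using sets_half_space[OF \<gamma>] by simp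
  have borel_H: "h \<in> borel_measurable ?H" if "h \<in> borel_measurable borel" for h :: "'a \<times> real \<Rightarrow> real"
    using that by (subst measurable_cong_sets[OF sets_half_space(1)[OF \<gamma>] refl]) (rule measurable_restrict_space1)
  have [measurable]: "fst \<in> ?H \<rightarrow>\<^sub>M (borel :: 'a measure)" "snd \<in> ?H \<rightarrow>\<^sub>M (borel :: real measure)"
    by (subst measurable_cong_sets[OF sets_half_space(1)[OF \<gamma>] refl],
        intro measurable_restrict_space1 borel_measurable_continuous_onI continuous_intros)+
  have id_H: "(\<lambda>z. z) \<in> ?H \<rightarrow>\<^sub>M borel"
    by (subst measurable_cong_sets[OF sets_half_space(1)[OF \<gamma>] refl]) (simp add: measurable_restrict_space1)
  have [measurable]: "(indicator (UNIV \<times> {a<..<b}) :: 'a \<times> real \<Rightarrow> real) \<in> borel_measurable ?H"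
    "(indicator (UNIV \<times> {a..b}) :: 'a \<times> real \<Rightarrow> real) \<in> borel_measurable ?H" for a b :: real
    by (intro borel_H borel_measurable_indicator borel_open open_Times open_UNIV open_greaterThanLessThan)
      (intro borel_H borel_measurable_indicator borel_closed closed_Times closed_UNIV closed_atLeastAtMost)
  have AE: "AE z in ?H. g z * indicator (UNIV \<times> {a<..<b}) z = 0" if ab: "0 < a" "a < b" for a b
  proof -
    define G where "G z = g z * indicator (UNIV \<times> {a<..<b}) z" for z
    have [measurable]: "G \<in> borel_measurable ?H" unfolding G_def by measurable
    have G_le: "\<bar>G z\<bar> \<le> \<bar>g z * indicator (UNIV \<times> {a..b}) z\<bar>" for z
      unfolding G_def by (auto simp: indicator_def)
    have G_int: "integrable ?H G"
      by (rule Bochner_Integration.integrable_bound[OF int[OF ab]]) (use G_le in auto)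
    have prod: "(LINT z|?H. G z * (cos (blinfun_apply w (fst z) + d) * cos (c * snd z + d'))) = 0" for w c d d'
    proof -
      have "(\<lambda>n. LINT z|?H. g z * (cos (blinfun_apply w (fst z) + d) * (bump n a b (snd z) * cos (c * snd z + d'))))
        \<longlonglongrightarrow> (LINT z|?H. G z * (cos (blinfun_apply w (fst z) + d) * cos (c * snd z + d')))"
      proof (rule integral_dominated_convergence[where w = "\<lambda>z. \<bar>g z * indicator (UNIV \<times> {a..b}) z\<bar>"])
        show "integrable ?H (\<lambda>z. \<bar>g z * indicator (UNIV \<times> {a..b}) z\<bar>)" using int[OF ab] by auto
        have [measurable]: "bump n a b \<in> borel_measurable borel" for n
          unfolding bump_def flat_exp_def by measurable
        show "(\<lambda>z. g z * (cos (blinfun_apply w (fst z) + d) * (bump n a b (snd z) * cos (c * snd z + d')))) \<in> borel_measurable ?H" for n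
          by measurable
        show "(\<lambda>z. G z * (cos (blinfun_apply w (fst z) + d) * cos (c * snd z + d'))) \<in> borel_measurable ?H"
          by measurable
        show "AE z in ?H. (\<lambda>n. g z * (cos (blinfun_apply w (fst z) + d) * (bump n a b (snd z) * cos (c * snd z + d'))))
          \<longlonglongrightarrow> G z * (cos (blinfun_apply w (fst z) + d) * cos (c * snd z + d'))"
        proof (rule AE_I2)
          fix z
          have "(\<lambda>n. g z * (cos (blinfun_apply w (fst z) + d) * (bump n a b (snd z) * cos (c * snd z + d'))))
            \<longlonglongrightarrow> g z * (cos (blinfun_apply w (fst z) + d) * (indicator {a<..<b} (snd z) * cos (c * snd z + d')))"
            by (intro tendsto_intros bump_tendsto)
          then show "(\<lambda>n. g z * (cos (blinfun_apply w (fst z) + d) * (bump n a b (snd z) * cos (c * snd z + d'))))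
            \<longlonglongrightarrow> G z * (cos (blinfun_apply w (fst z) + d) * cos (c * snd z + d'))"
            unfolding G_def by (cases z) (simp add: indicator_def mult_ac)
        qed
        fix n
        have "\<bar>cos (blinfun_apply w (fst z) + d) * (bump n a b (snd z) * cos (c * snd z + d'))\<bar>
            \<le> indicator (UNIV \<times> {a..b}) z" for z
        proof (cases "snd z \<in> {a<..<b}")
          case True
          have "\<bar>cos (blinfun_apply w (fst z) + d) * (bump n a b (snd z) * cos (c * snd z + d'))\<bar> \<le> 1"
            unfolding abs_mult using bump_bound(1,2)[of n a b "snd z"]
            by (intro mult_le_one abs_cos_le_one) auto
          then show ?thesis using True by (cases z) auto
        qed (use bump_bound(3)[of "snd z" a b n] in auto)
        then have "\<bar>g z\<bar> * \<bar>cos (blinfun_apply w (fst z) + d) * (bump n a b (snd z) * cos (c * snd z + d'))\<bar>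
            \<le> \<bar>g z\<bar> * indicator (UNIV \<times> {a..b}) z" for z
          by (intro mult_left_mono) auto
        then show "AE z in ?H. norm (g z * (cos (blinfun_apply w (fst z) + d) * (bump n a b (snd z) * cos (c * snd z + d'))))
          \<le> \<bar>g z * indicator (UNIV \<times> {a..b}) z\<bar>" by (simp add: abs_mult)
      qed
      moreover have "(LINT z|?H. g z * (cos (blinfun_apply w (fst z) + d) * (bump n a b (snd z) * cos (c * snd z + d')))) = 0" for n
        by (rule zero[OF smooth_cylindrical_cos test_function_bump_cos[OF ab]])
      ultimately show ?thesis by (simp only: LIMSEQ_const_iff)
    qed
    define M where "M s = distr (density ?H (\<lambda>z. ennreal (s * G z))) borel (\<lambda>z. z)" for s :: real
    have int_M: "(LINT z|M s. k z) = (LINT z|?H. max 0 (s * G z) * k z)"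
      if [measurable]: "k \<in> borel_measurable borel" for s and k :: "'a \<times> real \<Rightarrow> real"
    proof -
      have k: "k \<in> borel_measurable ?H" using borel_H[OF that] .
      have "(LINT z|M s. k z) = (LINT z|density ?H (\<lambda>z. ennreal (s * G z)). k z)"
        unfolding M_def using id_H by (intro integral_distr) simp_all
      also have "density ?H (\<lambda>z. ennreal (s * G z)) = density ?H (\<lambda>z. ennreal (max 0 (s * G z)))"
        by (intro arg_cong[where f = "density ?H"] ext) (auto simp: max_def ennreal_neg)
      also have "(LINT z|\<dots>. k z) = (LINT z|?H. max 0 (s * G z) * k z)"
        using k by (subst integral_density) auto
      finally show ?thesis .
    qed
    have fin: "(\<integral>\<^sup>+z. ennreal (s * G z) \<partial>?H) \<noteq> \<infinity>" for s
    proof -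
      have "integrable ?H (\<lambda>z. s * G z)" using G_int by simp
      then have "(\<integral>\<^sup>+z. ennreal (norm (s * G z)) \<partial>?H) < \<infinity>" unfolding integrable_iff_bounded by blast
      then have "(\<integral>\<^sup>+z. ennreal (s * G z) \<partial>?H) < \<infinity>"
        by (rule le_less_trans[rotated]) (auto intro!: nn_integral_mono ennreal_leI)
      then show ?thesis by simp
    qed
    have fM: "finite_measure (M s)" for s
    proof
      show "emeasure (M s) (space (M s)) \<noteq> \<infinity>"
        unfolding M_def using fin[of s] id_H by (simp add: emeasure_distr emeasure_density)
    qed
    have eq: "(LINT z|M 1. k z) = (LINT z|M (-1). k z)"
      if [measurable]: "k \<in> borel_measurable borel" and k: "\<And>z. \<bar>k z\<bar> \<le> 1"
        and "(LINT z|?H. G z * k z) = 0" for k :: "'a \<times> real \<Rightarrow> real"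
    proof -
      have [measurable]: "k \<in> borel_measurable ?H" by (rule borel_H) fact
      have i: "integrable ?H (\<lambda>z. max 0 (s * G z) * k z)" if "s = 1 \<or> s = -1" for s
      proof (rule Bochner_Integration.integrable_bound[OF G_int])
        have "\<bar>max 0 (s * G z)\<bar> * \<bar>k z\<bar> \<le> \<bar>G z\<bar> * 1" for z
          using that k by (intro mult_mono) (auto simp: max_def abs_mult)
        then show "AE z in ?H. norm (max 0 (s * G z) * k z) \<le> norm (G z)" by (simp add: abs_mult)
      qed measurable
      have "(LINT z|M 1. k z) - (LINT z|M (-1). k z)
          = (LINT z|?H. max 0 (1 * G z) * k z - max 0 (-1 * G z) * k z)"
        using i[of 1] i[of "-1"] by (simp add: int_M)
      also have "\<dots> = (LINT z|?H. G z * k z)"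
        by (intro Bochner_Integration.integral_cong) (auto simp: max_def)
      finally show ?thesis using that by simp
    qed
    have split: "cos (blinfun_apply w z + d) =
        cos (blinfun_apply (w o\<^sub>L Blinfun (\<lambda>x. (x, 0))) (fst z) + d) * cos (w (0, 1) * snd z + 0)
        - cos (blinfun_apply (w o\<^sub>L Blinfun (\<lambda>x. (x, 0))) (fst z) + (d - pi / 2)) * cos (w (0, 1) * snd z + (- pi / 2))"
      for w :: "('a \<times> real) \<Rightarrow>\<^sub>L real" and z d
    proof -
      have bl: "bounded_linear (\<lambda>x :: 'a. (x, 0 :: real))"
        by (intro bounded_linear_intro[of _ 1]) (auto simp: norm_Pair)
      have "w z = w ((fst z, 0) + snd z *\<^sub>R (0, 1))" by (cases z) simp
      also have "\<dots> = w (fst z, 0) + w (0, 1) * snd z"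
        by (simp only: blinfun.add_right blinfun.scaleR_right real_scaleR_def mult.commute)
      finally show ?thesis
        by (simp add: bounded_linear_Blinfun_apply[OF bl] cos_add sin_add cos_diff algebra_simps)
    qed
    have cos_eq: "(LINT z|M 1. cos (blinfun_apply w z + d)) = (LINT z|M (-1). cos (blinfun_apply w z + d))"
      for w :: "('a \<times> real) \<Rightarrow>\<^sub>L real" and d
    proof (rule eq)
      have i: "integrable ?H (\<lambda>z. G z * (cos (blinfun_apply w (fst z) + d) * cos (c * snd z + d')))" for w c d d'
      proof (rule Bochner_Integration.integrable_bound[OF G_int])
        have "\<bar>cos (blinfun_apply w (fst z) + d) * cos (c * snd z + d')\<bar> \<le> 1" for z :: "'a \<times> real"
          unfolding abs_mult by (intro mult_le_one abs_cos_le_one) auto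
        then show "AE z in ?H. norm (G z * (cos (blinfun_apply w (fst z) + d) * cos (c * snd z + d'))) \<le> norm (G z)"
          by (simp add: abs_mult[of "G _"] mult_left_le)
      qed measurable
      show "(LINT z|?H. G z * cos (blinfun_apply w z + d)) = 0"
        unfolding split[of w _ d] right_diff_distrib
        by (subst Bochner_Integration.integral_diff[OF i i]) (simp only: prod)
    qed measurable
    have "M 1 = M (-1)"
    proof (rule finite_measure_eq_trig[OF fM _ fM])
      show "(LINT z|M 1. cos (blinfun_apply w z)) = (LINT z|M (-1). cos (blinfun_apply w z))" for w :: "('a \<times> real) \<Rightarrow>\<^sub>L real"
        using cos_eq[of w 0] by simp
      show "(LINT z|M 1. sin (blinfun_apply w z)) = (LINT z|M (-1). sin (blinfun_apply w z))" for w :: "('a \<times> real) \<Rightarrow>\<^sub>L real"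
        using cos_eq[of w "- pi / 2"] by (simp add: cos_diff)
    qed (simp_all add: M_def)
    moreover have "emeasure (density ?H (\<lambda>z. ennreal (s * G z))) A = emeasure (M s) A" if A: "A \<in> sets ?H" for A s
    proof -
      have "UNIV \<times> {0<..} \<in> sets (borel :: ('a \<times> real) measure)" by (intro borel_open open_Times) auto
      then have "A \<in> sets borel" using A by (simp add: sets_half_space(1)[OF \<gamma>] sets_restrict_space_iff)
      then show ?thesis
        unfolding M_def using sets.sets_into_space[OF A] by (subst emeasure_distr) (auto simp: Int_absorb2 id_H)
    qed
    ultimately have "density ?H (\<lambda>z. ennreal (1 * G z)) = density ?H (\<lambda>z. ennreal (-1 * G z))"
      by (intro measure_eqI) (simp_all only: sets_density)
    then have "AE z in ?H. ennreal (1 * G z) = ennreal (-1 * G z)"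
      using fin[of 1] by (subst (asm) finite_density_unique) auto
    then show ?thesis
    proof eventually_elim
      case (elim z)
      show ?case
      proof (cases "0 \<le> G z")
        case True
        then have "ennreal (G z) = 0" using elim by (simp add: ennreal_neg)
        then show ?thesis using True by (simp add: G_def)
      next
        case False
        then have "ennreal (- G z) = 0" using elim by (simp add: ennreal_neg)
        then show ?thesis using False by simp
      qed
    qed
  qed
  have "AE z in ?H. \<forall>n. g z * indicator (UNIV \<times> {1 / real (n + 2)<..<real (n + 2)}) z = 0"
    unfolding AE_all_countable
  proof
    fix n
    have "1 / real (n + 2) < 1" by simp
    also have "\<dots> < real (n + 2)" by simp
    finally show "AE z in ?H. g z * indicator (UNIV \<times> {1 / real (n + 2)<..<real (n + 2)}) z = 0"
      by (intro AE) auto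
  qed
  with AE_space show ?thesis
  proof eventually_elim
    case (elim z)
    then have "snd z > 0" by (auto simp: sets_half_space(2)[OF \<gamma>])
    obtain n :: nat where n: "max (snd z) (1 / snd z) < n" using reals_Archimedean2 by blast
    then have "snd z < real (n + 2)" "1 / snd z < real (n + 2)" by auto
    then have "z \<in> UNIV \<times> {1 / real (n + 2)<..<real (n + 2)}"
      using \<open>snd z > 0\<close> by (cases z) (auto simp: field_simps)
    then show ?case using elim(2)[rule_format, of n] by simp
  qed
qed

section \<open>Gaussian measures on a separable Banach space\<close>

lemma std_normal_cos_sin:
  "(LINT t|std_normal_distribution. cos (c * t)) = exp (- c\<^sup>2 / 2)"
  "(LINT t|std_normal_distribution. sin (c * t)) = 0"
proof -
  interpret real_distribution std_normal_distribution by (rule real_dist_normal_dist)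
  have i: "integrable std_normal_distribution (\<lambda>t. iexp (c * t))"
    by (intro integrable_const_bound[of _ 1]) auto
  have "char std_normal_distribution c = complex_of_real (exp (- c\<^sup>2 / 2))"
    by (simp add: char_std_normal_distribution)
  then have eq: "(LINT t|std_normal_distribution. iexp (c * t)) = complex_of_real (exp (- c\<^sup>2 / 2))"
    unfolding char_def .
  have "(LINT t|std_normal_distribution. Re (iexp (c * t))) = exp (- c\<^sup>2 / 2)"
    using i by (subst integral_Re) (simp_all only: eq Re_complex_of_real)
  then show "(LINT t|std_normal_distribution. cos (c * t)) = exp (- c\<^sup>2 / 2)" by (simp add: Re_exp)
  have "(LINT t|std_normal_distribution. Im (iexp (c * t))) = 0"
    using i by (subst integral_Im) (simp_all only: eq Im_complex_of_real)
  then show "(LINT t|std_normal_distribution. sin (c * t)) = 0" by (simp add: Im_exp)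
qed

lemma integral_normal_scale:
  fixes k :: "real \<Rightarrow> real"
  assumes "\<sigma> > 0" and [measurable]: "k \<in> borel_measurable borel"
  shows "(LINT y|density lborel (normal_density 0 \<sigma>). k y) = (LINT t|std_normal_distribution. k (\<sigma> * t))"
proof -
  have *: "\<sigma> * normal_density 0 \<sigma> (\<sigma> * t) = std_normal_density t" for t
    using assms(1) by (simp add: normal_density_def real_sqrt_mult power_mult_distrib field_simps)
  have "(LINT y|density lborel (normal_density 0 \<sigma>). k y) = (LINT y|lborel. normal_density 0 \<sigma> y * k y)"
    by (subst integral_density) auto
  also have "\<dots> = \<bar>\<sigma>\<bar> *\<^sub>R (LINT t|lborel. normal_density 0 \<sigma> (0 + \<sigma> * t) * k (0 + \<sigma> * t))"
    using assms(1) by (intro lborel_integral_real_affine) simp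
  also have "\<dots> = (LINT t|lborel. std_normal_density t * k (\<sigma> * t))"
    using assms(1) by (simp add: *[symmetric] mult.assoc)
  also have "\<dots> = (LINT t|std_normal_distribution. k (\<sigma> * t))"
    by (subst integral_density) auto
  finally show ?thesis .
qed

lemma normal_second_moment:
  assumes "\<sigma> > 0"
  shows "integrable (density lborel (normal_density 0 \<sigma>)) (\<lambda>y. y\<^sup>2)"
    "(LINT y|density lborel (normal_density 0 \<sigma>). y\<^sup>2) = \<sigma>\<^sup>2"
proof -
  show "integrable (density lborel (normal_density 0 \<sigma>)) (\<lambda>y. y\<^sup>2)"
    using integrable_normal_moment[OF assms, of 0 2] by (subst integrable_density) auto
  show "(LINT y|density lborel (normal_density 0 \<sigma>). y\<^sup>2) = \<sigma>\<^sup>2"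
    using integral_normal_moment_even[OF assms, of 0 1] by (subst integral_density) auto
qed

locale wiener =
  fixes \<gamma> :: "'a::{banach,second_countable_topology} measure"
  assumes abstract_wiener: "abstract_wiener_measure \<gamma>"
begin

sublocale prob_space \<gamma>
  using abstract_wiener unfolding abstract_wiener_measure_def by blast

lemma sets_gamma [measurable_cong, simp]: "sets \<gamma> = sets borel"
  using abstract_wiener unfolding abstract_wiener_measure_def by blast

lemma space_gamma [simp]: "space \<gamma> = UNIV"
  using sets_eq_imp_space_eq[OF sets_gamma] by simp

lemma prob_UNIV [simp]: "measure \<gamma> UNIV = 1"
  using prob_space by simp

definition var :: "('a \<Rightarrow>\<^sub>L real) \<Rightarrow> real" where
  "var z = (LINT x|\<gamma>. (z x)\<^sup>2)"

lemma functional_gaussian: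
  fixes z :: "'a \<Rightarrow>\<^sub>L real"
  shows "integrable \<gamma> (\<lambda>x. (z x)\<^sup>2)" "(LINT x|\<gamma>. cos (z x)) = exp (- var z / 2)" "(LINT x|\<gamma>. sin (z x)) = 0"
proof -
  have "integrable \<gamma> (\<lambda>x. (z x)\<^sup>2) \<and> (LINT x|\<gamma>. cos (z x)) = exp (- var z / 2) \<and> (LINT x|\<gamma>. sin (z x)) = 0"
  proof (cases "z = 0")
    case True
    then show ?thesis by (simp add: var_def prob_space)
  next
    case False
    then obtain \<sigma> where \<sigma>: "\<sigma> > 0" "distr \<gamma> borel (blinfun_apply z) = density lborel (normal_density 0 \<sigma>)"
      using abstract_wiener unfolding abstract_wiener_measure_def by blast
    have z: "blinfun_apply z \<in> \<gamma> \<rightarrow>\<^sub>M borel" by measurable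
    have law: "(LINT x|\<gamma>. k (z x)) = (LINT y|density lborel (normal_density 0 \<sigma>). k y)"
      if "k \<in> borel_measurable borel" for k :: "real \<Rightarrow> real"
      unfolding \<sigma>(2)[symmetric] by (rule integral_distr[OF z that, symmetric])
    have "var z = \<sigma>\<^sup>2"
      unfolding var_def using law[of "\<lambda>y. y\<^sup>2"] normal_second_moment(2)[OF \<sigma>(1)] by simp
    moreover have "integrable \<gamma> (\<lambda>x. (z x)\<^sup>2)"
      using normal_second_moment(1)[OF \<sigma>(1)] integrable_distr_eq[OF z, of "\<lambda>y. y\<^sup>2"] unfolding \<sigma>(2) by simp
    ultimately show ?thesis
      using law[of cos] law[of sin] integral_normal_scale[OF \<sigma>(1), of cos] integral_normal_scale[OF \<sigma>(1), of sin]
      by (simp add: std_normal_cos_sin)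
  qed
  then show "integrable \<gamma> (\<lambda>x. (z x)\<^sup>2)" "(LINT x|\<gamma>. cos (z x)) = exp (- var z / 2)" "(LINT x|\<gamma>. sin (z x)) = 0"
    by auto
qed

end

text \<open>By the addition theorems and Fubini; the vanishing sine integrals remove the mixed terms.\<close>

lemma cos_sin_independent_sum:
  fixes f :: "'a \<Rightarrow> real" and g :: "'b \<Rightarrow> real"
  assumes M: "prob_space M" and N: "prob_space N"
    and [measurable]: "f \<in> borel_measurable M" "g \<in> borel_measurable N"
    and f: "(LINT x|M. sin (f x)) = 0" and g: "(LINT y|N. sin (g y)) = 0"
  shows "(LINT z|(M \<Otimes>\<^sub>M N). cos (f (fst z) + g (snd z))) = (LINT x|M. cos (f x)) * (LINT y|N. cos (g y))"
    "(LINT z|(M \<Otimes>\<^sub>M N). sin (f (fst z) + g (snd z))) = 0"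
proof -
  interpret M: prob_space M by fact
  interpret N: prob_space N by fact
  interpret P: pair_prob_space M N ..
  have j: "integrable N (\<lambda>x. cos (g x))" "integrable N (\<lambda>x. sin (g x))"
    by (auto intro!: N.integrable_const_bound[of _ 1])
  have k: "integrable (M \<Otimes>\<^sub>M N) (\<lambda>z. cos (f (fst z) + g (snd z)))"
      "integrable (M \<Otimes>\<^sub>M N) (\<lambda>z. sin (f (fst z) + g (snd z)))"
    by (auto intro!: P.integrable_const_bound[of _ 1])
  have "(LINT z|(M \<Otimes>\<^sub>M N). cos (f (fst z) + g (snd z))) = (LINT x|M. LINT y|N. cos (f x + g y))"
    using P.integral_fst'[OF k(1)] P.integral_fst'[OF k(2)] by simp
  also have "\<dots> = (LINT x|M. cos (f x) * (LINT y|N. cos (g y)))"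
    using j by (simp add: cos_add g)
  finally show "(LINT z|(M \<Otimes>\<^sub>M N). cos (f (fst z) + g (snd z))) = (LINT x|M. cos (f x)) * (LINT y|N. cos (g y))"
    by simp
  have "(LINT z|(M \<Otimes>\<^sub>M N). sin (f (fst z) + g (snd z))) = (LINT x|M. LINT y|N. sin (f x + g y))"
    using P.integral_fst'[OF k(1)] P.integral_fst'[OF k(2)] by simp
  also have "\<dots> = (LINT x|M. sin (f x) * (LINT y|N. cos (g y)))"
    using j by (simp add: sin_add g)
  finally show "(LINT z|(M \<Otimes>\<^sub>M N). sin (f (fst z) + g (snd z))) = 0" using f by simp
qed

context wiener begin

lemma var_add_scaled: "var (z + c *\<^sub>R w) = var z + 2 * c * (LINT x|\<gamma>. z x * w x) + c\<^sup>2 * var w"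
  and integrable_product: "integrable \<gamma> (\<lambda>x. blinfun_apply z x * blinfun_apply w x)"
proof -
  show i: "integrable \<gamma> (\<lambda>x. blinfun_apply z x * blinfun_apply w x)"
    by (rule square_integrable_mult[OF _ _ functional_gaussian(1) functional_gaussian(1)]) measurable
  have "var (z + c *\<^sub>R w) = (LINT x|\<gamma>. (z x)\<^sup>2 + 2 * c * (z x * w x) + c\<^sup>2 * (w x)\<^sup>2)"
    unfolding var_def by (simp add: blinfun.add_left blinfun.scaleR_left power2_eq_square algebra_simps)
  also have "\<dots> = var z + 2 * c * (LINT x|\<gamma>. z x * w x) + c\<^sup>2 * var w"
    unfolding var_def using i functional_gaussian(1) by simp
  finally show "var (z + c *\<^sub>R w) = var z + 2 * c * (LINT x|\<gamma>. z x * w x) + c\<^sup>2 * var w" .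
qed

text \<open>The Fourier transform of \<open>\<gamma>\<close> depends on the variances of functionals only, and the parallelogram
  identity preserves the total variance of a functional on the product.\<close>

lemma rotation_invariant:
  "distr (\<gamma> \<Otimes>\<^sub>M \<gamma>) borel (\<lambda>p. ((1 / sqrt 2) *\<^sub>R (fst p - snd p), (1 / sqrt 2) *\<^sub>R (fst p + snd p)))
   = distr (\<gamma> \<Otimes>\<^sub>M \<gamma>) borel (\<lambda>p. p)" (is "distr ?P _ ?R = distr ?P _ ?I")
proof -
  interpret P: pair_prob_space \<gamma> \<gamma> ..
  have sP [measurable_cong]: "sets (\<gamma> \<Otimes>\<^sub>M \<gamma>) = sets (borel :: ('a \<times> 'a) measure)"
    by (subst borel_prod[symmetric]) (intro sets_pair_measure_cong sets_gamma)
  have R: "?R \<in> ?P \<rightarrow>\<^sub>M borel" "?I \<in> ?P \<rightarrow>\<^sub>M borel"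
    by (subst measurable_cong_sets[OF sP refl], intro borel_measurable_continuous_onI continuous_intros)+
  define w1 w2 :: "(('a \<times> 'a) \<Rightarrow>\<^sub>L real) \<Rightarrow> 'a \<Rightarrow>\<^sub>L real"
    where "w1 w = w o\<^sub>L Blinfun (\<lambda>x. (x, 0))" and "w2 w = w o\<^sub>L Blinfun (\<lambda>x. (0, x))" for w
  have bl: "bounded_linear (\<lambda>x :: 'a. (x, 0 :: 'a))" "bounded_linear (\<lambda>x :: 'a. (0 :: 'a, x))"
    by (auto intro!: bounded_linear_intro[of _ 1] simp: norm_Pair)
  have split: "w p = w1 w (fst p) + w2 w (snd p)" for w :: "('a \<times> 'a) \<Rightarrow>\<^sub>L real" and p
    unfolding w1_def w2_def
    by (simp add: bounded_linear_Blinfun_apply[OF bl(1)] bounded_linear_Blinfun_apply[OF bl(2)] blinfun.add_right[symmetric])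
  define c :: real where "c = 1 / sqrt 2"
  have c2: "c\<^sup>2 = 1 / 2" unfolding c_def by (simp add: power_divide)
  have splitR: "w (?R p) = (c *\<^sub>R (w1 w + w2 w)) (fst p) + (c *\<^sub>R (w2 w - w1 w)) (snd p)"
    for w :: "('a \<times> 'a) \<Rightarrow>\<^sub>L real" and p
  proof -
    have "w (?R p) = w1 w (c *\<^sub>R (fst p - snd p)) + w2 w (c *\<^sub>R (fst p + snd p))"
      using split[of w "?R p"] unfolding c_def fst_conv snd_conv .
    then show ?thesis by (simp add: blinfun.bilinear_simps algebra_simps)
  qed
  have var0: "var (c *\<^sub>R z) = c\<^sup>2 * var z" for c z
    using var_add_scaled[of 0 c z] by (simp add: var_def[of 0])
  have var_rot: "var (c *\<^sub>R (z + w)) + var (c *\<^sub>R (w - z)) = var z + var w" for z w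
  proof -
    have "var (z + w) = var z + 2 * (LINT x|\<gamma>. z x * w x) + var w" using var_add_scaled[of z 1 w] by simp
    moreover have "var (w - z) = var w - 2 * (LINT x|\<gamma>. z x * w x) + var z"
      using var_add_scaled[of w "-1" z] by (simp add: mult.commute)
    ultimately show ?thesis unfolding var0 c2 by (simp add: field_simps)
  qed
  note gs = functional_gaussian(2,3)
  have eqs: "(LINT p|?P. cos (blinfun_apply z (fst p) + blinfun_apply w (snd p))) = exp (- (var z + var w) / 2)"
    "(LINT p|?P. sin (blinfun_apply z (fst p) + blinfun_apply w (snd p))) = 0" for z w
    using cos_sin_independent_sum[OF prob_space_axioms prob_space_axioms, of "blinfun_apply z" "blinfun_apply w"]
    by (simp_all add: gs exp_add[symmetric] add_divide_distrib)
  show ?thesis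
  proof (rule finite_measure_eq_trig)
    fix w :: "('a \<times> 'a) \<Rightarrow>\<^sub>L real"
    have "(LINT p|distr ?P borel ?R. cos (w p)) = (LINT p|?P. cos (w (?R p)))"
      by (rule integral_distr[OF R(1)]) measurable
    also have "\<dots> = exp (- (var (w1 w) + var (w2 w)) / 2)" unfolding splitR eqs var_rot ..
    also have "\<dots> = (LINT p|?P. cos (w p))" unfolding split eqs ..
    also have "\<dots> = (LINT p|distr ?P borel ?I. cos (w p))" by (rule integral_distr[OF R(2), symmetric]) measurable
    finally show "(LINT p|distr ?P borel ?R. cos (w p)) = (LINT p|distr ?P borel ?I. cos (w p))" .
    have "(LINT p|distr ?P borel ?R. sin (w p)) = (LINT p|?P. sin (w (?R p)))"
      by (rule integral_distr[OF R(1)]) measurable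
    also have "\<dots> = 0" unfolding splitR eqs ..
    also have "\<dots> = (LINT p|?P. sin (w p))" unfolding split eqs ..
    also have "\<dots> = (LINT p|distr ?P borel ?I. sin (w p))" by (rule integral_distr[OF R(2), symmetric]) measurable
    finally show "(LINT p|distr ?P borel ?R. sin (w p)) = (LINT p|distr ?P borel ?I. sin (w p))" .
  qed (auto intro!: P.finite_measure_distr R)
qed

definition tail :: "real \<Rightarrow> real" where
  "tail t = measure \<gamma> {x. t < norm x}"

text \<open>For independent copies, \<open>(x - y)/\<surd>2\<close> small and \<open>(x + y)/\<surd>2\<close> large in norm force both \<open>x\<close> and \<open>y\<close>
  to be large, while by rotation invariance the former event has product probability.\<close>

lemma fernique_inequality: "(1 - tail s) * tail t \<le> (tail ((t - s) / sqrt 2))\<^sup>2"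
proof -
  interpret P: pair_prob_space \<gamma> \<gamma> ..
  let ?P = "\<gamma> \<Otimes>\<^sub>M \<gamma>"
  let ?R = "\<lambda>p :: 'a \<times> 'a. ((1 / sqrt 2) *\<^sub>R (fst p - snd p), (1 / sqrt 2) *\<^sub>R (fst p + snd p))"
  have sP [measurable_cong]: "sets (\<gamma> \<Otimes>\<^sub>M \<gamma>) = sets (borel :: ('a \<times> 'a) measure)"
    by (subst borel_prod[symmetric]) (intro sets_pair_measure_cong sets_gamma)
  have R: "?R \<in> ?P \<rightarrow>\<^sub>M borel" "(\<lambda>p. p) \<in> ?P \<rightarrow>\<^sub>M borel"
    by (subst measurable_cong_sets[OF sP refl], intro borel_measurable_continuous_onI continuous_intros)+
  have m [measurable]: "{x. norm x \<le> s} \<in> sets borel" "{x. s < norm x} \<in> sets borel" for s :: real and x :: 'a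
    by measurable
  have Ps: "measure ?P (A \<times> B) = measure \<gamma> A * measure \<gamma> B" if "A \<in> sets borel" "B \<in> sets borel" for A B
    using that emeasure_pair_measure_Times[of A \<gamma> B]
    by (simp add: measure_def enn2real_mult)
  let ?A = "{x :: 'a. norm x \<le> s}" and ?B = "{x :: 'a. t < norm x}" and ?r = "(t - s) / sqrt 2"
  have AB: "?A \<times> ?B \<in> sets (borel :: ('a \<times> 'a) measure)"
    unfolding sP[symmetric] by (intro pair_measureI) simp_all
  have "1 - tail s = measure \<gamma> ?A"
    unfolding tail_def using prob_compl[of "{x. s < norm x}"] by (simp add: Compl_eq_Diff_UNIV[symmetric] Collect_neg_eq[symmetric] not_less)
  then have "(1 - tail s) * tail t = measure ?P (?A \<times> ?B)"
    unfolding tail_def by (subst Ps) simp_all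
  also have "\<dots> = measure (distr ?P borel (\<lambda>p. p)) (?A \<times> ?B)"
    using AB R by (subst measure_distr) (auto simp: space_pair_measure)
  also have "\<dots> = measure (distr ?P borel ?R) (?A \<times> ?B)" unfolding rotation_invariant ..
  also have "\<dots> = measure ?P (?R -` (?A \<times> ?B) \<inter> space ?P)"
    using AB R by (subst measure_distr) auto
  also have "\<dots> \<le> measure ?P ({x. ?r < norm x} \<times> {x. ?r < norm x})"
  proof (rule P.finite_measure_mono)
    show "?R -` (?A \<times> ?B) \<inter> space ?P \<subseteq> {x. ?r < norm x} \<times> {x. ?r < norm x}"
    proof
      fix p assume "p \<in> ?R -` (?A \<times> ?B) \<inter> space ?P"
      then have "norm ((1 / sqrt 2) *\<^sub>R (fst p - snd p)) \<le> s" "t < norm ((1 / sqrt 2) *\<^sub>R (fst p + snd p))"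
        by (auto simp del: norm_scaleR scaleR_diff_right scaleR_add_right)
      then have d: "norm (fst p - snd p) \<le> sqrt 2 * s" "sqrt 2 * t < norm (fst p + snd p)"
        unfolding norm_scaleR by (simp_all add: field_simps)
      have "norm (fst p + snd p) \<le> norm (fst p + fst p) + norm (snd p - fst p)"
        using norm_triangle_ineq[of "fst p + fst p" "snd p - fst p"] by simp
      moreover have "norm (fst p + snd p) \<le> norm (snd p + snd p) + norm (fst p - snd p)"
        using norm_triangle_ineq[of "snd p + snd p" "fst p - snd p"] by (simp add: add.commute)
      moreover have "norm (x + x) = 2 * norm x" for x :: 'a
        using norm_scaleR[of 2 x] by (simp add: scaleR_2)
      ultimately have "sqrt 2 * (t - s) < 2 * norm (fst p)" "sqrt 2 * (t - s) < 2 * norm (snd p)"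
        using d norm_minus_commute[of "snd p" "fst p"] by (auto simp: algebra_simps)
      moreover have "?r = sqrt 2 * (t - s) / 2" by (simp add: real_divide_square_eq field_simps)
      ultimately have "?r < norm (fst p)" "?r < norm (snd p)" by linarith+
      then show "p \<in> {x. ?r < norm x} \<times> {x. ?r < norm x}" by (cases p) simp
    qed
    show "{x. ?r < norm x} \<times> {x. ?r < norm x} \<in> sets ?P" by (intro pair_measureI) simp_all
  qed
  also have "\<dots> = (tail ?r)\<^sup>2" unfolding tail_def power2_eq_square by (rule Ps) simp_all
  finally show ?thesis .
qed

lemma tail_antimono: "s \<le> t \<Longrightarrow> tail t \<le> tail s"
  unfolding tail_def by (intro finite_measure_mono) auto

lemma tail_tendsto_0: "(\<lambda>n. tail (real n)) \<longlonglongrightarrow> 0"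
proof -
  have "(\<lambda>n. measure \<gamma> {x. real n < norm x}) \<longlonglongrightarrow> measure \<gamma> (\<Inter>n. {x. real n < norm x})"
    by (rule finite_Lim_measure_decseq) (auto simp: decseq_def)
  also have "(\<Inter>n. {x :: 'a. real n < norm x}) = {}"
  proof -
    have "\<exists>n. \<not> real n < norm x" for x :: 'a
      using reals_Archimedean2[of "norm x"] by (auto intro: less_asym)
    then show ?thesis by blast
  qed
  finally show ?thesis by (simp add: tail_def)
qed

text \<open>Fernique's inequality makes the tails along \<open>2\<^sup>n t\<^sub>0\<close> decay at least as fast as
  \<open>8\<^sup>-\<^sup>n\<close>, which beats the growth of the square of the norm.\<close>

lemma norm_square_integrable: "integrable \<gamma> (\<lambda>x. (norm x)\<^sup>2)"
proof -
  \<comment> \<open>The bound \<open>1/9\<close> makes \<open>tail s / (1 - tail s)\<close> at most \<open>1/8\<close>.\<close>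
  obtain N where N: "\<forall>n\<ge>N. norm (tail (real n) - 0) < 1 / 9"
    using LIMSEQ_D[OF tail_tendsto_0, of "1/9"] by auto
  define s where "s = real (N + 1)"
  have s: "s \<ge> 1" "tail s < 1 / 9" unfolding s_def using N[rule_format, of "N + 1"] by (auto simp: tail_def)
  define t where "t n = 2 ^ n * (2 * s)" for n :: nat
  define r where "r u = tail u / (1 - tail s)" for u
  have nn: "0 \<le> tail u" for u by (simp add: tail_def)
  have r_nn: "0 \<le> r u" for u unfolding r_def using s nn by simp
  have r_mono: "u \<le> u' \<Longrightarrow> r u' \<le> r u" for u u'
    unfolding r_def using tail_antimono s by (intro divide_right_mono) auto
  have r_step: "r (s + sqrt 2 * u) \<le> (r u)\<^sup>2" for u
  proof -
    have "r (s + sqrt 2 * u) = ((1 - tail s) * tail (s + sqrt 2 * u)) / (1 - tail s)\<^sup>2"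
      unfolding r_def using s by (simp add: power2_eq_square)
    also have "\<dots> \<le> (tail u)\<^sup>2 / (1 - tail s)\<^sup>2"
      using fernique_inequality[of s "s + sqrt 2 * u"] by (intro divide_right_mono) auto
    finally show ?thesis by (simp add: r_def power_divide)
  qed
  have r_double: "r (t (Suc n)) \<le> (r (t n))\<^sup>2" for n
  proof -
    have sq: "sqrt 2 \<le> 3 / 2" by (rule real_le_lsqrt) (auto simp: power2_eq_square)
    have "2 * s \<le> t n" unfolding t_def using s by simp
    moreover have "sqrt 2 * t n \<le> 3 / 2 * t n" using sq s by (intro mult_right_mono) (auto simp: t_def)
    moreover have "t (Suc n) = 2 * t n" unfolding t_def by simp
    ultimately have "s + sqrt 2 * t n \<le> t (Suc n)" by linarith
    then show ?thesis by (rule order_trans[OF r_mono r_step])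
  qed
  have r_t: "r (t n) \<le> (1 / 8) ^ Suc n" for n
  proof (induction n)
    case 0
    have "r (t 0) \<le> r s" using s by (intro r_mono) (simp add: t_def)
    also have "r s \<le> 1 / 8" unfolding r_def using s nn by (simp add: field_simps)
    finally show ?case by simp
  next
    case (Suc n)
    have "r (t (Suc n)) \<le> r (t n) * r (t n)" using r_double[of n] by (simp add: power2_eq_square)
    also have "\<dots> \<le> (1 / 8) * (1 / 8) ^ Suc n"
    proof (intro mult_mono Suc)
      have "(1 / 8) ^ Suc n \<le> (1 / 8 :: real)" using power_decreasing[of 1 "Suc n" "1/8::real"] by simp
      then show "r (t n) \<le> 1 / 8" using Suc by linarith
    qed (use r_nn in auto)
    finally show ?case by simp
  qed
  have tail_r: "tail u \<le> r u" for u
    unfolding r_def using nn[of u] nn[of s] s by (simp add: field_simps mult_left_le)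
  have tail_t: "tail (t n) \<le> (1 / 8) ^ n" for n
  proof -
    have "(1 / 8) ^ Suc n \<le> (1 / 8 :: real) ^ n" by simp
    then show ?thesis using r_t[of n] tail_r[of "t n"] by linarith
  qed
  have ptw: "ennreal ((norm x)\<^sup>2) \<le> ennreal ((t 0)\<^sup>2) + (\<Sum>n. ennreal ((t (Suc n))\<^sup>2) * indicator {x. t n < norm x} x)" for x :: 'a
  proof (cases "norm x \<le> t 0")
    case True
    then have "(norm x)\<^sup>2 \<le> (t 0)\<^sup>2" by (intro power_mono) auto
    then show ?thesis by (meson add_increasing2 ennreal_leI zero_le)
  next
    case False
    \<comment> \<open>The first \<open>t m\<close> above \<open>norm x\<close> has \<open>m > 0\<close>; its predecessor provides the summand that dominates.\<close>
    have "\<exists>n. norm x \<le> t n"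
    proof -
      obtain n where "norm x < real n" using reals_Archimedean2 by blast
      also have "real n \<le> 2 ^ n * 1" by (simp add: of_nat_less_two_power less_imp_le)
      also have "\<dots> \<le> t n" unfolding t_def using s by (intro mult_left_mono) auto
      finally show ?thesis by (intro exI[of _ n]) simp
    qed
    define m where "m = (LEAST n. norm x \<le> t n)"
    have m: "norm x \<le> t m" unfolding m_def using \<open>\<exists>n. norm x \<le> t n\<close> by (rule LeastI_ex)
    then have "m \<noteq> 0" using False by metis
    then obtain n where n: "m = Suc n" by (cases m) auto
    then have "t n < norm x" using not_less_Least[of n "\<lambda>n. norm x \<le> t n"] unfolding m_def by simp
    then have "ennreal ((norm x)\<^sup>2) \<le> ennreal ((t (Suc n))\<^sup>2) * indicator {x. t n < norm x} x"
      using m n by (auto intro!: ennreal_leI power_mono)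
    also have "\<dots> \<le> (\<Sum>n. ennreal ((t (Suc n))\<^sup>2) * indicator {x. t n < norm x} x)"
    proof -
      define F where "F n = ennreal ((t (Suc n))\<^sup>2) * indicator {x. t n < norm x} x" for n
      show ?thesis using sum_le_suminf[of F "{n}"] by (simp add: F_def[symmetric])
    qed
    finally show ?thesis by (meson add_increasing zero_le)
  qed
  have "(\<integral>\<^sup>+x. ennreal ((norm x)\<^sup>2) \<partial>\<gamma>)
      \<le> (\<integral>\<^sup>+x. ennreal ((t 0)\<^sup>2) + (\<Sum>n. ennreal ((t (Suc n))\<^sup>2) * indicator {x. t n < norm x} x) \<partial>\<gamma>)"
    by (intro nn_integral_mono ptw)
  also have "\<dots> = ennreal ((t 0)\<^sup>2) + (\<Sum>n. ennreal ((t (Suc n))\<^sup>2) * emeasure \<gamma> {x. t n < norm x})"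
    by (subst nn_integral_add) (auto simp: nn_integral_suminf nn_integral_cmult_indicator emeasure_space_1[simplified])
  also have "(\<Sum>n. ennreal ((t (Suc n))\<^sup>2) * emeasure \<gamma> {x. t n < norm x}) \<le> (\<Sum>n. ennreal (16 * s\<^sup>2 * (1 / 2) ^ n))"
  proof (rule suminf_le)
    fix n
    have "ennreal ((t (Suc n))\<^sup>2) * emeasure \<gamma> {x. t n < norm x} = ennreal ((t (Suc n))\<^sup>2 * tail (t n))"
      by (simp add: tail_def emeasure_eq_measure ennreal_mult)
    also have "\<dots> \<le> ennreal ((t (Suc n))\<^sup>2 * (1 / 8) ^ n)"
      by (intro ennreal_leI mult_left_mono tail_t) simp
    also have "(t (Suc n))\<^sup>2 * (1 / 8) ^ n = 16 * s\<^sup>2 * (1 / 2) ^ n"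
      by (simp add: t_def power_mult_distrib power2_eq_square power_divide flip: power_mult_distrib)
        (simp add: power_mult_distrib field_simps flip: power_mult_distrib)
    finally show "ennreal ((t (Suc n))\<^sup>2) * emeasure \<gamma> {x. t n < norm x} \<le> ennreal (16 * s\<^sup>2 * (1 / 2) ^ n)" .
  qed auto
  also have "(\<Sum>n. ennreal (16 * s\<^sup>2 * (1 / 2) ^ n)) = ennreal (\<Sum>n. 16 * s\<^sup>2 * (1 / 2) ^ n)"
    by (intro suminf_ennreal2 summable_mult summable_geometric) auto
  finally have "(\<integral>\<^sup>+x. ennreal ((norm x)\<^sup>2) \<partial>\<gamma>) < \<infinity>"
    by (simp add: add_left_mono le_less_trans ennreal_plus[symmetric] del: ennreal_plus)
  then show ?thesis by (intro integrableI_bounded) simp_all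
qed

lemma cm_R_integrable:
  assumes f [measurable]: "f \<in> borel_measurable \<gamma>" "integrable \<gamma> (\<lambda>x. (f x)\<^sup>2)"
  shows "integrable \<gamma> (\<lambda>x. f x *\<^sub>R x)"
proof (rule Bochner_Integration.integrable_bound)
  show "integrable \<gamma> (\<lambda>x. (f x)\<^sup>2 + (norm x)\<^sup>2)"
    by (intro Bochner_Integration.integrable_add f norm_square_integrable)
  have "\<bar>f x\<bar> * norm x \<le> (f x)\<^sup>2 + (norm x)\<^sup>2" for x
  proof -
    have "2 * (\<bar>f x\<bar> * norm x) \<le> (f x)\<^sup>2 + (norm x)\<^sup>2"
      using sum_squares_bound[of "\<bar>f x\<bar>" "norm x"] by (simp add: mult.assoc)
    moreover have "0 \<le> \<bar>f x\<bar> * norm x" by simp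
    ultimately show ?thesis by linarith
  qed
  then show "AE x in \<gamma>. norm (f x *\<^sub>R x) \<le> norm ((f x)\<^sup>2 + (norm x)\<^sup>2)" by simp
qed measurable

lemma functional_cm_R:
  assumes "f \<in> borel_measurable \<gamma>" "integrable \<gamma> (\<lambda>x. (f x)\<^sup>2)"
  shows "blinfun_apply z (cm_R \<gamma> f) = (LINT x|\<gamma>. f x * z x)" "integrable \<gamma> (\<lambda>x. f x * z x)"
proof -
  have i: "integrable \<gamma> (\<lambda>x. f x *\<^sub>R x)" using cm_R_integrable[OF assms] .
  show "blinfun_apply z (cm_R \<gamma> f) = (LINT x|\<gamma>. f x * z x)"
    unfolding cm_R_def using integral_bounded_linear[OF blinfun.bounded_linear_right[of z] i]
    by (simp add: blinfun.scaleR_right)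
  show "integrable \<gamma> (\<lambda>x. f x * z x)"
    using integrable_bounded_linear[OF blinfun.bounded_linear_right[of z] i]
    by (simp add: blinfun.scaleR_right)
qed

text \<open>The representative that the choice operator picks for \<open>R\<^sup>-\<^sup>1 h\<close> agrees almost everywhere
  with the functional, because a limit of functionals that is orthogonal to all functionals vanishes.\<close>

lemma cm_norm_cov_op: "(cm_norm \<gamma> (cov_op \<gamma> xs))\<^sup>2 = var xs"
proof -
  let ?h = "cov_op \<gamma> xs" and ?f = "cm_hat \<gamma> (cov_op \<gamma> xs)"
  have "blinfun_apply xs \<in> cm_dual \<gamma>"
    unfolding cm_dual_def using functional_gaussian(1)[of xs] by (auto intro!: exI[of _ xs])
  then have "\<exists>f. f \<in> cm_dual \<gamma> \<and> cm_R \<gamma> f = ?h" unfolding cov_op_def by blast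
  then have "?f \<in> cm_dual \<gamma> \<and> cm_R \<gamma> ?f = ?h" unfolding cm_hat_def by (rule someI_ex)
  then have f [measurable]: "?f \<in> borel_measurable \<gamma>" and f2: "integrable \<gamma> (\<lambda>x. (?f x)\<^sup>2)"
    and dense: "\<And>\<epsilon>. \<epsilon> > 0 \<Longrightarrow> \<exists>z :: 'a \<Rightarrow>\<^sub>L real. (LINT x|\<gamma>. (?f x - z x)\<^sup>2) < \<epsilon>"
    and R: "cm_R \<gamma> ?f = cm_R \<gamma> (blinfun_apply xs)"
    unfolding cm_dual_def cov_op_def by auto
  have xs: "blinfun_apply xs \<in> borel_measurable \<gamma>" by measurable
  define d where "d x = ?f x - xs x" for x
  have d [measurable]: "d \<in> borel_measurable \<gamma>" unfolding d_def by measurable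
  have fz: "integrable \<gamma> (\<lambda>x. ?f x * blinfun_apply z x)" for z by (rule functional_cm_R[OF f f2])
  have orth: "(LINT x|\<gamma>. d x * z x) = 0" "integrable \<gamma> (\<lambda>x. d x * z x)" for z :: "'a \<Rightarrow>\<^sub>L real"
  proof -
    have "(LINT x|\<gamma>. ?f x * z x) = (LINT x|\<gamma>. xs x * z x)"
      using functional_cm_R(1)[OF f f2, of z] functional_cm_R(1)[OF xs functional_gaussian(1), of z] R by simp
    then show "(LINT x|\<gamma>. d x * z x) = 0" "integrable \<gamma> (\<lambda>x. d x * z x)"
      unfolding d_def left_diff_distrib using fz[of z] integrable_product[of xs z] by auto
  qed
  have sq: "integrable \<gamma> (\<lambda>x. (?f x - z x)\<^sup>2)" for z :: "'a \<Rightarrow>\<^sub>L real"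
  proof -
    have "integrable \<gamma> (\<lambda>x. (?f x)\<^sup>2 + (z x)\<^sup>2 - 2 * (?f x * z x))"
      using f2 fz[of z] functional_gaussian(1)[of z] by auto
    then show ?thesis by (simp add: power2_diff mult.assoc)
  qed
  have d2: "integrable \<gamma> (\<lambda>x. (d x)\<^sup>2)" unfolding d_def by (rule sq)
  have "(LINT x|\<gamma>. (d x)\<^sup>2) \<le> 0 + \<epsilon>" if \<epsilon>: "\<epsilon> > 0" for \<epsilon>
  proof -
    obtain z :: "'a \<Rightarrow>\<^sub>L real" where z: "(LINT x|\<gamma>. (?f x - z x)\<^sup>2) < \<epsilon>" using dense[OF \<epsilon>] by blast
    have "(LINT x|\<gamma>. (d x)\<^sup>2) + (LINT x|\<gamma>. (z x - xs x)\<^sup>2) =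
       (LINT x|\<gamma>. (d x)\<^sup>2 + (z x - xs x)\<^sup>2)"
    proof -
      have "integrable \<gamma> (\<lambda>x. (z x - xs x)\<^sup>2)"
        using functional_gaussian(1)[of "z - xs"] unfolding blinfun.diff_left .
      then show ?thesis using d2 by simp
    qed
    also have "\<dots> = (LINT x|\<gamma>. (?f x - z x)\<^sup>2 + 2 * (d x * (z - xs) x))"
      by (intro Bochner_Integration.integral_cong)
        (auto simp: d_def blinfun.diff_left power2_eq_square algebra_simps)
    also have "\<dots> = (LINT x|\<gamma>. (?f x - z x)\<^sup>2)" using sq[of z] orth[of "z - xs"] by simp
    finally have "(LINT x|\<gamma>. (d x)\<^sup>2) + (LINT x|\<gamma>. (z x - xs x)\<^sup>2) = (LINT x|\<gamma>. (?f x - z x)\<^sup>2)" .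
    moreover have "0 \<le> (LINT x|\<gamma>. (z x - xs x)\<^sup>2)" by (rule integral_nonneg_AE) simp
    ultimately show ?thesis using z by linarith
  qed
  then have "(LINT x|\<gamma>. (d x)\<^sup>2) \<le> 0" by (rule field_le_epsilon)
  then have "(LINT x|\<gamma>. (d x)\<^sup>2) = 0" by (intro antisym) (auto intro: integral_nonneg_AE)
  then have "AE x in \<gamma>. (d x)\<^sup>2 = 0" using d2 by (subst (asm) integral_nonneg_eq_0_iff_AE) auto
  then have ae: "AE x in \<gamma>. ?f x * ?f x = (xs x)\<^sup>2" by eventually_elim (simp add: d_def power2_eq_square)
  have "cm_inner \<gamma> ?h ?h = var xs"
    unfolding cm_inner_def var_def using ae by (intro integral_cong_AE) auto
  moreover have "0 \<le> var xs" unfolding var_def by (intro integral_nonneg_AE) auto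
  ultimately show ?thesis unfolding cm_norm_def by simp
qed

text \<open>Replacing the component of \<open>x\<close> along \<open>h\<close> by an independent standard Gaussian keeps the law:
  \<open>\<gamma>\<close> disintegrates into standard Gaussians on the lines parallel to \<open>h\<close>.\<close>

lemma gaussian_resampling:
  fixes xs :: "'a \<Rightarrow>\<^sub>L real"
  defines "h \<equiv> cov_op \<gamma> xs"
  assumes "cm_norm \<gamma> h = 1"
  shows "xs h = 1"
    and "(\<lambda>p. fst p + (snd p - xs (fst p)) *\<^sub>R h) \<in> \<gamma> \<Otimes>\<^sub>M gauss1 \<rightarrow>\<^sub>M borel"
    and "distr (\<gamma> \<Otimes>\<^sub>M gauss1) borel (\<lambda>p. fst p + (snd p - xs (fst p)) *\<^sub>R h) = \<gamma>"
proof -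
  interpret g: prob_space gauss1 by (rule prob_space_normal_density) simp
  interpret P: pair_prob_space \<gamma> gauss1 ..
  let ?T = "\<lambda>p. fst p + (snd p - xs (fst p)) *\<^sub>R h"
  have v1: "var xs = 1" using cm_norm_cov_op[of xs] assms by simp
  have zh: "z h = (LINT x|\<gamma>. xs x * z x)" for z :: "'a \<Rightarrow>\<^sub>L real"
    unfolding h_def cov_op_def by (rule functional_cm_R) (use functional_gaussian(1) in auto)
  show "xs h = 1" using zh[of xs] v1 by (simp add: var_def power2_eq_square)
  have sP: "sets (\<gamma> \<Otimes>\<^sub>M gauss1) = sets (borel :: ('a \<times> real) measure)"
    by (subst borel_prod[symmetric]) (intro sets_pair_measure_cong, simp_all)
  have T: "?T \<in> \<gamma> \<Otimes>\<^sub>M gauss1 \<rightarrow>\<^sub>M borel"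
    by (subst measurable_cong_sets[OF sP refl], intro borel_measurable_continuous_onI continuous_intros
        bounded_linear.continuous_on[OF blinfun.bounded_linear_right])
  then show "?T \<in> \<gamma> \<Otimes>\<^sub>M gauss1 \<rightarrow>\<^sub>M borel" .
  have zT: "z (?T p) = (z + (- z h) *\<^sub>R xs) (fst p) + z h * snd p" for z :: "'a \<Rightarrow>\<^sub>L real" and p
    by (simp add: blinfun.bilinear_simps algebra_simps)
  have v: "var (z + (- z h) *\<^sub>R xs) = var z - (z h)\<^sup>2" for z :: "'a \<Rightarrow>\<^sub>L real"
    unfolding var_add_scaled using zh[of z] by (simp add: v1 mult.commute power2_eq_square)
  note gs = functional_gaussian(2,3)
  have eqs: "(LINT p|(\<gamma> \<Otimes>\<^sub>M gauss1). cos (z (?T p))) = exp (- var z / 2)"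
    "(LINT p|(\<gamma> \<Otimes>\<^sub>M gauss1). sin (z (?T p))) = 0" for z :: "'a \<Rightarrow>\<^sub>L real"
    unfolding zT
    using cos_sin_independent_sum[OF prob_space_axioms g.prob_space_axioms, of "blinfun_apply (z + (- z h) *\<^sub>R xs)" "\<lambda>t. z h * t"]
    by (simp_all only: gs std_normal_cos_sin v)
      (simp_all add: exp_add[symmetric] field_simps)
  show "distr (\<gamma> \<Otimes>\<^sub>M gauss1) borel ?T = \<gamma>"
  proof (rule finite_measure_eq_trig)
    fix z :: "'a \<Rightarrow>\<^sub>L real"
    show "(LINT x|distr (\<gamma> \<Otimes>\<^sub>M gauss1) borel ?T. cos (z x)) = (LINT x|\<gamma>. cos (z x))"
      by (subst integral_distr[OF T]) (simp_all only: gs eqs, measurable)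
    show "(LINT x|distr (\<gamma> \<Otimes>\<^sub>M gauss1) borel ?T. sin (z x)) = (LINT x|\<gamma>. sin (z x))"
      by (subst integral_distr[OF T]) (simp_all only: gs eqs, measurable)
  qed (auto intro!: P.finite_measure_distr T finite_measure_axioms)
qed

end

section \<open>Gaussian rearrangement on the line\<close>

abbreviation gauss_cdf :: "real \<Rightarrow> real" where
  "gauss_cdf \<equiv> cdf gauss1"

lemma gauss_phi_eq_measure: "gauss_phi e = measure gauss1 {x. ereal x < e}"
proof -
  have "gauss_phi e = (LINT x|lborel. indicator {x. ereal x < e} x * std_normal_density x)"
    unfolding gauss_phi_def interval_lebesgue_integral_def set_lebesgue_integral_def
    by (simp add: einterval_def std_normal_density_def flip: integral_mult_right_zero)
  also have "\<dots> = (LINT x|gauss1. indicator {x. ereal x < e} x)"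
    by (subst integral_density) (auto simp: mult.commute)
  finally show ?thesis by simp
qed

lemma gauss1_null_singleton: "measure gauss1 {t} = 0"
proof -
  have "emeasure gauss1 {t} = 0" by (subst emeasure_density) (auto simp: nn_integral_0_iff_AE AE_lborel_singleton)
  then show ?thesis by (simp add: measure_def)
qed

lemma gauss_phi_real: "gauss_phi (ereal t) = gauss_cdf t"
proof -
  interpret real_distribution gauss1 by (rule real_dist_normal_dist)
  have "{..t} = {..<t} \<union> {t}" by auto
  then have "measure gauss1 {..t} = measure gauss1 {..<t} + measure gauss1 {t}"
    by (simp only:) (subst finite_measure_Union, auto)
  then show ?thesis unfolding gauss_phi_eq_measure cdf_def gauss1_null_singleton by (simp add: lessThan_def)
qed

lemma gauss_cdf_strict_mono: "s < t \<Longrightarrow> gauss_cdf s < gauss_cdf t"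
proof -
  assume st: "s < t"
  interpret real_distribution gauss1 by (rule real_dist_normal_dist)
  have "emeasure gauss1 {s<..t} \<noteq> 0"
  proof
    assume "emeasure gauss1 {s<..t} = 0"
    then have "AE x in lborel. ennreal (std_normal_density x) * indicator {s<..t} x = 0"
      by (simp add: emeasure_density nn_integral_0_iff_AE)
    then have "AE x in lborel. x \<notin> {s<..t}"
    proof eventually_elim
      case (elim x)
      have "0 < std_normal_density x" by (rule normal_density_pos) simp
      with elim show ?case by (auto simp: indicator_def)
    qed
    then have "emeasure lborel {s<..t} = 0" by (subst (asm) AE_iff_measurable[of "{s<..t}"]) auto
    then show False using st by simp
  qed
  then have "0 < measure gauss1 {s<..t}" by (simp add: emeasure_eq_measure zero_less_measure_iff)
  then show ?thesis using cdf_diff_eq[OF st] by simp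
qed

lemma gauss_cdf_bounds: "0 < gauss_cdf t" "gauss_cdf t < 1"
proof -
  interpret real_distribution gauss1 by (rule real_dist_normal_dist)
  show "0 < gauss_cdf t" using gauss_cdf_strict_mono[of "t - 1" t] cdf_nonneg[of "t - 1"] by simp
  show "gauss_cdf t < 1" using gauss_cdf_strict_mono[of t "t + 1"] cdf_bounded_prob[of "t + 1"] by simp
qed

lemma gauss_phi_strict_mono: "strict_mono gauss_phi"
proof
  fix e e' :: ereal assume "e < e'"
  obtain s where s: "e < ereal s" "ereal s < e'" using ereal_dense2[OF \<open>e < e'\<close>] by blast
  obtain t where t: "ereal s < ereal t" "ereal t < e'" using ereal_dense2[OF s(2)] by blast
  interpret real_distribution gauss1 by (rule real_dist_normal_dist)
  have "gauss_phi e \<le> gauss_phi (ereal s)"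
    unfolding gauss_phi_eq_measure
    by (intro finite_measure_mono Collect_mono impI) (erule less_trans[OF _ s(1)], simp)
  also have "\<dots> < gauss_phi (ereal t)" using t(1) by (simp add: gauss_phi_real gauss_cdf_strict_mono)
  also have "\<dots> \<le> gauss_phi e'"
    unfolding gauss_phi_eq_measure
    by (intro finite_measure_mono Collect_mono impI) (erule less_trans[OF _ t(2)], simp)
  finally show "gauss_phi e < gauss_phi e'" .
qed

lemma gauss_phi_inv:
  assumes "0 \<le> p" "p \<le> 1" shows "gauss_phi (inv gauss_phi p) = p"
proof -
  interpret real_distribution gauss1 by (rule real_dist_normal_dist)
  have "\<exists>e. gauss_phi e = p"
  proof -
    consider "p = 0" | "p = 1" | "0 < p" "p < 1" using assms by linarith
    then show ?thesis
    proof cases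
      case 1
      then show ?thesis by (intro exI[of _ "-\<infinity>"]) (simp add: gauss_phi_eq_measure)
    next
      case 2
      then show ?thesis using prob_space by (intro exI[of _ "\<infinity>"]) (simp add: gauss_phi_eq_measure)
    next
      case 3
      have "eventually (\<lambda>t. gauss_cdf t < p) at_bot"
        using cdf_lim_at_bot 3(1) by (rule order_tendstoD)
      moreover have "eventually (\<lambda>t. p < gauss_cdf t) at_top"
        using cdf_lim_at_top_prob 3(2) by (rule order_tendstoD)
      ultimately obtain s t where st: "gauss_cdf s < p" "p < gauss_cdf t"
        by (meson eventually_at_bot_linorder eventually_at_top_linorder order_refl)
      then have "s \<le> t" using gauss_cdf_strict_mono[of t s] by (cases "s \<le> t") auto
      have "continuous_on {s..t} gauss_cdf"
        by (intro continuous_at_imp_continuous_on ballI) (simp add: isCont_cdf gauss1_null_singleton)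
      then obtain r where "gauss_cdf r = p" using IVT'[of gauss_cdf s p t] st \<open>s \<le> t\<close> by auto
      then show ?thesis by (intro exI[of _ "ereal r"]) (simp add: gauss_phi_real)
    qed
  qed
  then show ?thesis by (intro f_inv_into_f) auto
qed

lemma less_inv_gauss_phi:
  assumes "0 \<le> p" "p \<le> 1"
  shows "ereal t < inv gauss_phi p \<longleftrightarrow> gauss_cdf t < p"
  using strict_mono_less[OF gauss_phi_strict_mono, of "ereal t" "inv gauss_phi p"]
  by (simp add: gauss_phi_real gauss_phi_inv[OF assms])

lemma measure_gauss_cdf_less:
  assumes "0 \<le> p" "p \<le> 1" shows "measure gauss1 {t. gauss_cdf t < p} = p"
  using gauss_phi_eq_measure[of "inv gauss_phi p"] gauss_phi_inv[OF assms] less_inv_gauss_phi[OF assms] by simp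

text \<open>The Ehrhard symmetrisation of a function on the line.\<close>

definition gauss_rearr :: "(real \<Rightarrow> real) \<Rightarrow> real \<Rightarrow> real" where
  "gauss_rearr a t = Sup {c. gauss_cdf t < measure gauss1 {\<tau>. c < a \<tau>}}"

lemma ehrhard_sym_eq_gauss_rearr:
  "ehrhard_sym hhat h u x = gauss_rearr (\<lambda>\<tau>. u (x - hhat x *\<^sub>R h + \<tau> *\<^sub>R h)) (hhat x)"
proof -
  interpret real_distribution gauss1 by (rule real_dist_normal_dist)
  show ?thesis unfolding ehrhard_sym_def gauss_rearr_def ehrhard_set_def Let_def
    by (simp add: less_inv_gauss_phi)
qed

text \<open>The superlevel sets of the rearrangement are half lines with the Gaussian measure of the
  original ones, as the distribution function of \<open>a\<close> is continuous from the right.\<close>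

lemma gauss_rearr_gt:
  assumes [measurable]: "a \<in> borel_measurable borel"
  shows "d < gauss_rearr a t \<longleftrightarrow> gauss_cdf t < measure gauss1 {\<tau>. d < a \<tau>}"
proof -
  interpret real_distribution gauss1 by (rule real_dist_normal_dist)
  let ?m = "\<lambda>c. measure gauss1 {\<tau>. c < a \<tau>}"
  let ?S = "{c. gauss_cdf t < ?m c}"
  have mono: "c \<le> c' \<Longrightarrow> ?m c' \<le> ?m c" for c c' by (intro finite_measure_mono) auto
  have "(\<lambda>n. ?m (real n)) \<longlonglongrightarrow> measure gauss1 (\<Inter>n. {\<tau>. real n < a \<tau>})"
    by (rule finite_Lim_measure_decseq) (auto simp: decseq_def)
  moreover have "(\<Inter>n. {\<tau>. real n < a \<tau>}) = {}"
  proof -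
    have "\<exists>n. \<not> real n < a \<tau>" for \<tau>
      using reals_Archimedean2[of "a \<tau>"] by (auto intro: less_asym)
    then show ?thesis by blast
  qed
  ultimately have "(\<lambda>n. ?m (real n)) \<longlonglongrightarrow> 0" by simp
  then have "eventually (\<lambda>n. ?m (real n) < gauss_cdf t) sequentially"
    using gauss_cdf_bounds(1) by (rule order_tendstoD)
  then obtain n where n: "?m (real n) < gauss_cdf t" by (meson eventually_sequentially order_refl)
  have bdd: "bdd_above ?S"
  proof (rule bdd_aboveI)
    fix c assume "c \<in> ?S"
    then show "c \<le> real n" using n mono[of "real n" c] by (cases "c \<le> real n") auto
  qed
  have "(\<lambda>n. ?m (- real n)) \<longlonglongrightarrow> measure gauss1 (\<Union>n. {\<tau>. - real n < a \<tau>})"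
    by (rule finite_Lim_measure_incseq) (auto simp: incseq_def)
  moreover have "(\<Union>n. {\<tau>. - real n < a \<tau>}) = UNIV"
  proof -
    have "\<exists>n. - real n < a \<tau>" for \<tau>
      using reals_Archimedean2[of "- a \<tau>"] by (metis minus_less_iff)
    then show ?thesis by blast
  qed
  ultimately have "(\<lambda>n. ?m (- real n)) \<longlonglongrightarrow> 1" using prob_space by simp
  then have "eventually (\<lambda>n. gauss_cdf t < ?m (- real n)) sequentially"
    using gauss_cdf_bounds(2) by (rule order_tendstoD)
  then obtain n where "gauss_cdf t < ?m (- real n)" by (meson eventually_sequentially order_refl)
  then have ne: "?S \<noteq> {}" by blast
  have "d < gauss_rearr a t \<longleftrightarrow> (\<exists>c\<in>?S. d < c)"
    unfolding gauss_rearr_def by (rule less_cSup_iff[OF ne bdd])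
  also have "\<dots> \<longleftrightarrow> gauss_cdf t < ?m d"
  proof
    assume "\<exists>c\<in>?S. d < c"
    then obtain c where "gauss_cdf t < ?m c" "d < c" by auto
    then show "gauss_cdf t < ?m d" using mono[of d c] by simp
  next
    assume lt: "gauss_cdf t < ?m d"
    have "(\<lambda>n. ?m (d + inverse (real (Suc n)))) \<longlonglongrightarrow> measure gauss1 (\<Union>n. {\<tau>. d + inverse (real (Suc n)) < a \<tau>})"
    proof (rule finite_Lim_measure_incseq)
      show "incseq (\<lambda>n. {\<tau>. d + inverse (real (Suc n)) < a \<tau>})"
      proof (rule incseq_SucI, clarify)
        fix n \<tau> assume "d + inverse (real (Suc n)) < a \<tau>"
        moreover have "inverse (real (Suc (Suc n))) \<le> inverse (real (Suc n))" by (intro le_imp_inverse_le) auto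
        ultimately show "d + inverse (real (Suc (Suc n))) < a \<tau>" by linarith
      qed
    qed auto
    also have "(\<Union>n. {\<tau>. d + inverse (real (Suc n)) < a \<tau>}) = {\<tau>. d < a \<tau>}"
    proof (intro set_eqI iffI)
      fix \<tau> assume "\<tau> \<in> (\<Union>n. {\<tau>. d + inverse (real (Suc n)) < a \<tau>})"
      then obtain n where "d + inverse (real (Suc n)) < a \<tau>" by blast
      moreover have "0 < inverse (real (Suc n))" by simp
      ultimately have "d < a \<tau>" by linarith
      then show "\<tau> \<in> {\<tau>. d < a \<tau>}" by simp
    next
      fix \<tau> assume "\<tau> \<in> {\<tau>. d < a \<tau>}"
      then have "0 < a \<tau> - d" by simp
      then obtain n where "inverse (real (Suc n)) < a \<tau> - d" using reals_Archimedean by blast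
      then have "d + inverse (real (Suc n)) < a \<tau>" by linarith
      then show "\<tau> \<in> (\<Union>n. {\<tau>. d + inverse (real (Suc n)) < a \<tau>})" by blast
    qed
    finally have "eventually (\<lambda>n. gauss_cdf t < ?m (d + inverse (real (Suc n)))) sequentially"
      using lt by (rule order_tendstoD)
    then obtain n where "gauss_cdf t < ?m (d + inverse (real (Suc n)))"
      by (meson eventually_sequentially order_refl)
    then show "\<exists>c\<in>?S. d < c" by (intro bexI[of _ "d + inverse (real (Suc n))"]) auto
  qed
  finally show ?thesis .
qed

lemma gauss_cdf_measurable [measurable]: "gauss_cdf \<in> borel_measurable borel"
proof -
  interpret real_distribution gauss1 by (rule real_dist_normal_dist)
  show ?thesis by (intro borel_measurable_mono) (auto simp: mono_def cdf_nondecreasing)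
qed

text \<open>A version with parameters, since the symmetrisation rearranges along all lines and for all \<open>y\<close> at
  once.\<close>

lemma gauss_rearr_measurable:
  assumes w [measurable]: "(\<lambda>(p, \<tau>). w p \<tau>) \<in> borel_measurable (N \<Otimes>\<^sub>M borel)"
    and t [measurable]: "t \<in> borel_measurable N"
  shows "(\<lambda>p. gauss_rearr (w p) (t p)) \<in> borel_measurable N"
proof -
  interpret real_distribution gauss1 by (rule real_dist_normal_dist)
  have slice: "w p \<in> borel_measurable borel" if "p \<in> space N" for p
    using measurable_Pair2[OF w that] by simp
  have "{p \<in> space N. d < gauss_rearr (w p) (t p)} \<in> sets N" for d
  proof -
    have meas: "measure gauss1 {\<tau>. d < w p \<tau>} = enn2real (\<integral>\<^sup>+\<tau>. indicator {z. d < z} (w p \<tau>) \<partial>gauss1)"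
      if "p \<in> space N" for p
    proof -
      have [measurable]: "w p \<in> borel_measurable borel" using slice[OF that] .
      have "(\<integral>\<^sup>+\<tau>. indicator {z. d < z} (w p \<tau>) \<partial>gauss1) = (\<integral>\<^sup>+\<tau>. indicator {\<tau>. d < w p \<tau>} \<tau> \<partial>gauss1)"
        by (intro nn_integral_cong) (auto simp: indicator_def)
      then show ?thesis by (simp add: measure_def)
    qed
    have "{p \<in> space N. d < gauss_rearr (w p) (t p)}
      = {p \<in> space N. gauss_cdf (t p) < enn2real (\<integral>\<^sup>+\<tau>. indicator {z. d < z} (w p \<tau>) \<partial>gauss1)}"
      using gauss_rearr_gt[OF slice] meas by auto
    also have "\<dots> \<in> sets N"
    proof -
      have sg: "sets (N \<Otimes>\<^sub>M gauss1) = sets (N \<Otimes>\<^sub>M borel)" by (intro sets_pair_measure_cong) auto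
      have "(\<lambda>(p, \<tau>). indicator {z. d < z} (w p \<tau>) :: ennreal) \<in> borel_measurable (N \<Otimes>\<^sub>M gauss1)"
        unfolding measurable_cong_sets[OF sg refl] by measurable
      then have [measurable]: "(\<lambda>p. \<integral>\<^sup>+\<tau>. indicator {z. d < z} (w p \<tau>) \<partial>gauss1) \<in> borel_measurable N"
        by (rule borel_measurable_nn_integral)
      show ?thesis by measurable
    qed
    finally show ?thesis .
  qed
  then show ?thesis by (simp add: borel_measurable_iff_greater)
qed

text \<open>Both integrals of the layer cake are elementary: the inner one is \<open>2 (x - c)\<close> for
  \<open>y \<le> c \<le> x\<close>.\<close>

lemma square_pos_part_layers:
  fixes x y :: real
  shows "ennreal ((max 0 (x - y))\<^sup>2) =
    (\<integral>\<^sup>+c. \<integral>\<^sup>+d. 2 * indicator {(c, d). c \<le> d \<and> d < x \<and> y \<le> c} (c, d) \<partial>lborel \<partial>lborel)"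
proof -
  have "(\<integral>\<^sup>+d. 2 * indicator {(c, d). c \<le> d \<and> d < x \<and> y \<le> c} (c, d) \<partial>lborel)
      = ennreal (2 * (x - c)) * indicator {y..x} c" for c
  proof -
    have "(\<integral>\<^sup>+d. 2 * indicator {(c, d). c \<le> d \<and> d < x \<and> y \<le> c} (c, d) \<partial>lborel)
      = (\<integral>\<^sup>+d. (2 * indicator {y..} c) * indicator {c..<x} d \<partial>lborel)"
      by (intro nn_integral_cong) (auto simp: indicator_def)
    also have "\<dots> = (2 * indicator {y..} c) * emeasure lborel {c..<x}"
      by (rule nn_integral_cmult_indicator) simp
    also have "\<dots> = ennreal (2 * (x - c)) * indicator {y..x} c"
    proof (cases "c \<le> x")
      case True
      then have "ennreal (2 * (x - c)) = 2 * ennreal (x - c)" by (subst ennreal_mult) simp_all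
      then show ?thesis using True by (simp add: indicator_def)
    qed (simp add: indicator_def)
    finally show ?thesis .
  qed
  then have "(\<integral>\<^sup>+c. \<integral>\<^sup>+d. 2 * indicator {(c, d). c \<le> d \<and> d < x \<and> y \<le> c} (c, d) \<partial>lborel \<partial>lborel)
      = (\<integral>\<^sup>+c. ennreal (2 * (x - c)) * indicator {y..x} c \<partial>lborel)" by simp
  also have "\<dots> = ennreal ((max 0 (x - y))\<^sup>2)"
  proof (cases "y \<le> x")
    case True
    have "(\<integral>\<^sup>+c. ennreal (2 * (x - c)) * indicator {y..x} c \<partial>lborel) = ennreal (- (x - x)\<^sup>2 - (- (x - y)\<^sup>2))"
      by (rule nn_integral_FTC_Icc[OF _ _ _ True]) (auto intro!: derivative_eq_intros)
    then show ?thesis using True by (simp add: max_def)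
  qed (simp add: max_def)
  finally show ?thesis ..
qed

text \<open>Integrated over a measure space, the layers become measures of differences of superlevel sets.\<close>

lemma nn_integral_square_pos_part:
  fixes f g :: "'a \<Rightarrow> real"
  assumes "sigma_finite_measure M" and [measurable]: "f \<in> borel_measurable M" "g \<in> borel_measurable M"
  shows "(\<integral>\<^sup>+z. ennreal ((max 0 (f z - g z))\<^sup>2) \<partial>M)
    = (\<integral>\<^sup>+c. \<integral>\<^sup>+d. 2 * indicator {(c, d). c \<le> d} (c, d) * emeasure M {z \<in> space M. d < f z \<and> g z \<le> c} \<partial>lborel \<partial>lborel)"
proof -
  interpret M: sigma_finite_measure M by fact
  interpret R: pair_sigma_finite M "lborel :: real measure" ..
  define K :: "'a \<Rightarrow> real \<Rightarrow> real \<Rightarrow> ennreal"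
    where "K z c d = (if c \<le> d \<and> d < f z \<and> g z \<le> c then 2 else 0)" for z c d
  have K: "(\<lambda>((z, c), d). K z c d) \<in> borel_measurable ((M \<Otimes>\<^sub>M lborel) \<Otimes>\<^sub>M lborel)"
    unfolding K_def case_prod_beta by measurable
  have Kc: "(\<lambda>(z, d). K z c d) \<in> borel_measurable (M \<Otimes>\<^sub>M lborel)" for c
    using measurable_compose[OF _ K, of "\<lambda>(z, d). ((z, c), d)" "M \<Otimes>\<^sub>M lborel"] by (simp add: case_prod_beta)
  have "(\<integral>\<^sup>+z. ennreal ((max 0 (f z - g z))\<^sup>2) \<partial>M) = (\<integral>\<^sup>+z. \<integral>\<^sup>+c. \<integral>\<^sup>+d. K z c d \<partial>lborel \<partial>lborel \<partial>M)"
    unfolding square_pos_part_layers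
    by (intro nn_integral_cong) (auto simp: K_def indicator_def)
  also have "\<dots> = (\<integral>\<^sup>+c. \<integral>\<^sup>+z. \<integral>\<^sup>+d. K z c d \<partial>lborel \<partial>M \<partial>lborel)"
    using lborel.borel_measurable_nn_integral[OF K]
    by (intro R.Fubini'[symmetric]) (simp add: case_prod_beta)
  also have "\<dots> = (\<integral>\<^sup>+c. \<integral>\<^sup>+d. \<integral>\<^sup>+z. K z c d \<partial>M \<partial>lborel \<partial>lborel)"
    by (intro nn_integral_cong R.Fubini'[symmetric] Kc)
  also have "\<dots> = (\<integral>\<^sup>+c. \<integral>\<^sup>+d. 2 * indicator {(c, d). c \<le> d} (c, d) * emeasure M {z \<in> space M. d < f z \<and> g z \<le> c} \<partial>lborel \<partial>lborel)"
  proof (intro nn_integral_cong)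
    fix c d :: real
    have "(\<integral>\<^sup>+z. K z c d \<partial>M) = (\<integral>\<^sup>+z. (2 * indicator {(c, d). c \<le> d} (c, d)) * indicator {z \<in> space M. d < f z \<and> g z \<le> c} z \<partial>M)"
      by (intro nn_integral_cong) (auto simp: K_def indicator_def)
    also have "\<dots> = 2 * indicator {(c, d). c \<le> d} (c, d) * emeasure M {z \<in> space M. d < f z \<and> g z \<le> c}"
      by (rule nn_integral_cmult_indicator) measurable
    finally show "(\<integral>\<^sup>+z. K z c d \<partial>M) = 2 * indicator {(c, d). c \<le> d} (c, d) * emeasure M {z \<in> space M. d < f z \<and> g z \<le> c}" .
  qed
  finally show ?thesis .
qed

text \<open>Superlevel sets of rearrangements are nested, so they overlap as much as their measures
  permit: among all pairs with given distributions, rearranged pairs have the smallest differences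
  \<open>{a > d} - {b > c}\<close>.\<close>

lemma gauss_rearr_level_difference:
  assumes [measurable]: "a \<in> borel_measurable borel" "b \<in> borel_measurable borel"
  shows "emeasure gauss1 {t. d < gauss_rearr a t \<and> gauss_rearr b t \<le> c} \<le> emeasure gauss1 {t. d < a t \<and> b t \<le> c}"
proof -
  interpret real_distribution gauss1 by (rule real_dist_normal_dist)
  let ?A = "measure gauss1 {t. d < a t}" and ?B = "measure gauss1 {t. c < b t}"
  have eq: "{t. d < gauss_rearr a t \<and> gauss_rearr b t \<le> c} = {t. gauss_cdf t < ?A} - {t. gauss_cdf t < ?B}"
    using gauss_rearr_gt[of a d] gauss_rearr_gt[of b c] by (auto simp: not_less[symmetric])
  have "measure gauss1 ({t. gauss_cdf t < ?A} - {t. gauss_cdf t < ?B}) \<le> measure gauss1 {t. d < a t \<and> b t \<le> c}"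
  proof (cases "?B \<le> ?A")
    case True
    then have "measure gauss1 ({t. gauss_cdf t < ?A} - {t. gauss_cdf t < ?B}) = ?A - ?B"
      by (subst finite_measure_Diff) (auto simp: measure_gauss_cdf_less)
    moreover have "?A \<le> measure gauss1 ({t. d < a t \<and> b t \<le> c} \<union> {t. c < b t})"
      by (intro finite_measure_mono) auto
    then have "?A - ?B \<le> measure gauss1 {t. d < a t \<and> b t \<le> c}"
      using measure_Un_le[of "{t. d < a t \<and> b t \<le> c}" gauss1 "{t. c < b t}"] by simp
    ultimately show ?thesis by simp
  next
    case False
    then have "{t. gauss_cdf t < ?A} - {t. gauss_cdf t < ?B} = {}" by auto
    then show ?thesis by (simp only: measure_empty measure_nonneg)
  qed
  then show ?thesis unfolding eq by (simp add: emeasure_eq_measure)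
qed

text \<open>Comparison layer by layer, separately for the positive parts of \<open>a - b\<close> and \<open>b - a\<close>.\<close>

lemma gauss_rearr_contraction:
  assumes [measurable]: "a \<in> borel_measurable borel" "b \<in> borel_measurable borel"
  shows "(\<integral>\<^sup>+t. ennreal ((gauss_rearr a t - gauss_rearr b t)\<^sup>2) \<partial>gauss1) \<le> (\<integral>\<^sup>+t. ennreal ((a t - b t)\<^sup>2) \<partial>gauss1)"
proof -
  interpret real_distribution gauss1 by (rule real_dist_normal_dist)
  have [measurable]: "gauss_rearr f \<in> borel_measurable borel" if [measurable]: "f \<in> borel_measurable borel" for f
    by (rule gauss_rearr_measurable[of "\<lambda>_. f" borel "\<lambda>t. t"]) measurable
  have sf: "sigma_finite_measure gauss1" ..
  have pos: "(\<integral>\<^sup>+t. ennreal ((max 0 (gauss_rearr f t - gauss_rearr g t))\<^sup>2) \<partial>gauss1)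
      \<le> (\<integral>\<^sup>+t. ennreal ((max 0 (f t - g t))\<^sup>2) \<partial>gauss1)"
    if [measurable]: "f \<in> borel_measurable borel" "g \<in> borel_measurable borel" for f g
    using gauss_rearr_level_difference[OF that]
    by (subst (1 2) nn_integral_square_pos_part[OF sf]) (auto intro!: nn_integral_mono mult_left_mono)
  have split: "ennreal ((x - y)\<^sup>2) = ennreal ((max 0 (x - y))\<^sup>2) + ennreal ((max 0 (y - x))\<^sup>2)" for x y :: real
    by (cases "x \<le> y") (auto simp: max_def power2_commute)
  show ?thesis unfolding split
    by (subst (1 2) nn_integral_add) (auto intro!: add_mono pos)
qed

section \<open>Ehrhard symmetrisation contracts the mean square distance\<close>

locale wiener_direction = wiener \<gamma> for \<gamma> :: "'a::{banach,second_countable_topology} measure" +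
  fixes xs :: "'a \<Rightarrow>\<^sub>L real" and h :: 'a
  assumes h_eq: "h = cov_op \<gamma> xs" and h_norm: "cm_norm \<gamma> h = 1"
begin

lemma xs_h: "xs h = 1"
  using gaussian_resampling(1)[of xs] h_eq h_norm by simp

abbreviation sym :: "('a \<Rightarrow> real) \<Rightarrow> 'a \<Rightarrow> real" where
  "sym \<equiv> ehrhard_sym (blinfun_apply xs) h"

lemma sym_measurable:
  assumes [measurable]: "u \<in> borel_measurable borel"
  shows "sym u \<in> borel_measurable borel"
  unfolding ehrhard_sym_eq_gauss_rearr
  by (rule gauss_rearr_measurable) measurable

lemma sym_half_measurable:
  assumes v [measurable]: "v \<in> borel_measurable (half_space \<gamma>)"
  shows "ehrhard_sym_half (blinfun_apply xs) h v \<in> borel_measurable (half_space \<gamma>)"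
proof -
  have eq: "ehrhard_sym_half (blinfun_apply xs) h v
    = (\<lambda>p. gauss_rearr (\<lambda>\<tau>. v (fst p - xs (fst p) *\<^sub>R h + \<tau> *\<^sub>R h, snd p)) (xs (fst p)))"
    by (auto simp: ehrhard_sym_half_def ehrhard_sym_eq_gauss_rearr)
  have [measurable]: "fst \<in> half_space \<gamma> \<rightarrow>\<^sub>M borel" "snd \<in> half_space \<gamma> \<rightarrow>\<^sub>M restrict_space lborel {0<..}"
    unfolding half_space_def using measurable_fst[of \<gamma> "restrict_space lborel {0<..}"]
    by (simp_all add: measurable_cong_sets[OF refl sets_gamma])
  have "(\<lambda>q. (fst (fst q) - xs (fst (fst q)) *\<^sub>R h + snd q *\<^sub>R h, snd (fst q)))
      \<in> half_space \<gamma> \<Otimes>\<^sub>M borel \<rightarrow>\<^sub>M \<gamma> \<Otimes>\<^sub>M restrict_space lborel {0<..}"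
    by (intro measurable_Pair) measurable
  then have "(\<lambda>q. (fst (fst q) - xs (fst (fst q)) *\<^sub>R h + snd q *\<^sub>R h, snd (fst q)))
      \<in> half_space \<gamma> \<Otimes>\<^sub>M borel \<rightarrow>\<^sub>M half_space \<gamma>" unfolding half_space_def[of \<gamma>, symmetric] .
  from measurable_compose[OF this v] show ?thesis
    unfolding eq by (intro gauss_rearr_measurable) (simp_all add: case_prod_beta)
qed

text \<open>On each line parallel to \<open>h\<close> the symmetrised functions are rearrangements, and \<open>\<gamma>\<close> is an average of
  Gaussian measures on these lines.\<close>

lemma sym_contraction:
  assumes [measurable]: "u \<in> borel_measurable borel" "u' \<in> borel_measurable borel"
  shows "(\<integral>\<^sup>+x. ennreal ((sym u x - sym u' x)\<^sup>2) \<partial>\<gamma>) \<le> (\<integral>\<^sup>+x. ennreal ((u x - u' x)\<^sup>2) \<partial>\<gamma>)"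
proof -
  interpret g: prob_space gauss1 by (rule prob_space_normal_density) simp
  interpret P: pair_prob_space \<gamma> gauss1 ..
  let ?T = "\<lambda>p. fst p + (snd p - xs (fst p)) *\<^sub>R h"
  have T: "?T \<in> \<gamma> \<Otimes>\<^sub>M gauss1 \<rightarrow>\<^sub>M borel"
    and law: "distr (\<gamma> \<Otimes>\<^sub>M gauss1) borel ?T = \<gamma>"
    using gaussian_resampling(2,3)[of xs] h_eq h_norm by simp_all
  have disint: "(\<integral>\<^sup>+x. F x \<partial>\<gamma>) = (\<integral>\<^sup>+x. \<integral>\<^sup>+\<tau>. F (x - xs x *\<^sub>R h + \<tau> *\<^sub>R h) \<partial>gauss1 \<partial>\<gamma>)"
    if [measurable]: "F \<in> borel_measurable borel" for F :: "'a \<Rightarrow> ennreal"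
  proof -
    have "(\<integral>\<^sup>+x. F x \<partial>\<gamma>) = (\<integral>\<^sup>+p. F (?T p) \<partial>(\<gamma> \<Otimes>\<^sub>M gauss1))"
      by (subst law[symmetric], rule nn_integral_distr[OF T]) (simp add: that)
    also have "\<dots> = (\<integral>\<^sup>+x. \<integral>\<^sup>+\<tau>. F (?T (x, \<tau>)) \<partial>gauss1 \<partial>\<gamma>)"
      using measurable_compose[OF T that] by (rule g.nn_integral_fst[symmetric])
    finally show ?thesis by (simp add: algebra_simps)
  qed
  have [measurable]: "sym u \<in> borel_measurable borel" "sym u' \<in> borel_measurable borel"
    by (rule sym_measurable; measurable)+
  have on_line: "sym w (x - xs x *\<^sub>R h + \<tau> *\<^sub>R h) = gauss_rearr (\<lambda>\<sigma>. w (x - xs x *\<^sub>R h + \<sigma> *\<^sub>R h)) \<tau>" for w x \<tau>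
    unfolding ehrhard_sym_eq_gauss_rearr by (simp add: blinfun.bilinear_simps xs_h)
  have "(\<integral>\<^sup>+x. ennreal ((sym u x - sym u' x)\<^sup>2) \<partial>\<gamma>)
    = (\<integral>\<^sup>+x. \<integral>\<^sup>+\<tau>. ennreal ((sym u (x - xs x *\<^sub>R h + \<tau> *\<^sub>R h) - sym u' (x - xs x *\<^sub>R h + \<tau> *\<^sub>R h))\<^sup>2) \<partial>gauss1 \<partial>\<gamma>)"
    by (rule disint) measurable
  also have "\<dots> \<le> (\<integral>\<^sup>+x. \<integral>\<^sup>+\<tau>. ennreal ((u (x - xs x *\<^sub>R h + \<tau> *\<^sub>R h) - u' (x - xs x *\<^sub>R h + \<tau> *\<^sub>R h))\<^sup>2) \<partial>gauss1 \<partial>\<gamma>)"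
    unfolding on_line by (intro nn_integral_mono gauss_rearr_contraction) measurable
  also have "\<dots> = (\<integral>\<^sup>+x. ennreal ((u x - u' x)\<^sup>2) \<partial>\<gamma>)"
    by (rule disint[symmetric]) measurable
  finally show ?thesis .
qed

lemma sym_zero: "sym (\<lambda>_. 0) x = 0"
proof -
  interpret g: prob_space gauss1 by (rule prob_space_normal_density) simp
  have gt: "d < sym (\<lambda>_. 0) x \<longleftrightarrow> d < 0" for d
    unfolding ehrhard_sym_eq_gauss_rearr using gauss_cdf_bounds[of "xs x"] g.prob_space
    by (subst gauss_rearr_gt) (auto simp: not_less)
  show ?thesis using gt[of 0] gt[of "sym (\<lambda>_. 0) x"] by linarith
qed

end

section \<open>Averages of test functions\<close>

definition interval_measure :: "real \<Rightarrow> real measure" where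
  "interval_measure \<epsilon> = density lborel (\<lambda>r. ennreal (indicator {0..\<epsilon>} r))"

lemma interval_measure:
  assumes "0 < \<epsilon>"
  shows "finite_measure (interval_measure \<epsilon>)" "measure (interval_measure \<epsilon>) (space (interval_measure \<epsilon>)) = \<epsilon>"
    "sets (interval_measure \<epsilon>) = sets borel" "AE r in interval_measure \<epsilon>. r \<in> {0..\<epsilon>}"
proof -
  have e: "emeasure (interval_measure \<epsilon>) UNIV = ennreal \<epsilon>"
    unfolding interval_measure_def using assms by (subst emeasure_density) (auto simp: ennreal_indicator)
  then show "finite_measure (interval_measure \<epsilon>)" "measure (interval_measure \<epsilon>) (space (interval_measure \<epsilon>)) = \<epsilon>"
    using assms by (auto simp: measure_def interval_measure_def intro!: finite_measureI)
  show "sets (interval_measure \<epsilon>) = sets borel" by (simp add: interval_measure_def)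
  show "AE r in interval_measure \<epsilon>. r \<in> {0..\<epsilon>}"
    unfolding interval_measure_def by (subst AE_density) (auto simp: indicator_def)
qed

text \<open>The average over \<open>[y - \<epsilon>, y]\<close> of a test function is an increment of its antiderivative, hence again a
  test function.\<close>

lemma test_function_average:
  assumes \<eta>: "test_function \<eta>" and \<epsilon>: "0 < \<epsilon>"
  obtains \<psi> where "test_function \<psi>" "\<And>y. deriv \<psi> y = \<eta> y - \<eta> (y - \<epsilon>)"
    "\<And>y. \<psi> y = (LINT r|interval_measure \<epsilon>. \<eta> (y - r))"
proof -
  obtain a b where ab: "0 < a" "a < b" "\<And>y. y \<notin> {a..b} \<Longrightarrow> \<eta> y = 0"
    using \<eta> unfolding test_function_def by blast
  have cont: "continuous_on UNIV \<eta>" using test_function_continuous(1)[OF \<eta>, of 0] by simp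
  define N where "N y = (LINT r|interval_measure \<epsilon>. \<eta> (y - r))" for y
  have N_int: "N y = integral {0..\<epsilon>} (\<lambda>r. \<eta> (y - r))" for y
  proof -
    have c: "continuous_on {0..\<epsilon>} (\<lambda>r. \<eta> (y - r))"
      by (rule continuous_on_compose2[OF cont]) (auto intro: continuous_intros)
    have m [measurable]: "\<eta> \<in> borel_measurable borel" using cont by (rule borel_measurable_continuous_onI)
    have "N y = (LINT r|lborel. indicator {0..\<epsilon>} r *\<^sub>R \<eta> (y - r))"
      unfolding N_def interval_measure_def by (subst integral_density) auto
    also have "\<dots> = integral {0..\<epsilon>} (\<lambda>r. \<eta> (y - r))"
      using set_borel_integral_eq_integral(2)[OF borel_integrable_atLeastAtMost'[OF c]]
      unfolding set_lebesgue_integral_def .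
    finally show ?thesis .
  qed
  define A where "A y = (if 0 \<le> y then integral {0..y} \<eta> else 0)" for y
  have A0: "A y = 0" if "y \<le> a" for y
  proof (cases "0 \<le> y")
    case True
    have "integral {0..y} \<eta> = integral {0..y} (\<lambda>_. 0)"
    proof (rule integral_spike[of "{a}"])
      show "0 = \<eta> r" if "r \<in> {0..y} - {a}" for r using that \<open>y \<le> a\<close> ab(3)[of r] by auto
    qed auto
    then show ?thesis using True by (simp add: A_def)
  qed (simp add: A_def)
  have A_deriv: "(A has_real_derivative \<eta> y) (at y)" for y
  proof (cases "y < a")
    case True
    have "((\<lambda>_. 0) has_real_derivative 0) (at y)" by simp
    then have "(A has_real_derivative 0) (at y)"
      by (rule has_field_derivative_transform_within_open[of _ _ _ "{..<a}"]) (use True A0 in auto)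
    then show ?thesis using ab(3)[of y] True by simp
  next
    case False
    have "((\<lambda>y. integral {0..y} \<eta>) has_real_derivative \<eta> y) (at y within {0..y + 1})"
      using False ab(1) by (intro integral_has_real_derivative continuous_on_subset[OF cont]) auto
    moreover have "at y within {0..y + 1} = at y"
      using False ab(1) by (intro at_within_interior) auto
    ultimately have "((\<lambda>y. integral {0..y} \<eta>) has_real_derivative \<eta> y) (at y)" by simp
    then show ?thesis
      by (rule has_field_derivative_transform_within_open[of _ _ _ "{0<..}"]) (use False ab(1) in \<open>auto simp: A_def\<close>)
  qed
  have N_A: "N y = A y - A (y - \<epsilon>)" for y
  proof -
    have "((\<lambda>r. \<eta> (y - r)) has_integral (- A (y - \<epsilon>)) - (- A (y - 0))) {0..\<epsilon>}"
    proof (rule fundamental_theorem_of_calculus)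
      fix r
      have "((\<lambda>r. y - r) has_real_derivative -1) (at r)" by (auto intro!: derivative_eq_intros)
      from DERIV_chain2[OF A_deriv this] have "((\<lambda>r. - A (y - r)) has_real_derivative \<eta> (y - r)) (at r)"
        by (auto dest: DERIV_minus)
      then show "((\<lambda>r. - A (y - r)) has_vector_derivative \<eta> (y - r)) (at r within {0..\<epsilon>})"
        by (simp add: has_real_derivative_iff_has_vector_derivative has_vector_derivative_at_within)
    qed (use \<epsilon> in simp)
    then show ?thesis unfolding N_int by (simp add: integral_unique)
  qed
  have N_deriv: "(N has_real_derivative \<eta> y - \<eta> (y - \<epsilon>)) (at y)" for y
  proof -
    have "((\<lambda>y. y - \<epsilon>) has_real_derivative 1) (at y)" by (auto intro!: derivative_eq_intros)
    from DERIV_diff[OF A_deriv DERIV_chain2[OF A_deriv this]] show ?thesis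
      unfolding N_A[abs_def] by simp
  qed
  then have dN: "deriv N = (\<lambda>y. \<eta> y - \<eta> (y - \<epsilon>))" by (intro ext DERIV_imp_deriv)
  have diffs: "(deriv ^^ k) (\<lambda>y. \<eta> y - \<eta> (y - \<epsilon>)) = (\<lambda>y. (deriv ^^ k) \<eta> y - (deriv ^^ k) \<eta> (y - \<epsilon>))" for k
  proof (induction k)
    case (Suc k)
    have d: "((deriv ^^ k) \<eta> has_real_derivative (deriv ^^ Suc k) \<eta> y) (at y)" for y
      using \<eta> unfolding test_function_def by (simp add: DERIV_deriv_iff_real_differentiable)
    have "((\<lambda>y. (deriv ^^ k) \<eta> y - (deriv ^^ k) \<eta> (y - \<epsilon>)) has_real_derivative
        (deriv ^^ Suc k) \<eta> y - (deriv ^^ Suc k) \<eta> (y - \<epsilon>)) (at y)" for y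
    proof -
      have "((\<lambda>y. y - \<epsilon>) has_real_derivative 1) (at y)" by (auto intro!: derivative_eq_intros)
      from DERIV_diff[OF d DERIV_chain2[OF d this]] show ?thesis by simp
    qed
    then show ?case using Suc by (auto intro!: ext DERIV_imp_deriv)
  qed simp
  have "test_function N"
    unfolding test_function_def
  proof (intro conjI allI)
    fix k y
    show "(deriv ^^ k) N differentiable at y"
    proof (cases k)
      case 0
      then show ?thesis using N_deriv by (auto simp: real_differentiable_def)
    next
      case (Suc j)
      have d: "(deriv ^^ j) \<eta> differentiable at y" for y using \<eta> unfolding test_function_def by blast
      have "(\<lambda>y. (deriv ^^ j) \<eta> (y - \<epsilon>)) differentiable at y"
        by (rule differentiable_compose[OF d]) (auto intro: derivative_intros)
      then have "(\<lambda>y. (deriv ^^ j) \<eta> y - (deriv ^^ j) \<eta> (y - \<epsilon>)) differentiable at y"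
        by (intro differentiable_diff d)
      then show ?thesis unfolding Suc funpow_Suc_right o_apply dN diffs .
    qed
    have "N y = 0" if "y \<notin> {a..b + \<epsilon>}" for y
    proof -
      have "\<eta> (y - r) = 0" if "r \<in> {0..\<epsilon>}" for r using ab(3)[of "y - r"] that \<open>y \<notin> _\<close> by auto
      then have "integral {0..\<epsilon>} (\<lambda>r. \<eta> (y - r)) = integral {0..\<epsilon>} (\<lambda>_. 0)" by (intro integral_cong) auto
      then show ?thesis unfolding N_int by simp
    qed
    then show "\<exists>a b. 0 < a \<and> a < b \<and> (\<forall>y. y \<notin> {a..b} \<longrightarrow> N y = 0)"
      using ab(1,2) \<epsilon> by (intro exI[of _ a] exI[of _ "b + \<epsilon>"]) auto
  qed
  then show thesis using that[of N] by (simp add: dN N_def)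
qed

section \<open>The product measure on the half space\<close>

context wiener
begin

abbreviation H :: "('a \<times> real) measure" where "H \<equiv> half_space \<gamma>"
abbreviation P :: "('a \<times> real) measure" where "P \<equiv> \<gamma> \<Otimes>\<^sub>M lborel"
abbreviation Omega :: "('a \<times> real) set" where "Omega \<equiv> UNIV \<times> {0<..}"

text \<open>Extension by zero to the whole product space, on which vertical translations preserve the measure.\<close>

definition ext :: "('a \<times> real \<Rightarrow> real) \<Rightarrow> 'a \<times> real \<Rightarrow> real" where
  "ext u z = indicator Omega z * u z"

sublocale PL: pair_sigma_finite \<gamma> "lborel :: real measure" ..

lemma sets_P: "sets P = sets borel"
  by (subst borel_prod[symmetric]) (intro sets_pair_measure_cong, simp_all)

lemma space_P [simp]: "space P = UNIV"
  by (simp add: space_pair_measure)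

lemma measurable_P: "borel_measurable P = borel_measurable borel"
  by (intro measurable_cong_sets sets_P refl)

lemma Omega_sets [measurable]: "Omega \<in> sets P" "Omega \<in> sets borel"
  unfolding sets_P by (intro borel_open open_Times; simp)+

lemma H_eq: "H = restrict_space P Omega"
  by (rule half_space_eq[OF prob_space_axioms sets_gamma])

lemma space_H [simp]: "space H = Omega"
  by (rule sets_half_space(2)[OF prob_space_axioms sets_gamma])

lemma borel_measurable_H: "f \<in> borel_measurable borel \<Longrightarrow> f \<in> borel_measurable H"
  unfolding H_eq by (rule measurable_restrict_space1) (simp add: measurable_P)

lemma ext_measurable:
  assumes "u \<in> borel_measurable H" shows "ext u \<in> borel_measurable borel"
proof -
  have "(\<lambda>z. indicator Omega z *\<^sub>R u z) \<in> borel_measurable P"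
    using assms unfolding H_eq by (subst borel_measurable_restrict_space_iff[symmetric]) auto
  then show ?thesis by (simp add: ext_def[abs_def] measurable_P)
qed

lemma integral_H: "(LINT z|H. u z) = (LINT z|P. ext u z)"
  unfolding H_eq ext_def by (subst integral_restrict_space) auto

lemma integrable_H: "integrable H u \<longleftrightarrow> integrable P (ext u)"
  unfolding H_eq ext_def by (subst integrable_restrict_space) auto

lemma nn_integral_H: "(\<integral>\<^sup>+z. f z \<partial>H) = (\<integral>\<^sup>+z. f z * indicator Omega z \<partial>P)"
  unfolding H_eq by (subst nn_integral_restrict_space) auto

definition shift :: "real \<Rightarrow> 'a \<times> real \<Rightarrow> 'a \<times> real" where
  "shift r z = (fst z, snd z + r)"

lemma shift_measurable: "shift r \<in> P \<rightarrow>\<^sub>M P" "(\<lambda>(z, r). shift r z) \<in> P \<Otimes>\<^sub>M borel \<rightarrow>\<^sub>M P"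
  unfolding shift_def by measurable

lemma shift_law: "distr P P (shift r) = P"
proof (rule pair_measure_eqI[symmetric])
  fix A B assume A: "A \<in> sets \<gamma>" and B: "B \<in> sets (lborel :: real measure)"
  have vim: "shift r -` (A \<times> B) = A \<times> ((\<lambda>y. r + y) -` B)"
    by (auto simp: shift_def add.commute)
  have B': "(\<lambda>y. r + y) -` B \<in> sets lborel"
    using measurable_sets[of "(+) r" borel borel B] B by simp
  have "emeasure lborel B = emeasure (distr lborel borel ((+) r)) B" by (simp add: lborel_distr_plus)
  also have "\<dots> = emeasure lborel ((\<lambda>y. r + y) -` B)"
    using B by (subst emeasure_distr) auto
  finally have "emeasure lborel B = emeasure lborel ((\<lambda>y. r + y) -` B)" .
  moreover have "emeasure (distr P P (shift r)) (A \<times> B) = emeasure P (A \<times> ((\<lambda>y. r + y) -` B))"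
    using A B shift_measurable(1)[of r] by (subst emeasure_distr) (auto simp: vim)
  ultimately show "emeasure \<gamma> A * emeasure lborel B = emeasure (distr P P (shift r)) (A \<times> B)"
    using A B' by (simp add: lborel.emeasure_pair_measure_Times)
qed (auto intro: sigma_finite_lborel sigma_finite_measure_axioms)

lemma integral_shift:
  fixes f :: "'a \<times> real \<Rightarrow> real"
  assumes "f \<in> borel_measurable borel"
  shows "(LINT z|P. f (shift r z)) = (LINT z|P. f z)" "integrable P (\<lambda>z. f (shift r z)) \<longleftrightarrow> integrable P f"
  using integral_distr[OF shift_measurable(1), of f r] integrable_distr_eq[OF shift_measurable(1), of f r] assms
  by (simp_all add: shift_law measurable_P)

lemma nn_integral_shift:
  assumes "f \<in> borel_measurable borel"
  shows "(\<integral>\<^sup>+z. f (shift r z) \<partial>P) = (\<integral>\<^sup>+z. f z \<partial>P)"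
  using nn_integral_distr[OF shift_measurable(1), of f r] assms by (simp add: shift_law measurable_P)

abbreviation strip :: "real \<Rightarrow> real \<Rightarrow> ('a \<times> real) set" where
  "strip a b \<equiv> UNIV \<times> {a..b}"

lemma strip_sets [measurable]: "strip a b \<in> sets borel" "strip a b \<in> sets P"
  unfolding sets_P by (intro borel_closed closed_Times closed_UNIV closed_atLeastAtMost)+

lemma L2_loc_integrable_strip:
  assumes u: "L2_loc \<gamma> u" and ab: "0 < a" "a < b"
  shows "integrable H (\<lambda>z. u z * indicator (strip a b) z)"
proof -
  have [measurable]: "u \<in> borel_measurable H" using u unfolding L2_loc_def by blast
  have [measurable]: "(indicator (strip a b) :: _ \<Rightarrow> real) \<in> borel_measurable H"
    by (rule borel_measurable_H) measurable
  have [measurable]: "(\<lambda>z. (u z)\<^sup>2 * indicator (strip a b) z) \<in> borel_measurable H" by measurable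
  have i1: "integrable H (\<lambda>z. (u z)\<^sup>2 * indicator (strip a b) z)"
    using u ab unfolding L2_loc_def
    by (intro integrableI_bounded) (auto simp: abs_mult)
  have i2: "integrable H (indicator (strip a b) :: _ \<Rightarrow> real)"
  proof -
    have "emeasure P (strip a b) = emeasure \<gamma> UNIV * emeasure lborel {a..b}"
      by (rule lborel.emeasure_pair_measure_Times) auto
    then have "emeasure P (strip a b) < \<infinity>" using emeasure_space_1 ab by simp
    then have "integrable P (indicator (strip a b) :: _ \<Rightarrow> real)" by (intro integrable_real_indicator) auto
    also have "(indicator (strip a b) :: _ \<Rightarrow> real) = ext (indicator (strip a b))"
      using ab by (auto simp: ext_def indicator_def fun_eq_iff)
    finally show ?thesis by (simp only: integrable_H)
  qed
  show ?thesis
  proof (rule Bochner_Integration.integrable_bound[OF Bochner_Integration.integrable_add[OF i1 i2]])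
    have "\<bar>t\<bar> \<le> t\<^sup>2 + 1" for t :: real
      using zero_le_power2[of "\<bar>t\<bar> - 1"] by (simp add: power2_diff)
    then show "AE z in H. norm (u z * indicator (strip a b) z)
        \<le> norm ((u z)\<^sup>2 * indicator (strip a b) z + indicator (strip a b) z)"
      by (auto simp: indicator_def)
  qed measurable
qed

lemma L2_loc_integrable_mult:
  assumes u: "L2_loc \<gamma> u" and \<phi>: "\<phi> \<in> borel_measurable borel" "\<And>z. \<bar>\<phi> z\<bar> \<le> K"
    and supp: "0 < a" "a < b" "\<And>z. snd z \<notin> {a..b} \<Longrightarrow> \<phi> z = 0"
  shows "integrable H (\<lambda>z. u z * \<phi> z)"
proof (rule Bochner_Integration.integrable_bound)
  show "integrable H (\<lambda>z. K * (u z * indicator (strip a b) z))"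
    using L2_loc_integrable_strip[OF u supp(1,2)] by simp
  have [measurable]: "u \<in> borel_measurable H" using u unfolding L2_loc_def by blast
  have [measurable]: "\<phi> \<in> borel_measurable H" by (rule borel_measurable_H) fact
  show "(\<lambda>z. u z * \<phi> z) \<in> borel_measurable H" by measurable
  have "\<bar>u z * \<phi> z\<bar> \<le> \<bar>K * (u z * indicator (strip a b) z)\<bar>" for z
  proof (cases "snd z \<in> {a..b}")
    case True
    then have "z \<in> strip a b" by (cases z) auto
    moreover have "\<bar>\<phi> z\<bar> \<le> \<bar>K\<bar>" using \<phi>(2)[of z] by linarith
    then have "\<bar>u z\<bar> * \<bar>\<phi> z\<bar> \<le> \<bar>u z\<bar> * \<bar>K\<bar>" by (intro mult_left_mono) auto
    ultimately show ?thesis by (simp add: abs_mult mult.commute)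
  qed (use supp(3) in auto)
  then show "AE z in H. norm (u z * \<phi> z) \<le> norm (K * (u z * indicator (strip a b) z))" by simp
qed

text \<open>Products of cylindrical and test functions would suffice as test functions, but their linear span
  is awkward to describe. This larger class is closed under linear combinations by inspection, and
  its difference quotients in \<open>y\<close> converge boundedly to the second argument.\<close>

definition strip_test :: "('a \<times> real \<Rightarrow> real) \<Rightarrow> ('a \<times> real \<Rightarrow> real) \<Rightarrow> bool" where
  "strip_test \<phi> \<phi>' \<longleftrightarrow> \<phi> \<in> borel_measurable borel \<and> \<phi>' \<in> borel_measurable borel \<and>
     (\<forall>x y. ((\<lambda>y. \<phi> (x, y)) has_real_derivative \<phi>' (x, y)) (at y)) \<and>
     (\<exists>a b K. 0 < a \<and> a < b \<and>
        (\<forall>z. \<bar>\<phi> z\<bar> \<le> K \<and> \<bar>\<phi>' z\<bar> \<le> K \<and> (snd z \<notin> {a..b} \<longrightarrow> \<phi> z = 0 \<and> \<phi>' z = 0)))"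

lemma strip_test_integrable:
  assumes "strip_test \<phi> \<phi>'" "L2_loc \<gamma> u"
  shows "integrable H (\<lambda>z. u z * \<phi> z)" "integrable H (\<lambda>z. u z * \<phi>' z)"
proof -
  obtain a b K where "0 < a" "a < b" "\<And>z. \<bar>\<phi> z\<bar> \<le> K" "\<And>z. \<bar>\<phi>' z\<bar> \<le> K"
    "\<And>z. snd z \<notin> {a..b} \<Longrightarrow> \<phi> z = 0" "\<And>z. snd z \<notin> {a..b} \<Longrightarrow> \<phi>' z = 0"
    using assms(1) unfolding strip_test_def by blast
  then show "integrable H (\<lambda>z. u z * \<phi> z)" "integrable H (\<lambda>z. u z * \<phi>' z)"
    using assms L2_loc_integrable_mult[of u] unfolding strip_test_def by blast+
qed

lemma strip_test_tensor:
  assumes f: "smooth_cylindrical f" and \<eta>: "test_function \<eta>"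
  shows "strip_test (\<lambda>z. f (fst z) * \<eta> (snd z)) (\<lambda>z. f (fst z) * deriv \<eta> (snd z))"
proof -
  obtain L where L: "\<And>x. \<bar>f x\<bar> \<le> L" using smooth_cylindrical_bounded_measurable(2)[OF f] by blast
  obtain a b K where K: "0 < a" "a < b" "\<And>y. \<bar>\<eta> y\<bar> \<le> K" "\<And>y. \<bar>deriv \<eta> y\<bar> \<le> K"
    "\<And>y. y \<notin> {a..b} \<Longrightarrow> \<eta> y = 0" "\<And>y. y \<notin> {a..b} \<Longrightarrow> deriv \<eta> y = 0"
    using test_function_bounds[OF \<eta>] by blast
  have [measurable]: "f \<in> borel_measurable borel" "\<eta> \<in> borel_measurable borel" "deriv \<eta> \<in> borel_measurable borel"
    using smooth_cylindrical_bounded_measurable(1)[OF f] test_function_continuous(1)[OF \<eta>, of 0]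
      test_function_continuous(1)[OF \<eta>, of 1] by (auto intro: borel_measurable_continuous_onI)
  have "\<bar>f x * \<eta> y\<bar> \<le> L * K" "\<bar>f x * deriv \<eta> y\<bar> \<le> L * K" for x y
    unfolding abs_mult using L[of x] K(3)[of y] K(4)[of y] by (auto intro!: mult_mono)
  moreover have "((\<lambda>y. f x * \<eta> y) has_real_derivative f x * deriv \<eta> y) (at y)" for x y
    using test_function_continuous(2)[OF \<eta>, of y] by (rule DERIV_cmult)
  moreover have "(\<lambda>z. f (fst z) * \<eta> (snd z)) \<in> borel_measurable borel" "(\<lambda>z. f (fst z) * deriv \<eta> (snd z)) \<in> borel_measurable borel"
    unfolding borel_prod[symmetric] by measurable
  ultimately show ?thesis unfolding strip_test_def using K(1,2,5,6)
    by (intro conjI exI[of _ a] exI[of _ b] exI[of _ "L * K"]) auto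
qed

lemma weak_dy_unique:
  assumes "weak_dy \<gamma> v w" "weak_dy \<gamma> v w'"
  shows "AE z in H. w z = w' z"
proof -
  have L: "L2_loc \<gamma> w" "L2_loc \<gamma> w'" using assms unfolding weak_dy_def by blast+
  then have [measurable]: "w \<in> borel_measurable H" "w' \<in> borel_measurable H" unfolding L2_loc_def by blast+
  have "AE z in H. w z - w' z = 0"
  proof (rule weak_zero_imp_AE_zero[OF prob_space_axioms sets_gamma])
    fix a b :: real assume ab: "0 < a" "a < b"
    then show "integrable H (\<lambda>z. (w z - w' z) * indicator (strip a b) z)"
      using L2_loc_integrable_strip[OF L(1)] L2_loc_integrable_strip[OF L(2)] by (simp add: left_diff_distrib)
  next
    fix f :: "'a \<Rightarrow> real" and \<eta> assume f: "smooth_cylindrical f" and \<eta>: "test_function \<eta>"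
    note int = strip_test_integrable(1)[OF strip_test_tensor[OF f \<eta>]]
    show "(LINT z|H. (w z - w' z) * (f (fst z) * \<eta> (snd z))) = 0"
      using int[OF L(1)] int[OF L(2)] assms f \<eta> unfolding weak_dy_def by (simp add: left_diff_distrib)
  qed measurable
  then show ?thesis by eventually_elim simp
qed

section \<open>Increments in the vertical direction\<close>

text \<open>The integral of \<open>w(x, \<cdot>)\<close> over \<open>[y, y + \<epsilon>]\<close>, written as an integral of translates so that
  translation invariance applies after exchanging the order of integration.\<close>

definition vertical_integral :: "('a \<times> real \<Rightarrow> real) \<Rightarrow> real \<Rightarrow> 'a \<times> real \<Rightarrow> real" where
  "vertical_integral w \<epsilon> z = (LINT r|interval_measure \<epsilon>. ext w (shift r z))"

lemma ext_shift_measurable: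
  assumes w: "w \<in> borel_measurable H" and \<epsilon>: "0 < \<epsilon>"
  shows "(\<lambda>(z, r). ext w (shift r z)) \<in> borel_measurable (P \<Otimes>\<^sub>M interval_measure \<epsilon>)"
    and "vertical_integral w \<epsilon> \<in> borel_measurable borel"
proof -
  interpret U: finite_measure "interval_measure \<epsilon>" by (rule interval_measure(1)[OF \<epsilon>])
  have sets: "sets (P \<Otimes>\<^sub>M interval_measure \<epsilon>) = sets (P \<Otimes>\<^sub>M borel)"
    by (intro sets_pair_measure_cong refl interval_measure(3)[OF \<epsilon>])
  have "ext w \<in> borel_measurable P" using ext_measurable[OF w] by (simp add: measurable_P)
  from measurable_compose[OF shift_measurable(2) this]
  show m: "(\<lambda>(z, r). ext w (shift r z)) \<in> borel_measurable (P \<Otimes>\<^sub>M interval_measure \<epsilon>)"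
    unfolding measurable_cong_sets[OF sets refl] by (simp add: case_prod_beta)
  show "vertical_integral w \<epsilon> \<in> borel_measurable borel"
    unfolding vertical_integral_def[abs_def] measurable_P[symmetric]
    by (rule U.borel_measurable_lebesgue_integral[OF m])
qed

text \<open>Fubini's theorem for the average of the translates of \<open>w\<close>, tested against a function that
  is supported in a strip.\<close>

lemma vertical_integral_test:
  assumes w: "L2_loc \<gamma> w" and \<epsilon>: "0 < \<epsilon>"
    and \<phi> [measurable]: "\<phi> \<in> borel_measurable borel" and K: "\<And>z. \<bar>\<phi> z\<bar> \<le> K"
    and ab: "0 < a" "a < b" "\<And>z. snd z \<notin> {a..b} \<Longrightarrow> \<phi> z = 0"
  shows "integrable H (\<lambda>z. vertical_integral w \<epsilon> z * \<phi> z)"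
    and "(LINT z|H. vertical_integral w \<epsilon> z * \<phi> z)
      = (LINT z|H. w z * (LINT r|interval_measure \<epsilon>. \<phi> (shift (- r) z)))"
proof -
  let ?U = "interval_measure \<epsilon>"
  interpret U: finite_measure ?U by (rule interval_measure(1)[OF \<epsilon>])
  interpret PU: pair_sigma_finite P ?U ..
  have wm: "w \<in> borel_measurable H" using w unfolding L2_loc_def by blast
  note em = ext_measurable[OF wm]
  have \<phi>P: "\<phi> \<in> borel_measurable P" using \<phi> by (simp add: measurable_P)
  have \<phi>0: "\<phi> z = 0" if "z \<notin> Omega" for z using ab that by (cases z) auto
  define F where "F z r = ext w (shift r z) * \<phi> z" for z r
  have Fm: "(\<lambda>(z, r). F z r) \<in> borel_measurable (P \<Otimes>\<^sub>M ?U)"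
    using borel_measurable_times[OF ext_shift_measurable(1)[OF wm \<epsilon>] measurable_compose[OF measurable_fst \<phi>P]]
    by (simp add: F_def case_prod_beta)
  have strip_int: "integrable P (\<lambda>z. ext w z * indicator (strip a (b + \<epsilon>)) z)"
    using L2_loc_integrable_strip[OF w ab(1), of "b + \<epsilon>"] ab \<epsilon>
    by (simp add: integrable_H ext_def[abs_def] mult.assoc)
  define c where "c = (LINT z|P. \<bar>ext w z * indicator (strip a (b + \<epsilon>)) z\<bar>)"
  have slice: "(\<integral>\<^sup>+z. ennreal (norm (F z r)) \<partial>P) \<le> ennreal (\<bar>K\<bar> * c)" if r: "r \<in> {0..\<epsilon>}" for r
  proof -
    have "(\<integral>\<^sup>+z. ennreal (norm (F z r)) \<partial>P)
        \<le> (\<integral>\<^sup>+z. ennreal (\<bar>K\<bar> * \<bar>ext w (shift r z) * indicator (strip a (b + \<epsilon>)) (shift r z)\<bar>) \<partial>P)"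
    proof (intro nn_integral_mono ennreal_leI)
      fix z
      show "norm (F z r) \<le> \<bar>K\<bar> * \<bar>ext w (shift r z) * indicator (strip a (b + \<epsilon>)) (shift r z)\<bar>"
      proof (cases "snd z \<in> {a..b}")
        case True
        then have "shift r z \<in> strip a (b + \<epsilon>)" using r by (auto simp: shift_def)
        moreover have "\<bar>\<phi> z\<bar> \<le> \<bar>K\<bar>" using K[of z] by linarith
        ultimately show ?thesis unfolding F_def by (simp add: abs_mult mult.commute mult_right_mono)
      qed (simp add: F_def ab(3))
    qed
    also have "\<dots> = (\<integral>\<^sup>+z. ennreal (\<bar>K\<bar> * \<bar>ext w z * indicator (strip a (b + \<epsilon>)) z\<bar>) \<partial>P)"
      using nn_integral_shift[of "\<lambda>z. ennreal (\<bar>K\<bar> * \<bar>ext w z * indicator (strip a (b + \<epsilon>)) z\<bar>)" r] em by simp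
    also have "\<dots> = ennreal (\<bar>K\<bar> * c)"
      using strip_int unfolding c_def by (subst nn_integral_eq_integral) auto
    finally show ?thesis .
  qed
  have Fint: "integrable (P \<Otimes>\<^sub>M ?U) (\<lambda>(z, r). F z r)"
  proof (rule integrableI_bounded[OF Fm])
    have "(\<integral>\<^sup>+p. ennreal (norm (case p of (z, r) \<Rightarrow> F z r)) \<partial>(P \<Otimes>\<^sub>M ?U)) = (\<integral>\<^sup>+r. \<integral>\<^sup>+z. ennreal (norm (F z r)) \<partial>P \<partial>?U)"
      using PU.nn_integral_snd[of "\<lambda>p. ennreal (norm (case p of (z, r) \<Rightarrow> F z r))"] Fm by simp
    also have "\<dots> \<le> (\<integral>\<^sup>+r. ennreal (\<bar>K\<bar> * c) \<partial>?U)"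
      using interval_measure(4)[OF \<epsilon>] slice by (intro nn_integral_mono_AE) (auto elim: AE_mp)
    also have "\<dots> < \<infinity>" by (simp add: ennreal_mult_less_top U.emeasure_eq_measure)
    finally show "(\<integral>\<^sup>+p. ennreal (norm (case p of (z, r) \<Rightarrow> F z r)) \<partial>(P \<Otimes>\<^sub>M ?U)) < \<infinity>" .
  qed
  have inner: "(LINT r|?U. F z r) = vertical_integral w \<epsilon> z * \<phi> z" for z
    unfolding F_def vertical_integral_def by simp
  have ext_eq: "ext (\<lambda>z. vertical_integral w \<epsilon> z * \<phi> z) = (\<lambda>z. vertical_integral w \<epsilon> z * \<phi> z)"
    using \<phi>0 by (auto simp: ext_def indicator_def fun_eq_iff)
  show "integrable H (\<lambda>z. vertical_integral w \<epsilon> z * \<phi> z)"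
    unfolding integrable_H ext_eq using PU.integrable_fst[OF Fint] by (simp add: inner)
  define G where "G r z = ext w z * \<phi> (shift (- r) z)" for r z
  have Gm: "(\<lambda>z. \<phi> (shift r z)) \<in> borel_measurable borel" for r
    using measurable_compose[OF shift_measurable(1) \<phi>P] by (simp add: measurable_P)
  have GF: "F z r = G r (shift r z)" for z r unfolding F_def G_def by (simp add: shift_def)
  have Gint: "integrable (?U \<Otimes>\<^sub>M P) (\<lambda>(r, z). G r z)"
  proof (rule integrableI_bounded)
    have s: "sets (?U \<Otimes>\<^sub>M P) = sets (borel \<Otimes>\<^sub>M P)" by (intro sets_pair_measure_cong refl interval_measure(3)[OF \<epsilon>])
    have emP: "ext w \<in> borel_measurable P" using em by (simp add: measurable_P)
    have "(\<lambda>p. shift (- fst p) (snd p)) \<in> borel \<Otimes>\<^sub>M P \<rightarrow>\<^sub>M P" unfolding shift_def by measurable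
    from borel_measurable_times[OF measurable_compose[OF measurable_snd emP] measurable_compose[OF this \<phi>P]]
    show Gm': "(\<lambda>(r, z). G r z) \<in> borel_measurable (?U \<Otimes>\<^sub>M P)"
      unfolding measurable_cong_sets[OF s refl] G_def case_prod_beta .
    have Gr: "G r \<in> borel_measurable borel" for r
      unfolding G_def by (intro borel_measurable_times em Gm)
    have "(\<integral>\<^sup>+p. ennreal (norm (case p of (r, z) \<Rightarrow> G r z)) \<partial>(?U \<Otimes>\<^sub>M P)) = (\<integral>\<^sup>+r. \<integral>\<^sup>+z. ennreal (norm (G r z)) \<partial>P \<partial>?U)"
      using PL.P.nn_integral_fst[of "\<lambda>p. ennreal (norm (case p of (r, z) \<Rightarrow> G r z))" ?U] Gm' by simp
    also have "\<dots> = (\<integral>\<^sup>+r. \<integral>\<^sup>+z. ennreal (norm (F z r)) \<partial>P \<partial>?U)"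
      unfolding GF by (intro nn_integral_cong nn_integral_shift[symmetric]) (use Gr in auto)
    also have "\<dots> \<le> (\<integral>\<^sup>+r. ennreal (\<bar>K\<bar> * c) \<partial>?U)"
      using interval_measure(4)[OF \<epsilon>] slice by (intro nn_integral_mono_AE) (auto elim: AE_mp)
    also have "\<dots> < \<infinity>" by (simp add: ennreal_mult_less_top U.emeasure_eq_measure)
    finally show "(\<integral>\<^sup>+p. ennreal (norm (case p of (r, z) \<Rightarrow> G r z)) \<partial>(?U \<Otimes>\<^sub>M P)) < \<infinity>" .
  qed
  interpret UP: pair_sigma_finite ?U P ..
  have "(LINT z|H. vertical_integral w \<epsilon> z * \<phi> z) = (LINT z|P. LINT r|?U. F z r)"
    unfolding integral_H ext_eq inner ..
  also have "\<dots> = (LINT r|?U. LINT z|P. F z r)" by (rule PU.Fubini_integral[OF Fint, symmetric])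
  also have "\<dots> = (LINT r|?U. LINT z|P. G r z)"
    unfolding GF by (intro Bochner_Integration.integral_cong refl integral_shift(1))
      (auto simp: G_def intro!: borel_measurable_times em Gm)
  also have "\<dots> = (LINT z|P. LINT r|?U. G r z)" by (rule UP.Fubini_integral[OF Gint, symmetric])
  also have "\<dots> = (LINT z|H. w z * (LINT r|?U. \<phi> (shift (- r) z)))"
    unfolding G_def integral_H ext_def by (simp add: mult.assoc)
  finally show "(LINT z|H. vertical_integral w \<epsilon> z * \<phi> z) = (LINT z|H. w z * (LINT r|?U. \<phi> (shift (- r) z)))" .
qed

lemma L2_loc_shift:
  assumes u: "L2_loc \<gamma> u" and \<epsilon>: "0 < \<epsilon>"
  shows "L2_loc \<gamma> (\<lambda>z. u (shift \<epsilon> z))"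
proof -
  have m: "u \<in> borel_measurable H" using u unfolding L2_loc_def by blast
  have e: "u (shift \<epsilon> z) = ext u (shift \<epsilon> z)" if "z \<in> Omega" for z
    using that \<epsilon> by (auto simp: ext_def shift_def)
  have "(\<lambda>z. ext u (shift \<epsilon> z)) \<in> borel_measurable H"
    using measurable_compose[OF shift_measurable(1)[of \<epsilon>], of "ext u" borel] ext_measurable[OF m]
    by (intro borel_measurable_H) (simp add: measurable_P)
  then have m': "(\<lambda>z. u (shift \<epsilon> z)) \<in> borel_measurable H"
    using e by (subst measurable_cong[of H _ "\<lambda>z. ext u (shift \<epsilon> z)"]) auto
  have "(\<integral>\<^sup>+z. ennreal ((u (shift \<epsilon> z))\<^sup>2 * indicator (strip a b) z) \<partial>H) < \<infinity>" if ab: "0 < a" "a < b" for a b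
  proof -
    let ?F = "\<lambda>z. ennreal ((ext u z)\<^sup>2 * indicator (strip a (b + \<epsilon>)) z)"
    have "(\<integral>\<^sup>+z. ennreal ((u (shift \<epsilon> z))\<^sup>2 * indicator (strip a b) z) \<partial>H) \<le> (\<integral>\<^sup>+z. ?F (shift \<epsilon> z) \<partial>P)"
      unfolding nn_integral_H
      by (intro nn_integral_mono) (use \<epsilon> in \<open>auto simp: indicator_def ext_def shift_def\<close>)
    also have "\<dots> = (\<integral>\<^sup>+z. ?F z \<partial>P)" using ext_measurable[OF m] by (intro nn_integral_shift) simp
    also have "\<dots> = (\<integral>\<^sup>+z. ennreal ((u z)\<^sup>2 * indicator (strip a (b + \<epsilon>)) z) \<partial>H)"
      unfolding nn_integral_H by (intro nn_integral_cong) (auto simp: indicator_def ext_def)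
    also have "\<dots> < \<infinity>" using u ab \<epsilon> unfolding L2_loc_def by simp
    finally show ?thesis .
  qed
  with m' show ?thesis unfolding L2_loc_def by blast
qed

lemma integral_shift_test:
  fixes u \<phi> :: "'a \<times> real \<Rightarrow> real"
  assumes u: "u \<in> borel_measurable H" and \<epsilon>: "0 < \<epsilon>"
    and \<phi>: "\<phi> \<in> borel_measurable borel" "0 < a" "\<And>z. snd z \<notin> {a..b} \<Longrightarrow> \<phi> z = 0"
  shows "(LINT z|H. u (shift \<epsilon> z) * \<phi> z) = (LINT z|H. u z * \<phi> (shift (- \<epsilon>) z))"
proof -
  let ?F = "\<lambda>z. ext u z * \<phi> (shift (- \<epsilon>) z)"
  have "(LINT z|H. u (shift \<epsilon> z) * \<phi> z) = (LINT z|P. ?F (shift \<epsilon> z))"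
    unfolding integral_H
  proof (intro Bochner_Integration.integral_cong refl)
    fix z :: "'a \<times> real"
    show "ext (\<lambda>z. u (shift \<epsilon> z) * \<phi> z) z = ?F (shift \<epsilon> z)"
    proof (cases "snd z \<in> {a..b}")
      case True
      then have "z \<in> Omega" "shift \<epsilon> z \<in> Omega" using \<phi>(2) \<epsilon> by (cases z; auto simp: shift_def)+
      then show ?thesis by (simp add: ext_def) (simp add: shift_def)
    next
      case False
      then show ?thesis using \<phi>(3)[OF False] by (simp add: ext_def) (simp add: shift_def)
    qed
  qed
  also have "\<dots> = (LINT z|P. ?F z)"
  proof (rule integral_shift(1))
    have "(\<lambda>z. \<phi> (shift (- \<epsilon>) z)) \<in> borel_measurable borel"
      using measurable_compose[OF shift_measurable(1)[of "- \<epsilon>"], of \<phi> borel] \<phi>(1) by (simp add: measurable_P)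
    then show "?F \<in> borel_measurable borel" using ext_measurable[OF u] by (rule borel_measurable_times[rotated])
  qed
  also have "\<dots> = (LINT z|H. u z * \<phi> (shift (- \<epsilon>) z))"
    unfolding integral_H ext_def[abs_def] by (simp add: mult.assoc)
  finally show ?thesis .
qed

text \<open>Tested against \<open>f \<otimes> \<eta>\<close>, both sides are the weak derivative tested against \<open>f\<close> and the average
  of \<open>\<eta>\<close> over \<open>[y - \<epsilon>, y]\<close>, whose derivative is \<open>\<eta>(y) - \<eta>(y - \<epsilon>)\<close>.\<close>

theorem weak_dy_increment:
  assumes weak: "weak_dy \<gamma> v w" and \<epsilon>: "0 < \<epsilon>"
  shows "AE z in H. v (shift \<epsilon> z) - v z = vertical_integral w \<epsilon> z"
proof -
  have Lv: "L2_loc \<gamma> v" and Lw: "L2_loc \<gamma> w" using weak unfolding weak_dy_def by blast+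
  note Ls = L2_loc_shift[OF Lv \<epsilon>]
  have m [measurable]: "v \<in> borel_measurable H" "w \<in> borel_measurable H" "(\<lambda>z. v (shift \<epsilon> z)) \<in> borel_measurable H"
    using Lv Lw Ls unfolding L2_loc_def by blast+
  have [measurable]: "vertical_integral w \<epsilon> \<in> borel_measurable H"
    by (rule borel_measurable_H[OF ext_shift_measurable(2)[OF m(2) \<epsilon>]])
  have "AE z in H. v (shift \<epsilon> z) - v z - vertical_integral w \<epsilon> z = 0"
  proof (rule weak_zero_imp_AE_zero[OF prob_space_axioms sets_gamma])
    fix a b :: real assume ab: "0 < a" "a < b"
    have "integrable H (\<lambda>z. vertical_integral w \<epsilon> z * indicator (strip a b) z)"
      by (rule vertical_integral_test(1)[OF Lw \<epsilon> _ _ ab, of _ 1]) (auto simp: indicator_def)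
    then show "integrable H (\<lambda>z. (v (shift \<epsilon> z) - v z - vertical_integral w \<epsilon> z) * indicator (strip a b) z)"
      using L2_loc_integrable_strip[OF Lv ab] L2_loc_integrable_strip[OF Ls ab] by (simp add: left_diff_distrib)
  next
    fix f :: "'a \<Rightarrow> real" and \<eta> assume f: "smooth_cylindrical f" and \<eta>: "test_function \<eta>"
    let ?\<phi> = "\<lambda>z. f (fst z) * \<eta> (snd z)"
    have t: "strip_test ?\<phi> (\<lambda>z. f (fst z) * deriv \<eta> (snd z))" by (rule strip_test_tensor[OF f \<eta>])
    then obtain a b K where ab: "0 < a" "a < b" and K: "\<And>z. \<bar>?\<phi> z\<bar> \<le> K"
      and supp: "\<And>z. snd z \<notin> {a..b} \<Longrightarrow> ?\<phi> z = 0" and \<phi>m: "?\<phi> \<in> borel_measurable borel"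
      unfolding strip_test_def by blast
    obtain \<psi> where \<psi>: "test_function \<psi>" "\<And>y. deriv \<psi> y = \<eta> y - \<eta> (y - \<epsilon>)"
      "\<And>y. \<psi> y = (LINT r|interval_measure \<epsilon>. \<eta> (y - r))"
      using test_function_average[OF \<eta> \<epsilon>] by blast
    note t\<psi> = strip_test_tensor[OF f \<psi>(1)]
    have "(LINT z|H. v (shift \<epsilon> z) * ?\<phi> z) - (LINT z|H. v z * ?\<phi> z)
        = (LINT z|H. v z * ?\<phi> (shift (- \<epsilon>) z)) - (LINT z|H. v z * ?\<phi> z)"
      using integral_shift_test[OF m(1) \<epsilon> \<phi>m ab(1) supp] by simp
    also have "\<dots> = - (LINT z|H. v z * (f (fst z) * deriv \<psi> (snd z)))"
    proof -
      have i: "integrable H (\<lambda>z. v z * (f (fst z) * deriv \<psi> (snd z)))" by (rule strip_test_integrable(2)[OF t\<psi> Lv])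
      have j: "integrable H (\<lambda>z. v z * ?\<phi> z)" by (rule strip_test_integrable(1)[OF t Lv])
      have eq: "v z * ?\<phi> (shift (- \<epsilon>) z) = v z * ?\<phi> z - v z * (f (fst z) * deriv \<psi> (snd z))" for z
        by (simp add: \<psi>(2) shift_def algebra_simps)
      show ?thesis unfolding eq using Bochner_Integration.integral_diff[OF j i] by simp
    qed
    also have "\<dots> = (LINT z|H. w z * (f (fst z) * \<psi> (snd z)))"
      using weak f \<psi>(1) unfolding weak_dy_def by simp
    also have "\<dots> = (LINT z|H. w z * (LINT r|interval_measure \<epsilon>. ?\<phi> (shift (- r) z)))"
      by (simp add: \<psi>(3) shift_def)
    also have "\<dots> = (LINT z|H. vertical_integral w \<epsilon> z * ?\<phi> z)"
      by (rule vertical_integral_test(2)[OF Lw \<epsilon> \<phi>m K ab supp, symmetric])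
    finally have "(LINT z|H. v (shift \<epsilon> z) * ?\<phi> z) - (LINT z|H. v z * ?\<phi> z) = (LINT z|H. vertical_integral w \<epsilon> z * ?\<phi> z)" .
    then show "(LINT z|H. (v (shift \<epsilon> z) - v z - vertical_integral w \<epsilon> z) * ?\<phi> z) = 0"
      using strip_test_integrable(1)[OF t Lv] strip_test_integrable(1)[OF t Ls]
        vertical_integral_test(1)[OF Lw \<epsilon> \<phi>m K ab supp]
      by (simp add: left_diff_distrib)
  qed measurable
  then show ?thesis by eventually_elim simp
qed

end

lemma difference_quotient_bound:
  fixes g g' :: "real \<Rightarrow> real"
  assumes "\<And>y. (g has_real_derivative g' y) (at y)" "\<And>y. \<bar>g' y\<bar> \<le> K"
  shows "\<bar>g (y - \<epsilon>) - g y\<bar> \<le> K * \<bar>\<epsilon>\<bar>"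
proof -
  have "norm (g (y - \<epsilon>) - g y) \<le> K * norm ((y - \<epsilon>) - y)"
    by (rule field_differentiable_bound[of UNIV g g']) (use assms in \<open>auto intro: has_field_derivative_at_within\<close>)
  then show ?thesis by simp
qed

text \<open>A weight \<open>y\<^sup>p\<close> with \<open>p \<ge> -1\<close> decreases at most like \<open>1/y\<close>.\<close>

lemma powr_shift_weight:
  fixes y r a \<epsilon> p :: real
  assumes "0 < a" "a \<le> y" "0 \<le> r" "r \<le> \<epsilon>" "- 1 \<le> p"
  shows "y powr p \<le> (1 + \<epsilon> / a) * (y + r) powr p"
proof -
  have "r / y \<le> \<epsilon> / a" using assms by (intro frac_le) auto
  moreover have "0 \<le> r / y" using assms by simp
  ultimately have c: "1 \<le> 1 + r / y" "1 + r / y \<le> 1 + \<epsilon> / a" by auto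
  have "1 = (1 + r / y) * (1 + r / y) powr (- 1)" using c by (simp add: powr_minus field_simps)
  also have "\<dots> \<le> (1 + \<epsilon> / a) * (1 + r / y) powr p"
    using c assms(5) by (intro mult_mono powr_mono) auto
  finally have "y powr p * 1 \<le> y powr p * ((1 + \<epsilon> / a) * (1 + r / y) powr p)"
    by (intro mult_left_mono) auto
  also have "\<dots> = (1 + \<epsilon> / a) * ((y * (1 + r / y)) powr p)"
    using assms c by (simp add: powr_mult)
  also have "y * (1 + r / y) = y + r" using assms by (simp add: field_simps)
  finally show ?thesis by simp
qed

lemma powr_strip_bound:
  fixes y a b q :: real
  assumes "0 < a" "a \<le> y" "y \<le> b"
  shows "y powr q \<le> a powr q + b powr q"
proof (cases "0 \<le> q")
  case True
  then have "y powr q \<le> b powr q" using assms by (intro powr_mono2) auto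
  then show ?thesis by (simp add: add_increasing)
next
  case False
  then have "y powr q \<le> a powr q" using assms by (intro powr_mono2') auto
  then show ?thesis by (simp add: add_increasing2)
qed

context wiener
begin

text \<open>The increment is an average of \<open>w\<close> over \<open>[y, y + \<epsilon>]\<close>; by the inequality of Cauchy and
  Schwarz its weighted norm is that of \<open>w\<close>, up to the oscillation of the weight over \<open>\<epsilon>\<close>.\<close>

lemma increment_bound:
  assumes weak: "weak_dy \<gamma> v w" and \<epsilon>: "0 < \<epsilon>" and a: "0 < a" and p: "- 1 \<le> p"
  shows "(\<integral>\<^sup>+z. ennreal ((v (shift \<epsilon> z) - v z)\<^sup>2 * snd z powr p * indicator (strip a b) z) \<partial>H)
    \<le> ennreal ((1 + \<epsilon> / a) * \<epsilon>\<^sup>2) * (\<integral>\<^sup>+z. ennreal ((w z)\<^sup>2 * snd z powr p) \<partial>H)"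
proof -
  let ?U = "interval_measure \<epsilon>"
  interpret U: finite_measure ?U by (rule interval_measure(1)[OF \<epsilon>])
  interpret PU: pair_sigma_finite P ?U ..
  have w: "w \<in> borel_measurable H" using weak unfolding weak_dy_def L2_loc_def by blast
  have wP [measurable]: "ext w \<in> borel_measurable P" using ext_measurable[OF w] by (simp add: measurable_P)
  define \<omega> where "\<omega> z = snd z powr p * indicator (strip a b) z" for z :: "'a \<times> real"
  have \<omega>m [measurable]: "\<omega> \<in> borel_measurable P" unfolding \<omega>_def by measurable
  have \<omega>0: "0 \<le> \<omega> z" "z \<notin> Omega \<Longrightarrow> \<omega> z = 0" for z using a by (auto simp: \<omega>_def indicator_def)
  define J where "J = (\<integral>\<^sup>+z. ennreal ((ext w z)\<^sup>2 * snd z powr p) \<partial>P)"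
  have sq_m: "(\<lambda>z. ennreal ((ext w z)\<^sup>2 * snd z powr p)) \<in> borel_measurable borel"
    unfolding measurable_P[symmetric] by measurable
  have shm: "(\<lambda>(z, r). ext w (shift r z)) \<in> borel_measurable (P \<Otimes>\<^sub>M ?U)" by (rule ext_shift_measurable(1)[OF w \<epsilon>])
  have slice: "(\<lambda>r. ext w (shift r z)) \<in> borel_measurable ?U" for z
    using measurable_Pair2[OF shm, of z] by simp
  have Km: "(\<lambda>(z, r). ennreal ((ext w (shift r z))\<^sup>2) * ennreal (\<omega> z)) \<in> borel_measurable (P \<Otimes>\<^sub>M ?U)"
    using shm by (simp add: case_prod_beta)
  have "(\<integral>\<^sup>+z. \<integral>\<^sup>+r. ennreal ((ext w (shift r z))\<^sup>2) * ennreal (\<omega> z) \<partial>?U \<partial>P)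
      = (\<integral>\<^sup>+r. \<integral>\<^sup>+z. ennreal ((ext w (shift r z))\<^sup>2) * ennreal (\<omega> z) \<partial>P \<partial>?U)"
    by (rule PU.Fubini'[OF Km, symmetric])
  also have "\<dots> \<le> (\<integral>\<^sup>+r. ennreal (1 + \<epsilon> / a) * J \<partial>?U)"
  proof (rule nn_integral_mono_AE, rule AE_mp[OF interval_measure(4)[OF \<epsilon>]], intro AE_I2 impI)
    fix r assume r: "r \<in> {0..\<epsilon>}"
    have "(\<integral>\<^sup>+z. ennreal ((ext w (shift r z))\<^sup>2) * ennreal (\<omega> z) \<partial>P)
        \<le> (\<integral>\<^sup>+z. ennreal (1 + \<epsilon> / a) * ennreal ((ext w (shift r z))\<^sup>2 * snd (shift r z) powr p) \<partial>P)"
    proof (rule nn_integral_mono)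
      fix z :: "'a \<times> real"
      have "\<omega> z \<le> (1 + \<epsilon> / a) * snd (shift r z) powr p"
        using powr_shift_weight[OF a _ _ _ p, of "snd z" r \<epsilon>] r a \<epsilon>
        by (cases z) (auto simp: \<omega>_def shift_def indicator_def)
      then have "(ext w (shift r z))\<^sup>2 * \<omega> z \<le> (ext w (shift r z))\<^sup>2 * ((1 + \<epsilon> / a) * snd (shift r z) powr p)"
        by (intro mult_left_mono) auto
      then show "ennreal ((ext w (shift r z))\<^sup>2) * ennreal (\<omega> z)
          \<le> ennreal (1 + \<epsilon> / a) * ennreal ((ext w (shift r z))\<^sup>2 * snd (shift r z) powr p)"
      proof -
        assume le: "(ext w (shift r z))\<^sup>2 * \<omega> z \<le> (ext w (shift r z))\<^sup>2 * ((1 + \<epsilon> / a) * snd (shift r z) powr p)"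
        have "0 \<le> 1 + \<epsilon> / a" using a \<epsilon> by simp
        then have "ennreal (1 + \<epsilon> / a) * ennreal ((ext w (shift r z))\<^sup>2 * snd (shift r z) powr p)
            = ennreal ((1 + \<epsilon> / a) * ((ext w (shift r z))\<^sup>2 * snd (shift r z) powr p))"
          by (intro ennreal_mult[symmetric]) auto
        moreover have "ennreal ((ext w (shift r z))\<^sup>2) * ennreal (\<omega> z) = ennreal ((ext w (shift r z))\<^sup>2 * \<omega> z)"
          using \<omega>0 by (intro ennreal_mult[symmetric]) auto
        ultimately show ?thesis using ennreal_leI[OF le] by (simp only: mult.left_commute)
      qed
    qed
    also have "\<dots> = ennreal (1 + \<epsilon> / a) * (\<integral>\<^sup>+z. ennreal ((ext w (shift r z))\<^sup>2 * snd (shift r z) powr p) \<partial>P)"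
      using measurable_compose[OF shift_measurable(1), of "\<lambda>z. ennreal ((ext w z)\<^sup>2 * snd z powr p)" borel r] sq_m
      by (intro nn_integral_cmult) (simp add: measurable_P)
    also have "\<dots> = ennreal (1 + \<epsilon> / a) * J"
      unfolding J_def using nn_integral_shift[OF sq_m, of r] by simp
    finally show "(\<integral>\<^sup>+z. ennreal ((ext w (shift r z))\<^sup>2) * ennreal (\<omega> z) \<partial>P) \<le> ennreal (1 + \<epsilon> / a) * J" .
  qed
  also have "\<dots> = ennreal (1 + \<epsilon> / a) * J * ennreal \<epsilon>"
    using interval_measure(2)[OF \<epsilon>] by (simp add: U.emeasure_eq_measure)
  finally have inner: "(\<integral>\<^sup>+z. \<integral>\<^sup>+r. ennreal ((ext w (shift r z))\<^sup>2) * ennreal (\<omega> z) \<partial>?U \<partial>P)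
      \<le> ennreal (1 + \<epsilon> / a) * J * ennreal \<epsilon>" .
  have "(\<integral>\<^sup>+z. ennreal ((v (shift \<epsilon> z) - v z)\<^sup>2 * snd z powr p * indicator (strip a b) z) \<partial>H)
    = (\<integral>\<^sup>+z. ennreal ((vertical_integral w \<epsilon> z)\<^sup>2 * \<omega> z) \<partial>H)"
    using weak_dy_increment[OF weak \<epsilon>] by (intro nn_integral_cong_AE) (auto simp: \<omega>_def mult.assoc)
  also have "\<dots> = (\<integral>\<^sup>+z. ennreal ((vertical_integral w \<epsilon> z)\<^sup>2 * \<omega> z) \<partial>P)"
    unfolding nn_integral_H by (intro nn_integral_cong) (auto simp: indicator_def \<omega>0)
  also have "\<dots> \<le> (\<integral>\<^sup>+z. ennreal \<epsilon> * (\<integral>\<^sup>+r. ennreal ((ext w (shift r z))\<^sup>2) * ennreal (\<omega> z) \<partial>?U) \<partial>P)"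
  proof (rule nn_integral_mono)
    fix z
    have "ennreal ((vertical_integral w \<epsilon> z)\<^sup>2) \<le> ennreal \<epsilon> * (\<integral>\<^sup>+r. ennreal ((ext w (shift r z))\<^sup>2) \<partial>?U)"
      using nn_integral_square_ge_mean[OF U.finite_measure_axioms _ slice[of z]] interval_measure(2)[OF \<epsilon>] \<epsilon>
      unfolding vertical_integral_def by simp
    then have "ennreal ((vertical_integral w \<epsilon> z)\<^sup>2) * ennreal (\<omega> z)
        \<le> ennreal \<epsilon> * (\<integral>\<^sup>+r. ennreal ((ext w (shift r z))\<^sup>2) \<partial>?U) * ennreal (\<omega> z)"
      by (rule mult_right_mono) simp
    also have "\<dots> = ennreal \<epsilon> * (\<integral>\<^sup>+r. ennreal ((ext w (shift r z))\<^sup>2) * ennreal (\<omega> z) \<partial>?U)"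
      using slice[of z] by (subst nn_integral_multc) (auto simp: mult.assoc)
    finally show "ennreal ((vertical_integral w \<epsilon> z)\<^sup>2 * \<omega> z)
        \<le> ennreal \<epsilon> * (\<integral>\<^sup>+r. ennreal ((ext w (shift r z))\<^sup>2) * ennreal (\<omega> z) \<partial>?U)"
      using \<omega>0 by (simp add: ennreal_mult)
  qed
  also have "\<dots> = ennreal \<epsilon> * (\<integral>\<^sup>+z. \<integral>\<^sup>+r. ennreal ((ext w (shift r z))\<^sup>2) * ennreal (\<omega> z) \<partial>?U \<partial>P)"
    using U.borel_measurable_nn_integral[OF Km] by (intro nn_integral_cmult) simp
  also have "\<dots> \<le> ennreal \<epsilon> * (ennreal (1 + \<epsilon> / a) * J * ennreal \<epsilon>)"
    by (rule mult_left_mono[OF inner]) simp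
  also have "\<dots> = (ennreal (1 + \<epsilon> / a) * (ennreal \<epsilon> * ennreal \<epsilon>)) * J" by (simp only: mult_ac)
  also have "ennreal (1 + \<epsilon> / a) * (ennreal \<epsilon> * ennreal \<epsilon>) = ennreal ((1 + \<epsilon> / a) * \<epsilon>\<^sup>2)"
  proof -
    have "ennreal \<epsilon> * ennreal \<epsilon> = ennreal (\<epsilon>\<^sup>2)"
      unfolding power2_eq_square using \<epsilon> by (intro ennreal_mult[symmetric]) auto
    moreover have "ennreal (1 + \<epsilon> / a) * ennreal (\<epsilon>\<^sup>2) = ennreal ((1 + \<epsilon> / a) * \<epsilon>\<^sup>2)"
      using \<epsilon> a by (intro ennreal_mult[symmetric]) auto
    ultimately show ?thesis by simp
  qed
  also have "J = (\<integral>\<^sup>+z. ennreal ((w z)\<^sup>2 * snd z powr p) \<partial>H)"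
    unfolding J_def nn_integral_H by (intro nn_integral_cong) (auto simp: ext_def indicator_def)
  finally show ?thesis .
qed

lemma strip_indicator_integrable:
  assumes "0 < a" "a < b" shows "integrable H (indicator (strip a b) :: _ \<Rightarrow> real)"
proof -
  have "L2_loc \<gamma> (\<lambda>_. 1)" unfolding L2_loc_def
  proof (intro conjI allI impI)
    fix a b :: real assume ab: "0 < a \<and> a < b"
    have "(\<integral>\<^sup>+z. ennreal (1\<^sup>2 * indicator (strip a b) z) \<partial>H) \<le> (\<integral>\<^sup>+z. indicator (strip a b) z \<partial>P)"
      unfolding nn_integral_H by (intro nn_integral_mono) (auto simp: indicator_def)
    also have "\<dots> = emeasure \<gamma> UNIV * emeasure lborel {a..b}"
      by (simp add: lborel.emeasure_pair_measure_Times)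
    also have "\<dots> < \<infinity>" using ab emeasure_space_1 by simp
    finally show "(\<integral>\<^sup>+z. ennreal (1\<^sup>2 * indicator (strip a b) z) \<partial>H) < \<infinity>" .
  qed simp
  from L2_loc_integrable_strip[OF this assms] show ?thesis by simp
qed

lemma strip_test_weighted_square_integrable:
  assumes "strip_test \<phi> \<phi>'"
  shows "integrable H (\<lambda>z. (\<phi> z)\<^sup>2 * snd z powr q)"
proof -
  obtain a b K where ab: "0 < a" "a < b" and K: "\<And>z. \<bar>\<phi> z\<bar> \<le> K"
    and supp: "\<And>z. snd z \<notin> {a..b} \<Longrightarrow> \<phi> z = 0" and m: "\<phi> \<in> borel_measurable borel"
    using assms unfolding strip_test_def by blast
  have m2: "\<phi> \<in> borel_measurable H" by (rule borel_measurable_H[OF m])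
  have s: "snd \<in> borel_measurable H"
    by (rule borel_measurable_H) (intro borel_measurable_continuous_onI continuous_intros)
  show ?thesis
  proof (rule Bochner_Integration.integrable_bound)
    show "integrable H (\<lambda>z. (K\<^sup>2 * (a powr q + b powr q)) * indicator (strip a b) z)"
      using strip_indicator_integrable[OF ab] by (rule integrable_mult_right)
    show "(\<lambda>z. (\<phi> z)\<^sup>2 * snd z powr q) \<in> borel_measurable H" using m2 s by simp
    have "(\<phi> z)\<^sup>2 * snd z powr q \<le> (K\<^sup>2 * (a powr q + b powr q)) * indicator (strip a b) z" for z
    proof (cases "snd z \<in> {a..b}")
      case True
      have "(\<phi> z)\<^sup>2 \<le> K\<^sup>2" using K[of z] by (metis abs_ge_zero power2_abs power_mono)
      then have "(\<phi> z)\<^sup>2 * snd z powr q \<le> K\<^sup>2 * (a powr q + b powr q)"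
        using True powr_strip_bound[OF ab(1), of "snd z" b q] by (intro mult_mono) auto
      moreover have "z \<in> strip a b" using True by (cases z) auto
      ultimately show ?thesis by simp
    qed (simp add: supp)
    then have "\<bar>(\<phi> z)\<^sup>2 * snd z powr q\<bar> \<le> \<bar>(K\<^sup>2 * (a powr q + b powr q)) * indicator (strip a b) z\<bar>" for z
      unfolding abs_of_nonneg[OF mult_nonneg_nonneg[OF zero_le_power2 powr_ge_zero]]
      by (rule order_trans[OF _ abs_ge_self])
    then show "AE z in H. norm ((\<phi> z)\<^sup>2 * snd z powr q) \<le> norm ((K\<^sup>2 * (a powr q + b powr q)) * indicator (strip a b) z)"
      by (simp only: real_norm_def eventually_True)
  qed
qed

text \<open>Integration by parts for difference quotients, followed by \<open>2 XY \<le> \<rho> X\<^sup>2 + Y\<^sup>2/\<rho>\<close>.\<close>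

lemma weak_derivative_functional_bound:
  assumes u: "L2_loc \<gamma> u" and C: "0 \<le> C"
    and inc: "\<And>a b \<epsilon>. 0 < a \<Longrightarrow> a < b \<Longrightarrow> 0 < \<epsilon> \<Longrightarrow>
      (\<integral>\<^sup>+z. ennreal ((u (shift \<epsilon> z) - u z)\<^sup>2 * snd z powr p * indicator (strip a b) z) \<partial>H)
        \<le> ennreal ((1 + \<epsilon> / a) * \<epsilon>\<^sup>2 * C)"
    and \<phi>: "strip_test \<phi> \<phi>'"
  shows "- (LINT z|H. u z * \<phi>' z) \<le> C / 2 + (LINT z|H. (\<phi> z)\<^sup>2 * snd z powr (- p)) / 2"
proof -
  obtain a b K where ab: "0 < a" "a < b" and K: "\<And>z. \<bar>\<phi> z\<bar> \<le> K" "\<And>z. \<bar>\<phi>' z\<bar> \<le> K"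
    and supp: "\<And>z. snd z \<notin> {a..b} \<Longrightarrow> \<phi> z = 0"
    and \<phi>m: "\<phi> \<in> borel_measurable borel" and deriv: "\<And>x y. ((\<lambda>y. \<phi> (x, y)) has_real_derivative \<phi>' (x, y)) (at y)"
    and \<phi>'m: "\<phi>' \<in> borel_measurable borel"
    using \<phi> unfolding strip_test_def by blast
  have um [measurable]: "u \<in> borel_measurable H" using u unfolding L2_loc_def by blast
  have [measurable]: "\<phi> \<in> borel_measurable H" "\<phi>' \<in> borel_measurable H" using \<phi>m \<phi>'m by (auto intro: borel_measurable_H)
  have s [measurable]: "snd \<in> borel_measurable H"
    by (rule borel_measurable_H) (intro borel_measurable_continuous_onI continuous_intros)
  have [measurable]: "(indicator (strip a b) :: _ \<Rightarrow> real) \<in> borel_measurable H" by (rule borel_measurable_H) measurable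
  have sh [measurable]: "(\<lambda>z. \<phi> (shift r z)) \<in> borel_measurable H" for r
    using measurable_compose[OF shift_measurable(1)[of r], of \<phi> borel] \<phi>m
    by (intro borel_measurable_H) (simp add: measurable_P)
  define \<epsilon> where "\<epsilon> n = inverse (real (Suc n))" for n
  have \<epsilon>: "0 < \<epsilon> n" "\<epsilon> n \<le> 1" for n unfolding \<epsilon>_def by (auto simp: inverse_le_1_iff)
  have \<epsilon>_lim: "\<epsilon> \<longlonglongrightarrow> 0" unfolding \<epsilon>_def by (rule LIMSEQ_inverse_real_of_nat)
  define q where "q n z = (\<phi> (shift (- \<epsilon> n) z) - \<phi> z) / \<epsilon> n" for n z
  have lim: "(\<lambda>n. LINT z|H. u z * q n z) \<longlonglongrightarrow> (LINT z|H. u z * (- \<phi>' z))"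
  proof (rule integral_dominated_convergence[where w = "\<lambda>z. \<bar>K * (u z * indicator (strip a (b + 1)) z)\<bar>"])
    show "integrable H (\<lambda>z. \<bar>K * (u z * indicator (strip a (b + 1)) z)\<bar>)"
      using L2_loc_integrable_strip[OF u ab(1), of "b + 1"] ab by simp
    show "AE z in H. (\<lambda>n. u z * q n z) \<longlonglongrightarrow> u z * (- \<phi>' z)"
    proof (rule AE_I2)
      fix z :: "'a \<times> real"
      obtain x y where z: "z = (x, y)" by (cases z)
      have "((\<lambda>t. (\<phi> (x, y + t) - \<phi> (x, y)) / t) \<longlongrightarrow> \<phi>' (x, y)) (at 0)"
        using deriv[of x y] by (simp add: DERIV_def)
      moreover have "filterlim (\<lambda>n. - \<epsilon> n) (at 0) sequentially"
        unfolding filterlim_at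
      proof
        show "(\<lambda>n. - \<epsilon> n) \<longlonglongrightarrow> 0" using tendsto_minus[OF \<epsilon>_lim] by simp
        show "\<forall>\<^sub>F n in sequentially. - \<epsilon> n \<in> UNIV \<and> - \<epsilon> n \<noteq> 0" using \<epsilon>(1) by (simp add: order.strict_implies_not_eq[symmetric])
      qed
      ultimately have "(\<lambda>n. (\<phi> (x, y + - \<epsilon> n) - \<phi> (x, y)) / (- \<epsilon> n)) \<longlonglongrightarrow> \<phi>' (x, y)"
        by (rule filterlim_compose)
      then have "(\<lambda>n. - ((\<phi> (x, y + - \<epsilon> n) - \<phi> (x, y)) / (- \<epsilon> n))) \<longlonglongrightarrow> - \<phi>' (x, y)" by (rule tendsto_minus)
      then show "(\<lambda>n. u z * q n z) \<longlonglongrightarrow> u z * (- \<phi>' z)"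
        unfolding q_def z by (intro tendsto_mult tendsto_const) (simp add: shift_def)
    qed
    fix n
    have "\<bar>q n z\<bar> \<le> K * indicator (strip a (b + 1)) z" for z
    proof (cases "snd z \<in> {a..b + 1}")
      case True
      then have "z \<in> strip a (b + 1)" by (cases z) auto
      moreover have "\<bar>\<phi> (shift (- \<epsilon> n) z) - \<phi> z\<bar> \<le> K * \<bar>\<epsilon> n\<bar>"
        using difference_quotient_bound[OF deriv[of "fst z"], of K "snd z" "\<epsilon> n"] K(2) by (simp add: shift_def)
      ultimately show ?thesis using \<epsilon>(1)[of n] by (simp add: q_def field_simps)
    next
      case False
      then have "\<phi> z = 0" "\<phi> (shift (- \<epsilon> n) z) = 0"
        using supp[of z] supp[of "shift (- \<epsilon> n) z"] \<epsilon>[of n] by (auto simp: shift_def)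
      moreover have "0 \<le> K" using K(1)[of z] by linarith
      ultimately show ?thesis by (simp add: q_def)
    qed
    then have q_le: "\<bar>u z\<bar> * \<bar>q n z\<bar> \<le> \<bar>u z\<bar> * (K * indicator (strip a (b + 1)) z)" for z
      by (intro mult_left_mono) auto
    have "\<bar>u z * q n z\<bar> \<le> \<bar>K * (u z * indicator (strip a (b + 1)) z)\<bar>" for z
    proof -
      have "\<bar>u z\<bar> * (K * indicator (strip a (b + 1)) z) \<le> \<bar>u z\<bar> * (\<bar>K\<bar> * \<bar>indicator (strip a (b + 1)) z\<bar>)"
        by (intro mult_left_mono mult_mono) auto
      then show ?thesis using q_le[of z] by (simp only: abs_mult mult.left_commute)
    qed
    then show "AE z in H. norm (u z * q n z) \<le> \<bar>K * (u z * indicator (strip a (b + 1)) z)\<bar>" by simp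
    show "(\<lambda>z. u z * q n z) \<in> borel_measurable H" unfolding q_def by measurable
  qed measurable
  let ?N = "LINT z|H. (\<phi> z)\<^sup>2 * snd z powr (- p)"
  have N_int: "integrable H (\<lambda>z. (\<phi> z)\<^sup>2 * snd z powr (- p))" by (rule strip_test_weighted_square_integrable[OF \<phi>])
  have upper: "(LINT z|H. u z * q n z) \<le> (1 + \<epsilon> n / a) * C / 2 + ?N / 2" for n
  proof -
    let ?\<Delta> = "\<lambda>z. u (shift (\<epsilon> n) z) - u z"
    have Ls: "L2_loc \<gamma> (\<lambda>z. u (shift (\<epsilon> n) z))" by (rule L2_loc_shift[OF u \<epsilon>(1)])
    then have [measurable]: "(\<lambda>z. u (shift (\<epsilon> n) z)) \<in> borel_measurable H" unfolding L2_loc_def by blast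
    have \<Delta>_int: "integrable H (\<lambda>z. (?\<Delta> z)\<^sup>2 * snd z powr p * indicator (strip a b) z)"
    proof (rule integrableI_bounded)
      have "(\<integral>\<^sup>+z. ennreal (norm ((?\<Delta> z)\<^sup>2 * snd z powr p * indicator (strip a b) z)) \<partial>H)
          \<le> ennreal ((1 + \<epsilon> n / a) * (\<epsilon> n)\<^sup>2 * C)"
        using inc[OF ab \<epsilon>(1)[of n]] by (simp add: abs_mult)
      then show "(\<integral>\<^sup>+z. ennreal (norm ((?\<Delta> z)\<^sup>2 * snd z powr p * indicator (strip a b) z)) \<partial>H) < \<infinity>"
        by (rule le_less_trans) simp
    qed measurable
    have \<Delta>_le: "(LINT z|H. (?\<Delta> z)\<^sup>2 * snd z powr p * indicator (strip a b) z) \<le> (1 + \<epsilon> n / a) * (\<epsilon> n)\<^sup>2 * C"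
    proof (rule integral_real_bounded)
      show "0 \<le> (1 + \<epsilon> n / a) * (\<epsilon> n)\<^sup>2 * C" using C ab(1) \<epsilon>(1)[of n] by simp
      show "(\<integral>\<^sup>+z. ennreal ((?\<Delta> z)\<^sup>2 * snd z powr p * indicator (strip a b) z) \<partial>H) \<le> ennreal ((1 + \<epsilon> n / a) * (\<epsilon> n)\<^sup>2 * C)"
        by (rule inc[OF ab \<epsilon>(1)])
    qed
    note i1 = strip_test_integrable(1)[OF \<phi> u] and i2 = strip_test_integrable(1)[OF \<phi> Ls]
    have i3: "integrable H (\<lambda>z. u z * \<phi> (shift (- \<epsilon> n) z))"
    proof (rule L2_loc_integrable_mult[OF u _ _ ab(1)])
      show "(\<lambda>z. \<phi> (shift (- \<epsilon> n) z)) \<in> borel_measurable borel"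
        using measurable_compose[OF shift_measurable(1)[of "- \<epsilon> n"], of \<phi> borel] \<phi>m by (simp add: measurable_P)
      show "\<bar>\<phi> (shift (- \<epsilon> n) z)\<bar> \<le> K" for z by (rule K(1))
      show "a < b + 1" using ab by simp
      show "\<phi> (shift (- \<epsilon> n) z) = 0" if "snd z \<notin> {a..b + 1}" for z
        using that \<epsilon>[of n] by (intro supp) (auto simp: shift_def)
    qed
    have "(LINT z|H. u z * q n z) = (LINT z|H. (u z * \<phi> (shift (- \<epsilon> n) z) - u z * \<phi> z) / \<epsilon> n)"
      by (intro Bochner_Integration.integral_cong) (auto simp: q_def algebra_simps)
    also have "\<dots> = ((LINT z|H. u z * \<phi> (shift (- \<epsilon> n) z)) - (LINT z|H. u z * \<phi> z)) / \<epsilon> n"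
      using i1 i3 by simp
    also have "(LINT z|H. u z * \<phi> (shift (- \<epsilon> n) z)) = (LINT z|H. u (shift (\<epsilon> n) z) * \<phi> z)"
      by (rule integral_shift_test[OF um \<epsilon>(1) \<phi>m ab(1) supp, symmetric])
    also have "((LINT z|H. u (shift (\<epsilon> n) z) * \<phi> z) - (LINT z|H. u z * \<phi> z)) / \<epsilon> n
        = (LINT z|H. (u (shift (\<epsilon> n) z) * \<phi> z - u z * \<phi> z) / \<epsilon> n)"
      using i1 i2 by simp
    also have "\<dots> \<le> (LINT z|H. (?\<Delta> z)\<^sup>2 * snd z powr p * indicator (strip a b) z / (2 * (\<epsilon> n)\<^sup>2)
        + (\<phi> z)\<^sup>2 * snd z powr (- p) / 2)"
    proof (rule integral_mono)
      show "integrable H (\<lambda>z. (u (shift (\<epsilon> n) z) * \<phi> z - u z * \<phi> z) / \<epsilon> n)" using i1 i2 by simp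
      show "integrable H (\<lambda>z. (?\<Delta> z)\<^sup>2 * snd z powr p * indicator (strip a b) z / (2 * (\<epsilon> n)\<^sup>2)
        + (\<phi> z)\<^sup>2 * snd z powr (- p) / 2)" using \<Delta>_int N_int by simp
      fix z :: "'a \<times> real" assume "z \<in> space H"
      show "(u (shift (\<epsilon> n) z) * \<phi> z - u z * \<phi> z) / \<epsilon> n \<le> (?\<Delta> z)\<^sup>2 * snd z powr p * indicator (strip a b) z / (2 * (\<epsilon> n)\<^sup>2)
        + (\<phi> z)\<^sup>2 * snd z powr (- p) / 2"
      proof (cases "snd z \<in> {a..b}")
        case True
        then have ind: "z \<in> strip a b" by (cases z) auto
        define R where "R = snd z powr p"
        have R: "0 < R" "snd z powr (- p) = 1 / R"
          using True ab unfolding R_def by (auto simp: powr_minus inverse_eq_divide)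
        \<comment> \<open>Arithmetic-geometric mean inequality with the weight \<open>R\<close>.\<close>
        define X where "X = ?\<Delta> z / \<epsilon> n"
        have "0 \<le> (X * R - \<phi> z)\<^sup>2 / R" using R by simp
        also have "\<dots> = X\<^sup>2 * R - 2 * X * \<phi> z + (\<phi> z)\<^sup>2 / R"
          using R by (simp add: power2_eq_square field_simps)
        finally have "X * \<phi> z \<le> X\<^sup>2 * R / 2 + (\<phi> z)\<^sup>2 * (1 / R) / 2" by (simp add: field_simps)
        moreover have "(u (shift (\<epsilon> n) z) * \<phi> z - u z * \<phi> z) / \<epsilon> n = X * \<phi> z"
          unfolding X_def by (simp add: left_diff_distrib)
        moreover have "X\<^sup>2 * R / 2 = (?\<Delta> z)\<^sup>2 * snd z powr p * indicator (strip a b) z / (2 * (\<epsilon> n)\<^sup>2)"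
          using ind unfolding X_def R_def by (simp add: power_divide)
        ultimately show ?thesis using R(2) by simp
      qed (simp add: supp)
    qed
    also have "\<dots> = (LINT z|H. (?\<Delta> z)\<^sup>2 * snd z powr p * indicator (strip a b) z) / (2 * (\<epsilon> n)\<^sup>2) + ?N / 2"
      using \<Delta>_int N_int by simp
    also have "\<dots> \<le> (1 + \<epsilon> n / a) * (\<epsilon> n)\<^sup>2 * C / (2 * (\<epsilon> n)\<^sup>2) + ?N / 2"
      by (intro add_right_mono divide_right_mono \<Delta>_le) simp
    also have "\<dots> = (1 + \<epsilon> n / a) * C / 2 + ?N / 2" using \<epsilon>(1)[of n] by simp
    finally show ?thesis .
  qed
  have "(LINT z|H. u z * (- \<phi>' z)) \<le> C / 2 + ?N / 2"
  proof (rule LIMSEQ_le[OF lim])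
    show "(\<lambda>n. (1 + \<epsilon> n / a) * C / 2 + ?N / 2) \<longlonglongrightarrow> C / 2 + ?N / 2"
      using \<epsilon>_lim ab(1) by (auto intro!: tendsto_eq_intros)
    show "\<exists>N. \<forall>n\<ge>N. (LINT z|H. u z * q n z) \<le> (1 + \<epsilon> n / a) * C / 2 + ?N / 2" using upper by blast
  qed
  then show ?thesis by simp
qed

lemma strip_test_combination:
  assumes "strip_test \<phi> \<phi>'" "strip_test \<psi> \<psi>'"
  shows "strip_test (\<lambda>z. c * \<phi> z + d * \<psi> z) (\<lambda>z. c * \<phi>' z + d * \<psi>' z)"
proof -
  obtain a b K where 1: "0 < a" "a < b" "\<And>z. \<bar>\<phi> z\<bar> \<le> K" "\<And>z. \<bar>\<phi>' z\<bar> \<le> K"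
    "\<And>z. snd z \<notin> {a..b} \<Longrightarrow> \<phi> z = 0" "\<And>z. snd z \<notin> {a..b} \<Longrightarrow> \<phi>' z = 0"
    using assms(1) unfolding strip_test_def by blast
  obtain a' b' K' where 2: "0 < a'" "a' < b'" "\<And>z. \<bar>\<psi> z\<bar> \<le> K'" "\<And>z. \<bar>\<psi>' z\<bar> \<le> K'"
    "\<And>z. snd z \<notin> {a'..b'} \<Longrightarrow> \<psi> z = 0" "\<And>z. snd z \<notin> {a'..b'} \<Longrightarrow> \<psi>' z = 0"
    using assms(2) unfolding strip_test_def by blast
  have bd: "\<bar>c * s + d * t\<bar> \<le> \<bar>c\<bar> * K + \<bar>d\<bar> * K'" if "\<bar>s\<bar> \<le> K" "\<bar>t\<bar> \<le> K'" for s t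
  proof -
    have "\<bar>c * s + d * t\<bar> \<le> \<bar>c\<bar> * \<bar>s\<bar> + \<bar>d\<bar> * \<bar>t\<bar>" unfolding abs_mult[symmetric] by (rule abs_triangle_ineq)
    also have "\<dots> \<le> \<bar>c\<bar> * K + \<bar>d\<bar> * K'" using that by (intro add_mono mult_left_mono) auto
    finally show ?thesis .
  qed
  have m: "(\<lambda>z. c * \<phi> z + d * \<psi> z) \<in> borel_measurable borel" "(\<lambda>z. c * \<phi>' z + d * \<psi>' z) \<in> borel_measurable borel"
    using assms unfolding strip_test_def by auto
  have der: "((\<lambda>y. c * \<phi> (x, y) + d * \<psi> (x, y)) has_real_derivative c * \<phi>' (x, y) + d * \<psi>' (x, y)) (at y)" for x y
    using assms unfolding strip_test_def by (intro DERIV_add DERIV_cmult) blast+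
  have supp: "c * \<phi> z + d * \<psi> z = 0" "c * \<phi>' z + d * \<psi>' z = 0" if "snd z \<notin> {min a a'..max b b'}" for z
  proof -
    have "snd z \<notin> {a..b}" "snd z \<notin> {a'..b'}" using that by (auto simp: min_le_iff_disj le_max_iff_disj)
    then show "c * \<phi> z + d * \<psi> z = 0" "c * \<phi>' z + d * \<psi>' z = 0"
      by (simp_all add: 1(5,6) 2(5,6))
  qed
  show ?thesis unfolding strip_test_def
  proof (intro conjI allI exI)
    show "0 < min a a'" "min a a' < max b b'" using 1(1,2) 2(1,2) by auto
    fix z
    show "\<bar>c * \<phi> z + d * \<psi> z\<bar> \<le> \<bar>c\<bar> * K + \<bar>d\<bar> * K'" by (rule bd[OF 1(3) 2(3)])
    show "\<bar>c * \<phi>' z + d * \<psi>' z\<bar> \<le> \<bar>c\<bar> * K + \<bar>d\<bar> * K'" by (rule bd[OF 1(4) 2(4)])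
    show "snd z \<notin> {min a a'..max b b'} \<longrightarrow> c * \<phi> z + d * \<psi> z = 0 \<and> c * \<phi>' z + d * \<psi>' z = 0"
      using supp by blast
  qed (fact m der)+
qed

text \<open>Weak differentiability from a bound on increments: the functional bounded in the previous
  lemma is represented in the space with weight \<open>1/\<rho>\<close> by some \<open>g\<close>, and \<open>g/\<rho>\<close> is the derivative.\<close>

theorem weak_dy_from_increments:
  assumes u: "L2_loc \<gamma> u" and C: "0 \<le> C"
    and inc: "\<And>a b \<epsilon>. 0 < a \<Longrightarrow> a < b \<Longrightarrow> 0 < \<epsilon> \<Longrightarrow>
      (\<integral>\<^sup>+z. ennreal ((u (shift \<epsilon> z) - u z)\<^sup>2 * snd z powr p * indicator (strip a b) z) \<partial>H)
        \<le> ennreal ((1 + \<epsilon> / a) * \<epsilon>\<^sup>2 * C)"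
  obtains w where "weak_dy \<gamma> u w" "(\<integral>\<^sup>+z. ennreal ((w z)\<^sup>2 * snd z powr p) \<partial>H) \<le> ennreal C"
proof -
  define \<rho> where "\<rho> z = snd z powr (- p)" for z :: "'a \<times> real"
  have s [measurable]: "snd \<in> borel_measurable H"
    by (rule borel_measurable_H) (intro borel_measurable_continuous_onI continuous_intros)
  have \<rho>m [measurable]: "\<rho> \<in> borel_measurable H" unfolding \<rho>_def by measurable
  have \<rho>0: "0 \<le> \<rho> z" for z by (simp add: \<rho>_def)
  define M where "M = density H (\<lambda>z. ennreal (\<rho> z))"
  define S where "S = {\<phi>. \<exists>\<phi>'. strip_test \<phi> \<phi>'}"
  define L where "L \<phi> = - (LINT z|H. u z * deriv (\<lambda>y. \<phi> (fst z, y)) (snd z))" for \<phi>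
  have L_eq: "L \<phi> = - (LINT z|H. u z * \<phi>' z)" if "strip_test \<phi> \<phi>'" for \<phi> \<phi>'
  proof -
    have "deriv (\<lambda>y. \<phi> (fst z, y)) (snd z) = \<phi>' z" for z
      using that unfolding strip_test_def by (intro DERIV_imp_deriv) (metis prod.collapse)
    then show ?thesis by (simp add: L_def)
  qed
  have meas: "\<phi> \<in> borel_measurable H" if "\<phi> \<in> S" for \<phi>
    using that unfolding S_def strip_test_def by (auto intro: borel_measurable_H)
  have int_M: "(LINT z|M. k z) = (LINT z|H. \<rho> z * k z)" "integrable M k \<longleftrightarrow> integrable H (\<lambda>z. \<rho> z * k z)"
    if "k \<in> borel_measurable H" for k :: "'a \<times> real \<Rightarrow> real"
    unfolding M_def using that \<rho>0 by (simp_all add: integral_density integrable_density)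
  have sq_H: "integrable H (\<lambda>z. \<rho> z * (\<phi> z)\<^sup>2)" if "\<phi> \<in> S" for \<phi>
    using that strip_test_weighted_square_integrable[of \<phi> _ "- p"] unfolding S_def \<rho>_def by (auto simp: mult.commute)
  have mM: "borel_measurable M = borel_measurable H" unfolding M_def by (intro measurable_cong_sets) simp_all
  obtain g where g: "g \<in> borel_measurable M" "integrable M (\<lambda>z. (g z)\<^sup>2)" "(LINT z|M. (g z)\<^sup>2) \<le> C"
    and rep: "\<And>\<phi>. \<phi> \<in> S \<Longrightarrow> L \<phi> = (LINT z|M. g z * \<phi> z)"
  proof (rule L2_riesz[of S M L C])
    fix \<phi> assume \<phi>: "\<phi> \<in> S"
    show "\<phi> \<in> borel_measurable M" unfolding mM by (rule meas[OF \<phi>])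
    show "integrable M (\<lambda>z. (\<phi> z)\<^sup>2)" using meas[OF \<phi>] sq_H[OF \<phi>] by (simp add: int_M)
    obtain \<phi>' where \<phi>': "strip_test \<phi> \<phi>'" using \<phi> S_def by blast
    have "(LINT z|M. (\<phi> z)\<^sup>2) = (LINT z|H. (\<phi> z)\<^sup>2 * snd z powr (- p))"
      using meas[OF \<phi>] by (simp add: int_M \<rho>_def mult.commute)
    then show "L \<phi> \<le> C / 2 + (LINT z|M. (\<phi> z)\<^sup>2) / 2"
      using weak_derivative_functional_bound[OF u C inc \<phi>'] by (simp add: L_eq[OF \<phi>'])
  next
    have "strip_test (\<lambda>_. 0) (\<lambda>_. 0)"
      unfolding strip_test_def
      by (intro conjI, simp, simp, simp, rule exI[of _ 1], rule exI[of _ 2], rule exI[of _ 0]) simp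
    then show "(\<lambda>_. 0) \<in> S" unfolding S_def by blast
  next
    fix \<phi> \<psi> and c d :: real assume "\<phi> \<in> S" "\<psi> \<in> S"
    then obtain \<phi>' \<psi>' where 1: "strip_test \<phi> \<phi>'" "strip_test \<psi> \<psi>'" unfolding S_def by blast
    note 2 = strip_test_combination[OF 1, of c d]
    then show "(\<lambda>z. c * \<phi> z + d * \<psi> z) \<in> S" unfolding S_def by blast
    have "(LINT z|H. u z * (c * \<phi>' z + d * \<psi>' z)) = (LINT z|H. c * (u z * \<phi>' z) + d * (u z * \<psi>' z))"
      by (intro Bochner_Integration.integral_cong) (auto simp: algebra_simps)
    also have "\<dots> = c * (LINT z|H. u z * \<phi>' z) + d * (LINT z|H. u z * \<psi>' z)"
      using strip_test_integrable(2)[OF 1(1) u] strip_test_integrable(2)[OF 1(2) u] by simp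
    finally show "L (\<lambda>z. c * \<phi> z + d * \<psi> z) = c * L \<phi> + d * L \<psi>"
      by (simp add: L_eq[OF 1(1)] L_eq[OF 1(2)] L_eq[OF 2])
  qed blast
  have gm [measurable]: "g \<in> borel_measurable H" using g(1) unfolding mM .
  define w where "w z = \<rho> z * g z" for z
  have wm [measurable]: "w \<in> borel_measurable H" unfolding w_def by measurable
  have norm_w: "(\<integral>\<^sup>+z. ennreal ((w z)\<^sup>2 * snd z powr p) \<partial>H) \<le> ennreal C"
  proof -
    have "(\<integral>\<^sup>+z. ennreal ((w z)\<^sup>2 * snd z powr p) \<partial>H) = (\<integral>\<^sup>+z. ennreal (\<rho> z * (g z)\<^sup>2) \<partial>H)"
    proof (intro nn_integral_cong)
      fix z assume "z \<in> space H"
      then have "snd z powr (- p) * snd z powr p = 1" by (auto simp: powr_add[symmetric])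
      then have "(w z)\<^sup>2 * snd z powr p = \<rho> z * (g z)\<^sup>2"
        unfolding w_def \<rho>_def power2_eq_square by (metis (no_types, opaque_lifting) mult.assoc mult.commute mult_1)
      then show "ennreal ((w z)\<^sup>2 * snd z powr p) = ennreal (\<rho> z * (g z)\<^sup>2)" by simp
    qed
    also have "\<dots> = ennreal (LINT z|H. \<rho> z * (g z)\<^sup>2)"
      using g(2) \<rho>0 by (intro nn_integral_eq_integral) (auto simp: int_M)
    also have "\<dots> \<le> ennreal C" using g(3) by (intro ennreal_leI) (simp add: int_M)
    finally show ?thesis .
  qed
  have Lw: "L2_loc \<gamma> w" unfolding L2_loc_def
  proof (intro conjI allI impI wm)
    fix a b :: real assume ab: "0 < a \<and> a < b"
    define c where "c = a powr (- p) + b powr (- p)"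
    have c: "0 \<le> c" by (simp add: c_def)
    have "(\<integral>\<^sup>+z. ennreal ((w z)\<^sup>2 * indicator (strip a b) z) \<partial>H) \<le> (\<integral>\<^sup>+z. ennreal c * ennreal ((w z)\<^sup>2 * snd z powr p) \<partial>H)"
    proof (rule nn_integral_mono)
      fix z :: "'a \<times> real"
      have "(w z)\<^sup>2 * indicator (strip a b) z \<le> c * ((w z)\<^sup>2 * snd z powr p)"
      proof (cases "z \<in> strip a b")
        case True
        then have y: "a \<le> snd z" "snd z \<le> b" by auto
        then have "1 = snd z powr (- p) * snd z powr p" using ab by (simp add: powr_add[symmetric])
        also have "\<dots> \<le> c * snd z powr p"
          unfolding c_def using powr_strip_bound[of a "snd z" b "- p"] y ab by (intro mult_right_mono) auto
        finally have "(w z)\<^sup>2 * 1 \<le> (w z)\<^sup>2 * (c * snd z powr p)" by (intro mult_left_mono) auto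
        then show ?thesis using True by (simp add: mult.left_commute)
      qed (simp add: c)
      then show "ennreal ((w z)\<^sup>2 * indicator (strip a b) z) \<le> ennreal c * ennreal ((w z)\<^sup>2 * snd z powr p)"
        using c by (simp add: ennreal_mult[symmetric] ennreal_leI)
    qed
    also have "\<dots> = ennreal c * (\<integral>\<^sup>+z. ennreal ((w z)\<^sup>2 * snd z powr p) \<partial>H)"
      by (intro nn_integral_cmult) measurable
    also have "\<dots> \<le> ennreal c * ennreal C" by (intro mult_left_mono norm_w) simp
    also have "\<dots> < \<infinity>" by (simp add: ennreal_mult_less_top)
    finally show "(\<integral>\<^sup>+z. ennreal ((w z)\<^sup>2 * indicator (strip a b) z) \<partial>H) < \<infinity>" .
  qed
  have "weak_dy \<gamma> u w" unfolding weak_dy_def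
  proof (intro conjI allI impI u Lw)
    fix f :: "'a \<Rightarrow> real" and \<eta> assume "smooth_cylindrical f \<and> test_function \<eta>"
    then have t: "strip_test (\<lambda>z. f (fst z) * \<eta> (snd z)) (\<lambda>z. f (fst z) * deriv \<eta> (snd z))"
      using strip_test_tensor by blast
    then have S: "(\<lambda>z. f (fst z) * \<eta> (snd z)) \<in> S" unfolding S_def by blast
    have "(LINT z|H. u z * (f (fst z) * deriv \<eta> (snd z))) = - L (\<lambda>z. f (fst z) * \<eta> (snd z))"
      by (simp add: L_eq[OF t])
    also have "\<dots> = - (LINT z|H. \<rho> z * (g z * (f (fst z) * \<eta> (snd z))))"
      unfolding rep[OF S] using meas[OF S] by (simp add: int_M)
    finally show "(LINT z|H. u z * (f (fst z) * deriv \<eta> (snd z))) = - (LINT z|H. w z * (f (fst z) * \<eta> (snd z)))"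
      by (simp add: w_def mult.assoc)
  qed
  then show thesis using that norm_w by blast
qed

end

section \<open>The Dirichlet energy in the vertical direction\<close>

context wiener_direction
begin

abbreviation sym_half :: "('a \<times> real \<Rightarrow> real) \<Rightarrow> 'a \<times> real \<Rightarrow> real" where
  "sym_half \<equiv> ehrhard_sym_half (blinfun_apply xs) h"

lemma slice_measurable:
  fixes v :: "'a \<times> real \<Rightarrow> real"
  assumes "v \<in> borel_measurable H" "0 < y"
  shows "(\<lambda>x. v (x, y)) \<in> borel_measurable borel"
proof -
  have "ext v \<in> borel_measurable P" using ext_measurable[OF assms(1)] by (simp add: measurable_P)
  then have "(\<lambda>x. ext v (x, y)) \<in> borel_measurable \<gamma>" by (rule measurable_Pair1) simp
  then show ?thesis using assms(2) by (simp add: ext_def measurable_cong_sets[OF sets_gamma refl])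
qed

lemma nn_integral_H_iterated:
  assumes f: "f \<in> borel_measurable H"
  shows "(\<integral>\<^sup>+z. f z \<partial>H) = (\<integral>\<^sup>+y. \<integral>\<^sup>+x. f (x, y) \<partial>\<gamma> \<partial>restrict_space lborel {0<..})"
proof -
  interpret L: sigma_finite_measure "restrict_space lborel {0 :: real<..}"
    by (rule sigma_finite_measure_restrict_space) (auto intro: sigma_finite_lborel)
  interpret pair_sigma_finite \<gamma> "restrict_space lborel {0 :: real<..}" ..
  show ?thesis using nn_integral_snd[of f] f unfolding half_space_def by simp
qed

text \<open>The contraction on slices survives integration in \<open>y\<close> against any weight \<open>k\<close>.\<close>

lemma sym_half_contraction:
  assumes u: "u \<in> borel_measurable H" "u' \<in> borel_measurable H" and k [measurable]: "k \<in> borel_measurable borel"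
  shows "(\<integral>\<^sup>+z. ennreal ((sym_half u z - sym_half u' z)\<^sup>2) * k (snd z) \<partial>H)
    \<le> (\<integral>\<^sup>+z. ennreal ((u z - u' z)\<^sup>2) * k (snd z) \<partial>H)"
proof -
  have s [measurable]: "snd \<in> borel_measurable H"
    by (rule borel_measurable_H) (intro borel_measurable_continuous_onI continuous_intros)
  have [measurable]: "u \<in> borel_measurable H" "u' \<in> borel_measurable H"
    "sym_half u \<in> borel_measurable H" "sym_half u' \<in> borel_measurable H"
    using u sym_half_measurable by auto
  have "(\<integral>\<^sup>+z. ennreal ((sym_half u z - sym_half u' z)\<^sup>2) * k (snd z) \<partial>H)
    = (\<integral>\<^sup>+y. \<integral>\<^sup>+x. ennreal ((sym_half u (x, y) - sym_half u' (x, y))\<^sup>2) * k y \<partial>\<gamma> \<partial>restrict_space lborel {0<..})"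
    by (subst nn_integral_H_iterated) simp_all
  also have "\<dots> \<le> (\<integral>\<^sup>+y. \<integral>\<^sup>+x. ennreal ((u (x, y) - u' (x, y))\<^sup>2) * k y \<partial>\<gamma> \<partial>restrict_space lborel {0<..})"
  proof (rule nn_integral_mono)
    fix y :: real assume "y \<in> space (restrict_space lborel {0<..})"
    then have y: "0 < y" by (simp add: space_restrict_space)
    note m [measurable] = slice_measurable[OF u(1) y] slice_measurable[OF u(2) y]
    have [measurable]: "sym (\<lambda>x. u (x, y)) \<in> borel_measurable borel" "sym (\<lambda>x. u' (x, y)) \<in> borel_measurable borel"
      by (rule sym_measurable[OF m(1)], rule sym_measurable[OF m(2)])
    have "(\<integral>\<^sup>+x. ennreal ((sym_half u (x, y) - sym_half u' (x, y))\<^sup>2) * k y \<partial>\<gamma>)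
        = (\<integral>\<^sup>+x. ennreal ((sym (\<lambda>x. u (x, y)) x - sym (\<lambda>x. u' (x, y)) x)\<^sup>2) \<partial>\<gamma>) * k y"
      unfolding ehrhard_sym_half_def prod.case by (rule nn_integral_multc) measurable
    also have "\<dots> \<le> (\<integral>\<^sup>+x. ennreal ((u (x, y) - u' (x, y))\<^sup>2) \<partial>\<gamma>) * k y"
      by (intro mult_right_mono sym_contraction m) simp
    also have "\<dots> = (\<integral>\<^sup>+x. ennreal ((u (x, y) - u' (x, y))\<^sup>2) * k y \<partial>\<gamma>)"
      by (rule nn_integral_multc[symmetric]) measurable
    finally show "(\<integral>\<^sup>+x. ennreal ((sym_half u (x, y) - sym_half u' (x, y))\<^sup>2) * k y \<partial>\<gamma>)
        \<le> (\<integral>\<^sup>+x. ennreal ((u (x, y) - u' (x, y))\<^sup>2) * k y \<partial>\<gamma>)" .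
  qed
  also have "\<dots> = (\<integral>\<^sup>+z. ennreal ((u z - u' z)\<^sup>2) * k (snd z) \<partial>H)"
    by (subst nn_integral_H_iterated) simp_all
  finally show ?thesis .
qed

text \<open>Comparison with the zero function, which is its own symmetrisation.\<close>

lemma sym_half_L2_loc:
  assumes "L2_loc \<gamma> u" shows "L2_loc \<gamma> (sym_half u)"
  unfolding L2_loc_def
proof (intro conjI allI impI)
  have m: "u \<in> borel_measurable H" using assms unfolding L2_loc_def by blast
  then show "sym_half u \<in> borel_measurable H" by (rule sym_half_measurable)
  fix a b :: real assume ab: "0 < a \<and> a < b"
  have split: "ennreal (t * indicator (strip a b) z) = ennreal t * indicator {a..b} (snd z)" for t and z :: "'a \<times> real"
    by (cases z) (auto simp: indicator_def)
  have zero: "sym_half (\<lambda>_. 0) z = 0" for z by (cases z) (simp add: ehrhard_sym_half_def sym_zero)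
  have "(\<integral>\<^sup>+z. ennreal ((sym_half u z)\<^sup>2 * indicator (strip a b) z) \<partial>H)
      \<le> (\<integral>\<^sup>+z. ennreal ((u z)\<^sup>2 * indicator (strip a b) z) \<partial>H)"
    using sym_half_contraction[OF m, of "\<lambda>_. 0" "indicator {a..b}"] unfolding split by (simp add: zero)
  also have "\<dots> < \<infinity>" using assms ab unfolding L2_loc_def by simp
  finally show "(\<integral>\<^sup>+z. ennreal ((sym_half u z)\<^sup>2 * indicator (strip a b) z) \<partial>H) < \<infinity>" .
qed

text \<open>Symmetrisation acts slice by slice and therefore commutes with vertical translations.\<close>

lemma sym_half_increment:
  assumes u: "L2_loc \<gamma> u" and \<epsilon>: "0 < \<epsilon>"
  shows "(\<integral>\<^sup>+z. ennreal ((sym_half u (shift \<epsilon> z) - sym_half u z)\<^sup>2 * snd z powr p * indicator (strip a b) z) \<partial>H)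
    \<le> (\<integral>\<^sup>+z. ennreal ((u (shift \<epsilon> z) - u z)\<^sup>2 * snd z powr p * indicator (strip a b) z) \<partial>H)"
proof -
  have m: "u \<in> borel_measurable H" "(\<lambda>z. u (shift \<epsilon> z)) \<in> borel_measurable H"
    using u L2_loc_shift[OF u \<epsilon>] unfolding L2_loc_def by blast+
  have comm: "sym_half u (shift \<epsilon> z) = sym_half (\<lambda>z. u (shift \<epsilon> z)) z" for z
    by (cases z) (simp add: ehrhard_sym_half_def shift_def)
  have split: "ennreal (t\<^sup>2 * snd z powr p * indicator (strip a b) z)
      = ennreal (t\<^sup>2) * (ennreal (snd z powr p) * indicator {a..b} (snd z))" for t and z :: "'a \<times> real"
    by (cases z) (auto simp: indicator_def ennreal_mult)
  show ?thesis unfolding comm split by (rule sym_half_contraction[OF m(2,1)]) measurable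
qed

end

theorem lemma3p1:
  fixes \<gamma> :: "'a::{banach,second_countable_topology} measure"
    and s :: real
    and v :: "'a \<times> real \<Rightarrow> real"
    and xs :: "'a \<Rightarrow>\<^sub>L real"
    and h :: 'a
  assumes "abstract_wiener_measure \<gamma>"
    and "0 < s" and "s < 1"
    and "v \<in> H1_weighted \<gamma> s"
    and "h = cov_op \<gamma> xs" and "cm_norm \<gamma> h = 1"
  shows "J1 \<gamma> s (ehrhard_sym_half (blinfun_apply xs) h v) \<le> J1 \<gamma> s v"
proof -
  interpret wiener_direction \<gamma> xs h by unfold_locales fact+
  show ?thesis
  proof (cases "(\<exists>w. weak_dy \<gamma> v w) \<and> J1 \<gamma> s v \<noteq> \<infinity>")
    case True
    define p where "p = 1 - 2 * s"
    have p: "- 1 \<le> p" unfolding p_def using assms(3) by simp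
    have J1_eq: "J1 \<gamma> s u = (\<integral>\<^sup>+z. ennreal ((w z)\<^sup>2 * snd z powr p) \<partial>H)" if w: "weak_dy \<gamma> u w" for u w
    proof -
      have "weak_dy \<gamma> u (dy \<gamma> u)" unfolding dy_def by (rule someI[of "weak_dy \<gamma> u", OF w])
      from weak_dy_unique[OF this w] have "AE z in H. dy \<gamma> u z = w z" .
      then show ?thesis unfolding J1_def p_def using w by (auto intro!: nn_integral_cong_AE)
    qed
    obtain w where w: "weak_dy \<gamma> v w" using True by blast
    then have v: "L2_loc \<gamma> v" unfolding weak_dy_def by blast
    obtain C where C: "J1 \<gamma> s v = ennreal C" "0 \<le> C" using True by (cases "J1 \<gamma> s v") auto
    have "(\<integral>\<^sup>+z. ennreal ((sym_half v (shift \<epsilon> z) - sym_half v z)\<^sup>2 * snd z powr p * indicator (strip a b) z) \<partial>H)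
        \<le> ennreal ((1 + \<epsilon> / a) * \<epsilon>\<^sup>2 * C)" if "0 < a" "0 < \<epsilon>" for a b \<epsilon>
    proof -
      have "(\<integral>\<^sup>+z. ennreal ((sym_half v (shift \<epsilon> z) - sym_half v z)\<^sup>2 * snd z powr p * indicator (strip a b) z) \<partial>H)
          \<le> ennreal ((1 + \<epsilon> / a) * \<epsilon>\<^sup>2) * ennreal C"
        using order_trans[OF sym_half_increment[OF v that(2)] increment_bound[OF w that(2,1) p]]
        unfolding J1_eq[OF w, symmetric] C(1) .
      also have "\<dots> = ennreal ((1 + \<epsilon> / a) * \<epsilon>\<^sup>2 * C)"
        using that C(2) by (intro ennreal_mult[symmetric]) auto
      finally show ?thesis .
    qed
    then obtain w' where w': "weak_dy \<gamma> (sym_half v) w'" "(\<integral>\<^sup>+z. ennreal ((w' z)\<^sup>2 * snd z powr p) \<partial>H) \<le> ennreal C"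
      using weak_dy_from_increments[OF sym_half_L2_loc[OF v] C(2), of p] by blast
    then show ?thesis unfolding J1_eq[OF w'(1)] C(1) by simp
  next
    case False
    then have "J1 \<gamma> s v = \<infinity>"
      by (cases "\<exists>w. weak_dy \<gamma> v w") (blast, simp add: J1_def)
    then show ?thesis by simp
  qed
qed

end
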